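(* Let $K$ be an algebraically closed field of characteristic zero, $d\geq 4$, $\alpha\in K$ with $\alpha\neq 0$, and let $C\subset \mathbb{P}^2(K)$ be the plane curve $X^d+Y^{d-1}Z+\alpha YZ^{d-1}=0$. The full automorphism group of $C$ is as follows. (1) If $d\neq 4,6$, then $Aut(C)$ is the central extension $$\langle\sigma,\tau\mid \sigma^2=\tau^{d(d-2)}=1,\ \sigma\tau\sigma=\tau^{-(d-1)}\rangle$$ of $D_{2(d-2)}$ by $\mathbb{Z}/d\mathbb{Z}$. In particular, $|Aut(C)|=2d(d-2)$. (2) If $d=6$, then $Aut(C)$ is a central extension of $S_4$ by $\mathbb{Z}/6\mathbb{Z}$. Thus $|Aut(C)|=144$. (3) If $d=4$, then $C$ is isomorphic to the Fermat quartic $F_4: X^4+Y^4+Z^4=0$, and thus $Aut(C)\simeq(\mathbb{Z}/4\mathbb{Z})^2\rtimes S_3$.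
   Context: $Aut(C)$ is the full automorphism group of $C$ over $K$, identified with the finite subgroup of $PGL_3(K)$ preserving the defining equation of $C$. $D_{2n}$ denotes the dihedral group of order $2n$. *)

theory Defs
  imports
    "HOL-Analysis.Determinants"
    "HOL-Algebra.Elementary_Groups"
    "HOL-Algebra.Sym_Groups"
    "HOL-Computational_Algebra.Polynomial"
begin

section \<open>The projective linear group and automorphisms of plane curves\<close>

definition GL3 :: "('k::field^3^3) monoid" where
  "GL3 = \<lparr>carrier = {A. invertible A}, monoid.mult = (**), one = mat 1\<rparr>"

definition scalar_matrices :: "('k::field^3^3) set" where
  "scalar_matrices = {mat c |c. c \<noteq> 0}"

definition PGL3 :: "('k::field^3^3) set monoid" where
  "PGL3 = GL3 Mod scalar_matrices"

text \<open>A plane curve is given by a form, represented by its polynomial function on the affine cone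
  \<open>k^3\<close>; over an infinite field this determines the polynomial. An element of \<open>PGL3\<close> preserves the
  equation \<open>F = 0\<close> iff the substitution by any representing matrix multiplies \<open>F\<close> by a nonzero
  constant. The points \<open>v\<close> are moved by \<open>v \<mapsto> A v\<close>, so multiplication is composition.\<close>

definition curve_Aut :: "('k::field^3 \<Rightarrow> 'k) \<Rightarrow> ('k^3^3) set monoid" where
  "curve_Aut F = PGL3\<lparr>carrier :=
     {M \<in> carrier PGL3. \<forall>A\<in>M. \<exists>c. c \<noteq> 0 \<and> (\<forall>v. F (A *v v) = c * F v)}\<rparr>"

text \<open>The coordinates \<open>X, Y, Z\<close> are the components 1, 2, 3.\<close>

definition C_form :: "nat \<Rightarrow> 'k::field \<Rightarrow> 'k^3 \<Rightarrow> 'k" where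
  "C_form d \<alpha> v = (v$1)^d + (v$2)^(d-1) * v$3 + \<alpha> * v$2 * (v$3)^(d-1)"

definition fermat_form :: "nat \<Rightarrow> 'k::field^3 \<Rightarrow> 'k" where
  "fermat_form d v = (v$1)^d + (v$2)^d + (v$3)^d"


section \<open>Isomorphism of plane curves\<close>

text \<open>A point of the projective plane is the set of its homogeneous coordinate vectors.\<close>

definition proj_point :: "'k::field^3 \<Rightarrow> ('k^3) set" where
  "proj_point v = {c *s v |c. c \<noteq> 0}"

definition plane_curve :: "('k::field^3 \<Rightarrow> 'k) \<Rightarrow> ('k^3) set set" where
  "plane_curve F = {proj_point v |v. v \<noteq> 0 \<and> F v = 0}"

definition homogeneous_form :: "nat \<Rightarrow> ('k::field^3 \<Rightarrow> 'k) \<Rightarrow> bool" where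
  "homogeneous_form m F \<longleftrightarrow> (\<exists>c :: nat \<times> nat \<times> nat \<Rightarrow> 'k. \<forall>v.
     F v = (\<Sum>(i, j, l) \<in> {(i, j, l). i + j + l = m}.
              c (i, j, l) * (v$1)^i * (v$2)^j * (v$3)^l))"

text \<open>Morphisms of projective varieties: around every point the map is given by a triple of forms of
  the same degree without common zero at the point. Requiring agreement on the whole locus where
  the triple does not vanish is no restriction: away from a smaller neighbourhood the triple can be
  made to vanish by multiplying it with a suitable form.\<close>

definition curve_morphism ::
    "('k::field^3) set set \<Rightarrow> ('k^3) set set \<Rightarrow> (('k^3) set \<Rightarrow> ('k^3) set) \<Rightarrow> bool" where
  "curve_morphism C D \<phi> \<longleftrightarrow> \<phi> ` C \<subseteq> D \<and>
     (\<forall>P\<in>C. \<exists>m. \<exists>G :: 'k^3 \<Rightarrow> 'k^3.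
        (\<forall>i. homogeneous_form m (\<lambda>v. G v $ i)) \<and>
        (\<forall>v\<in>P. G v \<noteq> 0) \<and>
        (\<forall>v. v \<noteq> 0 \<and> proj_point v \<in> C \<and> G v \<noteq> 0 \<longrightarrow> \<phi> (proj_point v) = proj_point (G v)))"

definition curves_isomorphic :: "('k::field^3) set set \<Rightarrow> ('k^3) set set \<Rightarrow> bool" where
  "curves_isomorphic C D \<longleftrightarrow> (\<exists>\<phi> \<psi>. curve_morphism C D \<phi> \<and> curve_morphism D C \<psi> \<and>
     (\<forall>P\<in>C. \<psi> (\<phi> P) = P) \<and> (\<forall>Q\<in>D. \<phi> (\<psi> Q) = Q))"


section \<open>Groups given by generators and relations\<close>

text \<open>The letter \<open>(g, True)\<close> stands for the generator \<open>g\<close> and \<open>(g, False)\<close> for its inverse.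
  The pair \<open>(u, v)\<close> of words is the relation \<open>u = v\<close>.\<close>

type_synonym 'g word = "('g \<times> bool) list"

inductive presentation_eq :: "('g word \<times> 'g word) set \<Rightarrow> 'g word \<Rightarrow> 'g word \<Rightarrow> bool"
  for R where
  relation: "(u, v) \<in> R \<Longrightarrow> presentation_eq R u v"
| cancel: "presentation_eq R [(g, b), (g, \<not> b)] []"
| refl: "presentation_eq R u u"
| sym: "presentation_eq R u v \<Longrightarrow> presentation_eq R v u"
| trans: "presentation_eq R u v \<Longrightarrow> presentation_eq R v w \<Longrightarrow> presentation_eq R u w"
| append: "presentation_eq R u v \<Longrightarrow> presentation_eq R u' v' \<Longrightarrow> presentation_eq R (u @ u') (v @ v')"

definition presented_group :: "('g word \<times> 'g word) set \<Rightarrow> 'g word set monoid" where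
  "presented_group R = \<lparr>carrier = UNIV // {(u, v). presentation_eq R u v},
     monoid.mult = (\<lambda>A B. {w. \<exists>a\<in>A. \<exists>b\<in>B. presentation_eq R (a @ b) w}),
     one = {w. presentation_eq R [] w}\<rparr>"

datatype generator = gen_sigma | gen_tau

definition C_relations :: "nat \<Rightarrow> (generator word \<times> generator word) set" where
  "C_relations d =
    (let \<sigma> = (gen_sigma, True); \<tau> = (gen_tau, True); \<tau>_inv = (gen_tau, False)
     in {([\<sigma>, \<sigma>], []),
         (replicate (d * (d - 2)) \<tau>, []),
         ([\<sigma>, \<tau>, \<sigma>], replicate (d - 1) \<tau>_inv)})"


section \<open>Group extensions\<close>

text \<open>\<open>E\<close> is a central extension of \<open>Q\<close> by \<open>A\<close>: there is a short exact sequence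
  \<open>1 \<rightarrow> A \<rightarrow> E \<rightarrow> Q \<rightarrow> 1\<close> such that the image of \<open>A\<close> is central in \<open>E\<close>.\<close>

definition central_extension ::
    "('e, 'x) monoid_scheme \<Rightarrow> ('q, 'y) monoid_scheme \<Rightarrow> ('a, 'z) monoid_scheme \<Rightarrow> bool" where
  "central_extension E Q A \<longleftrightarrow> group E \<and> group Q \<and> group A \<and>
     (\<exists>\<iota> \<pi>. \<iota> \<in> mon A E \<and> \<pi> \<in> epi E Q \<and> \<iota> ` carrier A = kernel E Q \<pi> \<and>
        (\<forall>a\<in>carrier A. \<forall>x\<in>carrier E. \<iota> a \<otimes>\<^bsub>E\<^esub> x = x \<otimes>\<^bsub>E\<^esub> \<iota> a))"

definition semidirect_product ::
    "('n, 'x) monoid_scheme \<Rightarrow> ('h, 'y) monoid_scheme \<Rightarrow> ('h \<Rightarrow> 'n \<Rightarrow> 'n) \<Rightarrow> ('n \<times> 'h) monoid" where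
  "semidirect_product N H \<theta> = \<lparr>carrier = carrier N \<times> carrier H,
     monoid.mult = (\<lambda>(n, h) (n', h'). (n \<otimes>\<^bsub>N\<^esub> \<theta> h n', h \<otimes>\<^bsub>H\<^esub> h')),
     one = (\<one>\<^bsub>N\<^esub>, \<one>\<^bsub>H\<^esub>)\<rparr>"

text \<open>The dihedral group of order \<open>2 * n\<close>.\<close>

definition dihedral_group :: "nat \<Rightarrow> (int \<times> int) monoid" where
  "dihedral_group n = semidirect_product (integer_mod_group n) (integer_mod_group 2)
     (\<lambda>h x. if h = 0 then x else inv\<^bsub>integer_mod_group n\<^esub> x)"

text \<open>The action of \<open>S_3\<close> on \<open>(Z/n)^2\<close>, viewed as the quotient of \<open>(Z/n)^3\<close> by the diagonal, by
  permutation of the coordinates. The pair \<open>(a, b)\<close> stands for the class of \<open>(a, b, 0)\<close>, and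
  the class of \<open>(x, y, z)\<close> is \<open>(x - z, y - z)\<close>.\<close>

definition S3_action :: "nat \<Rightarrow> (nat \<Rightarrow> nat) \<Rightarrow> int \<times> int \<Rightarrow> int \<times> int" where
  "S3_action n p ab =
    (let t = (\<lambda>i::nat. if i = 1 then fst ab else if i = 2 then snd ab else 0);
         q = inv_into UNIV p
     in ((t (q 1) - t (q 3)) mod int n, (t (q 2) - t (q 3)) mod int n))"

definition Zn_squared_S3 :: "nat \<Rightarrow> ((int \<times> int) \<times> (nat \<Rightarrow> nat)) monoid" where
  "Zn_squared_S3 n =
     semidirect_product (integer_mod_group n \<times>\<times> integer_mod_group n) (sym_group 3) (S3_action n)"

end

theory Submission
  imports Defs
begin

text \<open>For \<open>d \<ge> 5\<close> the polar of \<open>C\<close> at \<open>(1:0:0)\<close> is \<open>d X^(d-1)\<close>, a multiple line, and no other point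
  has such a polar. An automorphism therefore fixes this point and the line \<open>X = 0\<close>, and it becomes an
  automorphism of the binary form \<open>f = Y^(d-1) Z + \<alpha> Y Z^(d-1)\<close> once the coefficient of \<open>X\<close> is
  scaled to \<open>1\<close>. The second polar of \<open>f\<close> at \<open>(1:0)\<close> and \<open>(0:1)\<close> has a root of multiplicity \<open>d - 3\<close>;
  for \<open>d \<noteq> 6\<close> no other root of \<open>f\<close> has this property, so the automorphisms permute the axes and the
  group consists of monomial matrices. For \<open>d = 6\<close> the roots of \<open>f\<close> are the vertices of an octahedron, and
  \<open>S_4\<close> is the permutation group of its four pairs of opposite faces. For \<open>d = 4\<close> the form is a
  difference of two fourth powers, and the automorphisms of the Fermat curve are the monomial matrices because only the
  coordinate points have a multiple line as polar.\<close>

section \<open>The projective linear group\<close>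

text \<open>Polars are read off as the coefficient of t in F(w + t v), so their invariance is a
  comparison of polynomials in t. The restrictions on d come from such coefficients. The polar of
  any point, restricted to X = 0, involves only y^(d-1), y^(d-2), y and 1; the gap at y^(d-3) rules
  out a nonzero power of a linear form, and it exists only for d >= 5. For d = 6 nothing can single
  out the axes, since the six roots of f are equivalent. Over an algebraically closed field the
  parameter can be scaled to any nonzero value: 1 makes f symmetric in Y and Z, and -1 puts the
  octahedron at 0, infinity and the fourth roots of unity. A diagonal automorphism (p, s) of f
  satisfies p^(d-1) s = p s^(d-1) = 1, so s = p^(1-d) and the order of p divides (d-1)^2 - 1 = d
  (d-2); this is the origin of the exponents in the presentation. \<open>metacyclic_group\<close> is
  the model through which matrices, presentation and extension are compared.\<close>

lemma mat_mult_entry [simp]: "(mat c ** A) $ i $ j = c * A $ i $ j"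
  for A :: "'k::field^'n^'n"
  by (simp add: matrix_matrix_mult_def mat_def if_distrib[of "\<lambda>x. x * _"] sum.delta cong: if_cong)

lemma mult_mat_entry [simp]: "(A ** mat c) $ i $ j = A $ i $ j * c"
  for A :: "'k::field^'n^'n"
  by (simp add: matrix_matrix_mult_def mat_def if_distrib[of "\<lambda>x. _ * x"] sum.delta' cong: if_cong)

lemma mat_commute: "mat c ** A = A ** mat c" for A :: "'k::field^'n^'n"
  by (simp add: vec_eq_iff)

lemma mat_mult_mat: "mat c ** mat c' = (mat (c * c') :: 'k::field^'n^'n)"
  by (simp add: vec_eq_iff) (simp add: mat_def)

lemma mat_vector_mult: "mat c *v v = c *s v" for v :: "'k::field^'n"
  by (simp add: vec_eq_iff matrix_vector_mult_def mat_def if_distrib[of "\<lambda>x. x * _"] sum.delta cong: if_cong)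

lemma invertible_mat: "c \<noteq> 0 \<Longrightarrow> invertible (mat c :: 'k::field^'n^'n)"
  unfolding invertible_def by (rule exI[of _ "mat (inverse c)"]) (simp add: mat_mult_mat)

lemma invertible_inverse_matrix:
  assumes "invertible (A :: 'k::field^'n^'n)"
  obtains B where "invertible B" "A ** B = mat 1" "B ** A = mat 1"
  using assms unfolding invertible_def by blast

definition PGL_class :: "'k::field^3^3 \<Rightarrow> ('k^3^3) set" where
  "PGL_class A = {mat c ** A |c. c \<noteq> 0}"

lemma PGL_class_eq_iff: "PGL_class A = PGL_class B \<longleftrightarrow> (\<exists>c. c \<noteq> 0 \<and> B = mat c ** A)"
proof
  assume "PGL_class A = PGL_class B"
  moreover have "mat 1 ** B \<in> PGL_class B"
    unfolding PGL_class_def by (metis (mono_tags, lifting) mem_Collect_eq one_neq_zero)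
  ultimately show "\<exists>c. c \<noteq> 0 \<and> B = mat c ** A"
    by (auto simp: PGL_class_def)
next
  assume "\<exists>c. c \<noteq> 0 \<and> B = mat c ** A"
  then obtain c where c: "c \<noteq> 0" "B = mat c ** A" by blast
  have "mat b ** B = mat (b * c) ** A" for b
    by (simp add: c matrix_mul_assoc mat_mult_mat)
  moreover have "mat b ** A = mat (b / c) ** B" for b
    using c by (simp add: matrix_mul_assoc mat_mult_mat)
  moreover have "b / c \<noteq> 0 \<longleftrightarrow> b \<noteq> 0" "b * c \<noteq> 0 \<longleftrightarrow> b \<noteq> 0" for b
    using c(1) by auto
  ultimately show "PGL_class A = PGL_class B"
    unfolding PGL_class_def by blast
qed

lemma group_GL3: "group (GL3 :: ('k::field^3^3) monoid)"
proof (rule groupI)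
  fix x :: "'k^3^3"
  assume "x \<in> carrier GL3"
  then show "\<exists>y\<in>carrier GL3. y \<otimes>\<^bsub>GL3\<^esub> x = \<one>\<^bsub>GL3\<^esub>"
    by (auto simp: GL3_def elim: invertible_inverse_matrix)
qed (auto simp: GL3_def invertible_mult matrix_mul_assoc invertible_mat)

lemma normal_scalar_matrices: "(scalar_matrices :: ('k::field^3^3) set) \<lhd> GL3"
proof -
  interpret group "GL3 :: ('k^3^3) monoid" by (rule group_GL3)
  have inv_mat: "inv\<^bsub>GL3\<^esub> (mat c) = (mat (inverse c) :: 'k^3^3)" if "c \<noteq> 0" for c
    using that by (intro inv_equality) (auto simp: GL3_def mat_mult_mat invertible_mat)
  have "subgroup (scalar_matrices :: ('k^3^3) set) GL3"
  proof (rule subgroupI)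
    show "scalar_matrices \<subseteq> carrier (GL3 :: ('k^3^3) monoid)"
      by (auto simp: scalar_matrices_def GL3_def invertible_mat)
    show "scalar_matrices \<noteq> ({} :: ('k^3^3) set)"
      unfolding scalar_matrices_def using one_neq_zero by blast
  next
    fix a :: "'k^3^3" assume "a \<in> scalar_matrices"
    then show "inv\<^bsub>GL3\<^esub> a \<in> scalar_matrices"
      by (auto simp: scalar_matrices_def inv_mat)
  next
    fix a b :: "'k^3^3" assume "a \<in> scalar_matrices" "b \<in> scalar_matrices"
    then show "a \<otimes>\<^bsub>GL3\<^esub> b \<in> scalar_matrices"
      by (auto simp: scalar_matrices_def GL3_def mat_mult_mat)
  qed
  moreover have "x \<otimes>\<^bsub>GL3\<^esub> h \<otimes>\<^bsub>GL3\<^esub> inv\<^bsub>GL3\<^esub> x \<in> scalar_matrices"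
    if x: "x \<in> carrier GL3" and h: "h \<in> scalar_matrices" for x h :: "'k^3^3"
  proof -
    have "x \<otimes>\<^bsub>GL3\<^esub> h = h \<otimes>\<^bsub>GL3\<^esub> x" and "h \<in> carrier GL3"
      using h by (auto simp: scalar_matrices_def GL3_def mat_commute invertible_mat)
    then show ?thesis using x h by (simp add: m_assoc)
  qed
  ultimately show ?thesis
    by (simp add: normal_inv_iff)
qed

lemma r_coset_scalar_matrices: "scalar_matrices #>\<^bsub>GL3\<^esub> A = PGL_class A"
  by (auto simp: r_coset_def scalar_matrices_def GL3_def PGL_class_def)

lemma carrier_PGL3: "carrier PGL3 = PGL_class ` {A. invertible A}"
  by (simp add: PGL3_def carrier_FactGroup r_coset_scalar_matrices) (simp add: GL3_def)

lemma one_PGL3: "\<one>\<^bsub>PGL3\<^esub> = PGL_class (mat 1)"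
  by (auto simp: PGL3_def scalar_matrices_def PGL_class_def)

lemma mult_PGL3:
  assumes "invertible A" "invertible B"
  shows "PGL_class A \<otimes>\<^bsub>PGL3\<^esub> PGL_class B = PGL_class (A ** B)"
  using normal.rcos_sum[OF normal_scalar_matrices, of A B] assms
  by (simp add: PGL3_def r_coset_scalar_matrices) (simp add: GL3_def)

section \<open>Matrices that preserve a form, and the group of their classes\<close>

definition preserves :: "('k::field^3 \<Rightarrow> 'k) \<Rightarrow> 'k^3^3 \<Rightarrow> bool" where
  "preserves F A \<longleftrightarrow> invertible A \<and> (\<exists>c. c \<noteq> 0 \<and> (\<forall>v. F (A *v v) = c * F v))"

text \<open>Weaker than \<open>homogeneous_form\<close>: the scaling law is what makes preservation
  independent of the matrix chosen in its class.\<close>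

definition homogeneous :: "nat \<Rightarrow> ('k::field^3 \<Rightarrow> 'k) \<Rightarrow> bool" where
  "homogeneous m F \<longleftrightarrow> (\<forall>c v. F (c *s v) = c ^ m * F v)"

text \<open>Replacing A by b A multiplies the factor c by b^m, so the test on all matrices of a
  class reduces to one representative.\<close>

lemma carrier_curve_Aut:
  assumes "homogeneous m F"
  shows "carrier (curve_Aut F) = PGL_class ` {A. preserves F A}"
proof -
  have "(\<forall>B\<in>PGL_class A. \<exists>c. c \<noteq> 0 \<and> (\<forall>v. F (B *v v) = c * F v))
        \<longleftrightarrow> (\<exists>c. c \<noteq> 0 \<and> (\<forall>v. F (A *v v) = c * F v))" (is "?l \<longleftrightarrow> ?r") for A
  proof
    assume ?l
    moreover have "mat 1 ** A \<in> PGL_class A"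
      unfolding PGL_class_def by (metis (mono_tags, lifting) mem_Collect_eq one_neq_zero)
    ultimately show ?r by simp
  next
    assume ?r
    then obtain c where c: "c \<noteq> 0" "\<And>v. F (A *v v) = c * F v" by blast
    have "F ((mat b ** A) *v v) = (b ^ m * c) * F v" for b v
      using assms c(2) by (simp add: homogeneous_def mat_vector_mult flip: matrix_vector_mul_assoc)
    moreover have "b ^ m * c \<noteq> 0" if "b \<noteq> 0" for b
      using that c(1) by simp
    ultimately show ?l
      unfolding PGL_class_def by blast
  qed
  then show ?thesis
    unfolding curve_Aut_def preserves_def by (auto simp: carrier_PGL3)
qed

lemma mult_curve_Aut:
  assumes "preserves F A" "preserves F B"
  shows "PGL_class A \<otimes>\<^bsub>curve_Aut F\<^esub> PGL_class B = PGL_class (A ** B)"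
  using assms by (simp add: curve_Aut_def mult_PGL3 preserves_def)

lemma one_curve_Aut: "\<one>\<^bsub>curve_Aut F\<^esub> = PGL_class (mat 1)"
  by (simp add: curve_Aut_def one_PGL3)

lemma preserves_mult: "preserves F A \<Longrightarrow> preserves F B \<Longrightarrow> preserves F (A ** B)"
  unfolding preserves_def
  by (auto simp: invertible_mult simp flip: matrix_vector_mul_assoc)
     (metis mult.assoc mult_eq_0_iff)

lemma preserves_mat1: "preserves F (mat 1)"
  by (auto simp: preserves_def invertible_mat intro!: exI[of _ 1])

lemma preserves_inverse:
  assumes "preserves F A" "A ** B = mat 1" "B ** A = mat 1"
  shows "preserves F B"
proof -
  obtain c where c: "c \<noteq> 0" "\<And>v. F (A *v v) = c * F v"
    using assms(1) by (auto simp: preserves_def)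
  have "F (B *v v) = inverse c * F v" for v
    using c(2)[of "B *v v"] c(1) assms(2) by (simp add: matrix_vector_mul_assoc)
  then show ?thesis
    unfolding preserves_def invertible_def using assms(2,3) c(1)
    by (metis inverse_nonzero_iff_nonzero)
qed

lemma group_curve_Aut:
  assumes "homogeneous m F"
  shows "group (curve_Aut F)"
proof (rule groupI)
  note carrier = carrier_curve_Aut[OF assms]
  fix x assume "x \<in> carrier (curve_Aut F)"
  then obtain A where A: "x = PGL_class A" "preserves F A" by (auto simp: carrier)
  obtain B where "A ** B = mat 1" "B ** A = mat 1"
    using A by (auto simp: preserves_def elim: invertible_inverse_matrix)
  with A show "\<exists>y\<in>carrier (curve_Aut F). y \<otimes>\<^bsub>curve_Aut F\<^esub> x = \<one>\<^bsub>curve_Aut F\<^esub>"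
    by (intro bexI[of _ "PGL_class B"])
      (auto simp: carrier one_curve_Aut mult_curve_Aut preserves_inverse)
  show "\<one>\<^bsub>curve_Aut F\<^esub> \<otimes>\<^bsub>curve_Aut F\<^esub> x = x"
    using A by (simp add: one_curve_Aut mult_curve_Aut preserves_mat1)
next
  note carrier = carrier_curve_Aut[OF assms]
  show "\<one>\<^bsub>curve_Aut F\<^esub> \<in> carrier (curve_Aut F)"
    by (simp add: carrier one_curve_Aut preserves_mat1)
  fix x y assume "x \<in> carrier (curve_Aut F)" "y \<in> carrier (curve_Aut F)"
  then obtain A B where AB: "x = PGL_class A" "preserves F A" "y = PGL_class B" "preserves F B"
    by (auto simp: carrier)
  then show "x \<otimes>\<^bsub>curve_Aut F\<^esub> y \<in> carrier (curve_Aut F)"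
    by (simp add: carrier mult_curve_Aut preserves_mult)
  fix z assume "z \<in> carrier (curve_Aut F)"
  then obtain C where "z = PGL_class C" "preserves F C"
    by (auto simp: carrier)
  with AB show "x \<otimes>\<^bsub>curve_Aut F\<^esub> y \<otimes>\<^bsub>curve_Aut F\<^esub> z = x \<otimes>\<^bsub>curve_Aut F\<^esub> (y \<otimes>\<^bsub>curve_Aut F\<^esub> z)"
    by (simp add: mult_curve_Aut preserves_mult matrix_mul_assoc)
qed

text \<open>\<open>M\<close> has to be multiplicative only up to scalars. The Fermat curve needs
  this freedom: there a product of normalised matrices is normalised again only after division by a
  root of unity.\<close>

lemma curve_Aut_isoI:
  fixes M :: "'h \<Rightarrow> 'k::field^3^3"
  assumes hom: "homogeneous m F" and H: "group H"
    and pres: "\<And>h. h \<in> carrier H \<Longrightarrow> preserves F (M h)"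
    and mult: "\<And>h h'. h \<in> carrier H \<Longrightarrow> h' \<in> carrier H \<Longrightarrow>
                 PGL_class (M (h \<otimes>\<^bsub>H\<^esub> h')) = PGL_class (M h ** M h')"
    and inj: "\<And>h h'. h \<in> carrier H \<Longrightarrow> h' \<in> carrier H \<Longrightarrow>
                 PGL_class (M h) = PGL_class (M h') \<Longrightarrow> h = h'"
    and surj: "\<And>A. preserves F A \<Longrightarrow> \<exists>h\<in>carrier H. PGL_class (M h) = PGL_class A"
  shows "curve_Aut F \<cong> H"
proof -
  have "(\<lambda>h. PGL_class (M h)) \<in> iso H (curve_Aut F)"
    unfolding iso_def bij_betw_def inj_on_def
  proof (intro CollectI conjI homI)
    show "(\<lambda>h. PGL_class (M h)) ` carrier H = carrier (curve_Aut F)"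
      using surj pres by (fastforce simp: carrier_curve_Aut[OF hom])
  qed (use assms in \<open>auto simp: carrier_curve_Aut[OF hom] mult_curve_Aut\<close>)
  then show ?thesis
    using group.iso_set_sym[OF H] is_isoI by blast
qed

text \<open>The isomorphism is conjugation, A to S A T with S inverse to T; it respects scalars,
  hence classes.\<close>

lemma curve_Aut_substitution:
  fixes T :: "'k::field^3^3"
  assumes hom: "homogeneous m G" and T: "invertible T" and c: "c \<noteq> 0"
    and F: "\<And>v. F v = c * G (T *v v)"
  shows "curve_Aut F \<cong> curve_Aut G"
proof -
  obtain S where S: "T ** S = mat 1" "S ** T = mat 1"
    using T by (auto elim: invertible_inverse_matrix)
  have S': "A ** T ** S = A" "A ** S ** T = A" for A
    by (simp_all add: S flip: matrix_mul_assoc)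
  have homF: "homogeneous m F"
    using hom by (simp add: homogeneous_def F vector_scalar_commute)
  have inv: "invertible T" "invertible S"
    unfolding invertible_def using S by blast+
  have G: "G v = inverse c * F (S *v v)" for v
    using c by (simp add: F matrix_vector_mul_assoc S)
  have conj: "preserves F (S ** A ** T)" if "preserves G A" for A
    using that inv c unfolding preserves_def
    by (auto simp: F invertible_mult matrix_vector_mul_assoc matrix_mul_assoc S)
       (metis matrix_vector_mul_assoc mult.left_commute)
  have conj': "preserves G (T ** A ** S)" if "preserves F A" for A
    using that inv c unfolding preserves_def
    by (auto simp: G invertible_mult matrix_vector_mul_assoc matrix_mul_assoc S)
       (metis matrix_vector_mul_assoc mult.left_commute)
  \<comment> \<open>An arbitrary representative of each class; it is multiplicative only modulo
    scalars, which \<open>curve_Aut_isoI\<close> allows.\<close>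
  define rep where "rep X = (SOME A. preserves G A \<and> X = PGL_class A)" for X
  have rep: "preserves G (rep X)" "PGL_class (rep X) = X" if "X \<in> carrier (curve_Aut G)" for X
    using that someI_ex[of "\<lambda>A. preserves G A \<and> X = PGL_class A"]
    by (auto simp: rep_def carrier_curve_Aut[OF hom])
  have cong: "PGL_class (S ** A ** T) = PGL_class (S ** B ** T) \<longleftrightarrow> PGL_class A = PGL_class B" for A B
  proof -
    have "S ** B ** T = mat a ** (S ** A ** T) \<longleftrightarrow> B = mat a ** A" for a
    proof
      assume "S ** B ** T = mat a ** (S ** A ** T)"
      then have "T ** (S ** B ** T) ** S = T ** (S ** (mat a ** A) ** T) ** S"
        by (metis mat_commute matrix_mul_assoc)
      then show "B = mat a ** A"
        by (simp add: matrix_mul_assoc S S')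
    qed (metis mat_commute matrix_mul_assoc)
    then show ?thesis by (simp add: PGL_class_eq_iff)
  qed
  show ?thesis
  proof (rule curve_Aut_isoI[OF homF group_curve_Aut[OF hom], where M = "\<lambda>X. S ** rep X ** T"])
    fix X Y assume X: "X \<in> carrier (curve_Aut G)" and Y: "Y \<in> carrier (curve_Aut G)"
    have XY: "X \<otimes>\<^bsub>curve_Aut G\<^esub> Y \<in> carrier (curve_Aut G)"
      using X Y group_curve_Aut[OF hom] by (simp add: group.is_monoid monoid.m_closed)
    have "PGL_class (rep (X \<otimes>\<^bsub>curve_Aut G\<^esub> Y)) = PGL_class (rep X ** rep Y)"
      using rep X Y XY by (metis mult_curve_Aut)
    then have "PGL_class (S ** rep (X \<otimes>\<^bsub>curve_Aut G\<^esub> Y) ** T) = PGL_class (S ** (rep X ** rep Y) ** T)"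
      by (simp add: cong)
    then show "PGL_class (S ** rep (X \<otimes>\<^bsub>curve_Aut G\<^esub> Y) ** T) = PGL_class (S ** rep X ** T ** (S ** rep Y ** T))"
      by (simp add: matrix_mul_assoc S')
    show "X = Y" if "PGL_class (S ** rep X ** T) = PGL_class (S ** rep Y ** T)"
      using that rep X Y by (metis cong)
  next
    fix A assume A: "preserves F A"
    let ?X = "PGL_class (T ** A ** S)"
    have X: "?X \<in> carrier (curve_Aut G)"
      using conj'[OF A] by (simp add: carrier_curve_Aut[OF hom])
    then have "PGL_class (S ** rep ?X ** T) = PGL_class (S ** (T ** A ** S) ** T)"
      by (simp add: cong rep)
    then show "\<exists>X\<in>carrier (curve_Aut G). PGL_class (S ** rep X ** T) = PGL_class A"
      using X by (auto simp: matrix_mul_assoc S S' intro!: bexI[of _ ?X])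
  qed (simp add: rep conj)
qed

section \<open>Semidirect products, central extensions and presentations\<close>

lemma group_semidirect_product:
  assumes N: "group N" and H: "group H"
    and hom: "\<And>h. h \<in> carrier H \<Longrightarrow> \<theta> h \<in> hom N N"
    and one: "\<And>x. x \<in> carrier N \<Longrightarrow> \<theta> \<one>\<^bsub>H\<^esub> x = x"
    and mult: "\<And>h h' x. h \<in> carrier H \<Longrightarrow> h' \<in> carrier H \<Longrightarrow> x \<in> carrier N \<Longrightarrow>
                 \<theta> (h \<otimes>\<^bsub>H\<^esub> h') x = \<theta> h (\<theta> h' x)"
  shows "group (semidirect_product N H \<theta>)"
proof -
  interpret N: group N by fact
  interpret H: group H by fact
  have closed: "\<theta> h x \<in> carrier N" if "h \<in> carrier H" "x \<in> carrier N" for h x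
    using hom[OF that(1)] that(2) by (auto simp: hom_def)
  have \<theta>_mult: "\<theta> h (x \<otimes>\<^bsub>N\<^esub> y) = \<theta> h x \<otimes>\<^bsub>N\<^esub> \<theta> h y"
    if "h \<in> carrier H" "x \<in> carrier N" "y \<in> carrier N" for h x y
    using hom[OF that(1)] that(2,3) by (auto simp: hom_def)
  have \<theta>_one: "\<theta> h \<one>\<^bsub>N\<^esub> = \<one>\<^bsub>N\<^esub>" if "h \<in> carrier H" for h
    using hom_one[OF hom[OF that] N N] .
  show ?thesis
  proof (rule groupI)
    fix x assume "x \<in> carrier (semidirect_product N H \<theta>)"
    then obtain n h where x: "x = (n, h)" "n \<in> carrier N" "h \<in> carrier H"
      by (auto simp: semidirect_product_def)
    show "\<exists>y\<in>carrier (semidirect_product N H \<theta>).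
            y \<otimes>\<^bsub>semidirect_product N H \<theta>\<^esub> x = \<one>\<^bsub>semidirect_product N H \<theta>\<^esub>"
      using x
      by (intro bexI[of _ "(\<theta> (inv\<^bsub>H\<^esub> h) (inv\<^bsub>N\<^esub> n), inv\<^bsub>H\<^esub> h)"])
        (simp_all add: semidirect_product_def closed \<theta>_one flip: \<theta>_mult)
  qed (auto simp: semidirect_product_def closed \<theta>_mult mult one N.m_assoc H.m_assoc)
qed

lemma order_semidirect_product:
  "Coset.order (semidirect_product N H \<theta>) = Coset.order N * Coset.order H"
  by (simp add: Coset.order_def semidirect_product_def card_cartesian_product)

lemma order_integer_mod_group: "n > 0 \<Longrightarrow> Coset.order (integer_mod_group n) = n"
  by (simp add: Coset.order_def carrier_integer_mod_group)

lemma carrier_integer_mod_group_2: "carrier (integer_mod_group 2) = {0, 1}"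
  by (auto simp: carrier_integer_mod_group)

text \<open>With n = d (d - 2) and k = 1 - d the pair (x, h) stands for tau^x sigma^h, and
  conjugation by sigma raises tau to the power k.\<close>

definition metacyclic_group :: "nat \<Rightarrow> int \<Rightarrow> (int \<times> int) monoid" where
  "metacyclic_group n k = semidirect_product (integer_mod_group n) (integer_mod_group 2)
     (\<lambda>h x. if h = 0 then x else (k * x) mod int n)"

text \<open>The condition on k makes multiplication by k an involution modulo n, so that Z/2
  acts.\<close>

lemma group_metacyclic_group:
  assumes n: "n > 0" and k: "(k * k) mod int n = 1 mod int n"
  shows "group (metacyclic_group n k)"
  unfolding metacyclic_group_def
proof (rule group_semidirect_product)
  fix h x :: int and h' assume *: "h \<in> carrier (integer_mod_group 2)" "h' \<in> carrier (integer_mod_group 2)"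
    and x: "x \<in> carrier (integer_mod_group n)"
  have "(k * k * x) mod int n = x"
    using k x n by (metis atLeastLessThan_iff carrier_integer_mod_group mod_mult_left_eq
      mod_pos_pos_trivial mult_1 not_gr_zero)
  then show "(if h \<otimes>\<^bsub>integer_mod_group 2\<^esub> h' = 0 then x else k * x mod int n) =
      (if h = 0 then (if h' = 0 then x else k * x mod int n)
       else k * (if h' = 0 then x else k * x mod int n) mod int n)"
    using * by (auto simp: carrier_integer_mod_group_2 mod_mult_right_eq mult.assoc)
next
  fix h :: int
  show "(\<lambda>x. if h = 0 then x else k * x mod int n) \<in> hom (integer_mod_group n) (integer_mod_group n)"
    using n by (auto simp: hom_def carrier_integer_mod_group mod_simps algebra_simps)
qed auto

lemma inv_metacyclic_group:
  assumes n: "n > 0" and k: "(k * k) mod int n = 1 mod int n"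
  shows "inv\<^bsub>metacyclic_group n k\<^esub> (0, 1) = (0, 1)"
    and "n > 1 \<Longrightarrow> inv\<^bsub>metacyclic_group n k\<^esub> (1, 0) = (int n - 1, 0)"
proof -
  interpret group "metacyclic_group n k" by (rule group_metacyclic_group[OF n k])
  show "inv\<^bsub>metacyclic_group n k\<^esub> (0, 1) = (0, 1)"
    using n by (intro inv_equality)
      (auto simp: metacyclic_group_def semidirect_product_def carrier_integer_mod_group)
  show "inv\<^bsub>metacyclic_group n k\<^esub> (1, 0) = (int n - 1, 0)" if "n > 1"
    using that by (intro inv_equality)
      (auto simp: metacyclic_group_def semidirect_product_def carrier_integer_mod_group)
qed

lemma group_dihedral_group:
  assumes "n > 0"
  shows "group (dihedral_group n)"
  unfolding dihedral_group_def
proof (rule group_semidirect_product)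
  let ?Z = "integer_mod_group n"
  interpret Z: comm_group ?Z by simp
  fix h :: int
  show "(\<lambda>x. if h = 0 then x else inv\<^bsub>?Z\<^esub> x) \<in> hom ?Z ?Z"
    by (rule homI) (auto simp: Z.inv_mult simp del: inv_integer_mod_group mult_integer_mod_group)
next
  let ?Z = "integer_mod_group n"
  interpret Z: comm_group ?Z by simp
  fix h h' x :: int assume "h \<in> carrier (integer_mod_group 2)" "h' \<in> carrier (integer_mod_group 2)"
    and "x \<in> carrier ?Z"
  then show "(if h \<otimes>\<^bsub>integer_mod_group 2\<^esub> h' = 0 then x else inv\<^bsub>?Z\<^esub> x) =
      (if h = 0 then (if h' = 0 then x else inv\<^bsub>?Z\<^esub> x)
       else inv\<^bsub>?Z\<^esub> (if h' = 0 then x else inv\<^bsub>?Z\<^esub> x))"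
    by (auto simp: carrier_integer_mod_group_2 simp del: inv_integer_mod_group)
qed auto

lemma mult_dihedral_group:
  assumes "x' \<in> carrier (integer_mod_group n)"
  shows "(x, h) \<otimes>\<^bsub>dihedral_group n\<^esub> (x', h') =
    ((if h = 0 then x + x' else x - x') mod int n, (h + h') mod 2)"
  using assms by (simp add: dihedral_group_def semidirect_product_def mod_simps)

section \<open>Central extensions\<close>

lemma central_extensionE:
  assumes "central_extension E Q A"
  obtains \<iota> \<pi> where "\<iota> \<in> mon A E" "\<pi> \<in> epi E Q" "\<iota> ` carrier A = kernel E Q \<pi>"
    "\<forall>a\<in>carrier A. \<forall>x\<in>carrier E. \<iota> a \<otimes>\<^bsub>E\<^esub> x = x \<otimes>\<^bsub>E\<^esub> \<iota> a"
  using assms unfolding central_extension_def by (elim conjE exE) (rule that)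

lemma central_extension_iso:
  assumes "E' \<cong> E" "group E'" "central_extension E Q A"
  shows "central_extension E' Q A"
proof -
  obtain f where f: "f \<in> iso E' E"
    using assms(1) by (auto simp: is_iso_def)
  let ?g = "inv_into (carrier E') f"
  have g: "?g \<in> iso E E'"
    using group.iso_set_sym[OF assms(2) f] .
  have fbij: "bij_betw f (carrier E') (carrier E)"
    using f by (simp add: iso_def)
  then have gf: "?g (f x) = x" if "x \<in> carrier E'" for x
    using that by (simp add: bij_betw_inv_into_left)
  have fg: "f (?g y) = y" if "y \<in> carrier E" for y
    using fbij that by (simp add: bij_betw_inv_into_right)
  obtain \<iota> \<pi> where \<iota>: "\<iota> \<in> mon A E" and \<pi>: "\<pi> \<in> epi E Q"
    and exact: "\<iota> ` carrier A = kernel E Q \<pi>"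
    and central: "\<forall>a\<in>carrier A. \<forall>x\<in>carrier E. \<iota> a \<otimes>\<^bsub>E\<^esub> x = x \<otimes>\<^bsub>E\<^esub> \<iota> a"
    using assms(3) by (rule central_extensionE)
  have f_closed: "f x \<in> carrier E" if "x \<in> carrier E'" for x
    using fbij that by (auto simp: bij_betw_def)
  have \<iota>_closed: "\<iota> a \<in> carrier E" if "a \<in> carrier A" for a
    using \<iota> that by (auto simp: mon_def hom_def)
  have "?g \<circ> \<iota> \<in> mon A E'"
    unfolding mon_def
  proof (intro CollectI conjI)
    show "?g \<circ> \<iota> \<in> hom A E'"
      using \<iota> g by (auto simp: mon_def iso_def intro: hom_compose)
    show "inj_on (?g \<circ> \<iota>) (carrier A)"
      using \<iota> by (auto simp: mon_def inj_on_def) (metis \<iota>_closed fg)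
  qed
  moreover have "\<pi> \<circ> f \<in> epi E' Q"
  proof -
    have "\<pi> \<circ> f \<in> hom E' Q"
      using \<pi> f by (auto simp: epi_def iso_def intro: hom_compose)
    moreover have "(\<pi> \<circ> f) ` carrier E' = carrier Q"
      using \<pi> fbij by (metis (mono_tags, lifting) bij_betw_def epi_def image_comp mem_Collect_eq)
    ultimately show ?thesis by (simp add: epi_def)
  qed
  moreover have "(?g \<circ> \<iota>) ` carrier A = kernel E' Q (\<pi> \<circ> f)"
  proof -
    have "(?g \<circ> \<iota>) ` carrier A = ?g ` kernel E Q \<pi>"
      by (metis exact image_comp)
    also have "\<dots> = kernel E' Q (\<pi> \<circ> f)"
    proof (intro equalityI subsetI)
      fix x assume "x \<in> ?g ` kernel E Q \<pi>"
      then show "x \<in> kernel E' Q (\<pi> \<circ> f)"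
        using g by (auto simp: kernel_def fg iso_def hom_def)
    next
      fix x assume "x \<in> kernel E' Q (\<pi> \<circ> f)"
      then show "x \<in> ?g ` kernel E Q \<pi>"
        by (intro image_eqI[of _ _ "f x"]) (auto simp: kernel_def gf f_closed)
    qed
    finally show ?thesis .
  qed
  moreover have "(?g \<circ> \<iota>) a \<otimes>\<^bsub>E'\<^esub> x = x \<otimes>\<^bsub>E'\<^esub> (?g \<circ> \<iota>) a"
    if a: "a \<in> carrier A" and x: "x \<in> carrier E'" for a x
  proof -
    have "?g (\<iota> a \<otimes>\<^bsub>E\<^esub> f x) = ?g (f x \<otimes>\<^bsub>E\<^esub> \<iota> a)"
      by (simp add: central a x f_closed)
    then show ?thesis
      using hom_mult[OF iso_imp_homomorphism[OF g]] a x by (simp add: \<iota>_closed f_closed gf)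
  qed
  ultimately show ?thesis
    using assms(2,3) unfolding central_extension_def by (intro conjI exI[of _ "?g \<circ> \<iota>"] exI[of _ "\<pi> \<circ> f"]) auto
qed

text \<open>The first isomorphism theorem identifies the cosets of the kernel with Q, and Lagrange's
  theorem counts them. Both orders in the theorem come from here.\<close>

lemma order_central_extension:
  assumes "central_extension E Q A"
  shows "Coset.order E = Coset.order A * Coset.order Q"
proof -
  obtain \<iota> \<pi> where \<iota>: "\<iota> \<in> mon A E" and \<pi>: "\<pi> \<in> epi E Q"
    and exact: "\<iota> ` carrier A = kernel E Q \<pi>"
    using assms by (rule central_extensionE)
  interpret group_hom E Q \<pi>
    using assms \<pi> by (simp add: group_hom_def group_hom_axioms_def central_extension_def epi_def)
  have "E Mod kernel E Q \<pi> \<cong> Q"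
    using \<pi> by (intro FactGroup_iso) (simp add: epi_def)
  then have "card (rcosets\<^bsub>E\<^esub> kernel E Q \<pi>) = Coset.order Q"
    using iso_same_card by (fastforce simp: FactGroup_def Coset.order_def)
  moreover have "card (kernel E Q \<pi>) = Coset.order A"
    using \<iota> by (simp add: mon_def Coset.order_def card_image flip: exact)
  ultimately show ?thesis
    using G.lagrange[OF subgroup_kernel] by (simp add: mult.commute)
qed

lemma metacyclic_square:
  assumes "d \<ge> 3"
  shows "((1 - int d) * (1 - int d)) mod int (d * (d - 2)) = 1 mod int (d * (d - 2))"
proof -
  have "(1 - int d) * (1 - int d) = 1 + int (d * (d - 2)) * 1"
    using assms by (simp add: of_nat_diff algebra_simps)
  then show ?thesis by (simp only: mod_mult_self2)
qed

text \<open>Put m = d - 2. Modulo m the multiplier 1 - d is -1, so reducing the first coordinate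
  modulo m gives the dihedral group. The kernel consists of the multiples of m, and it is central
  because (1 - d) m a differs from m a by a multiple of m d.\<close>

lemma central_extension_metacyclic_group:
  assumes d: "d \<ge> 3"
  shows "central_extension (metacyclic_group (d * (d - 2)) (1 - int d)) (dihedral_group (d - 2))
           (integer_mod_group d)" (is "central_extension ?E ?Q ?A")
  unfolding central_extension_def
proof (intro conjI exI)
  define m where "m = int d - 2"
  have m: "m > 0" "int (d - 2) = m" and md: "int d = m + 2" and N: "int (d * (d - 2)) = m * int d"
    using d by (auto simp: m_def of_nat_diff mult.commute)
  \<comment> \<open>Keeps \<open>int (d * (d - 2))\<close> intact, so that it can be rewritten to
    \<open>m * int d\<close>.\<close>
  note [simp del] = of_nat_mult
  have E: "carrier ?E = {0..<m * int d} \<times> {0, 1}"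
    "x \<otimes>\<^bsub>?E\<^esub> y = ((fst x + (if snd x = 0 then fst y else ((1 - int d) * fst y) mod (m * int d))) mod (m * int d),
                 (snd x + snd y) mod 2)" for x y
    using m(1) d by (auto simp: metacyclic_group_def semidirect_product_def carrier_integer_mod_group N split: prod.splits)
  have Q: "carrier ?Q = {0..<m} \<times> {0, 1}" "\<one>\<^bsub>?Q\<^esub> = (0, 0)"
    using m d by (auto simp: dihedral_group_def semidirect_product_def carrier_integer_mod_group)
  have A: "carrier ?A = {0..<int d}"
    using d by (auto simp: carrier_integer_mod_group)
  show "group ?E"
    using d by (intro group_metacyclic_group metacyclic_square) auto
  show "group ?Q"
    using d by (intro group_dihedral_group) auto
  show "group ?A" by simp
  let ?\<iota> = "\<lambda>a. (m * a, 0 :: int)" and ?\<pi> = "\<lambda>(x, h). (x mod m, h :: int)"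
  show "?\<iota> \<in> mon ?A ?E"
    using m(1) by (auto simp: mon_def hom_def E A inj_on_def mult_left_mono simp flip: mult_mod_right distrib_left)
  show "?\<pi> \<in> epi ?E ?Q"
    unfolding epi_def
  proof (intro CollectI conjI homI)
    show "?\<pi> ` carrier ?E = carrier ?Q"
    proof (intro equalityI subsetI)
      fix y assume "y \<in> carrier ?Q"
      moreover have "x < m * int d" if "x < m" for x
      proof -
        have "m * 1 \<le> m * int d"
          using m(1) d by (intro mult_left_mono) linarith+
        with that show ?thesis by linarith
      qed
      ultimately have "y \<in> carrier ?E" "y = ?\<pi> y"
        unfolding Q E by auto
      then show "y \<in> ?\<pi> ` carrier ?E"
        by (metis image_eqI)
    qed (use m in \<open>auto simp: E Q\<close>)
  next
    fix x y assume x: "x \<in> carrier ?E" and y: "y \<in> carrier ?E"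
    obtain a h b h' where xy: "x = (a, h)" "y = (b, h')" by fastforce
    have "((1 - int d) * b) mod m = (- b) mod m"
    proof -
      have "(1 - int d) * b = - b + m * (- b)"
        by (simp add: md algebra_simps)
      then show ?thesis by (simp only: mod_mult_self2)
    qed
    then have "(a + (1 - int d) * b) mod m = (a - b) mod m"
      by (metis mod_add_right_eq uminus_add_conv_diff add.commute)
    moreover have "(a + (1 - int d) * b mod (m * int d)) mod m = (a + (1 - int d) * b) mod m"
      by (metis mod_add_right_eq mod_mod_cancel dvd_triv_left)
    moreover have "((a mod m) - (b mod m)) mod m = (a - b) mod m"
      by (simp add: mod_simps)
    moreover have "b mod m \<in> carrier (integer_mod_group (d - 2))"
      using m by (auto simp: carrier_integer_mod_group)
    ultimately show "?\<pi> (x \<otimes>\<^bsub>?E\<^esub> y) = ?\<pi> x \<otimes>\<^bsub>?Q\<^esub> ?\<pi> y"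
      unfolding xy E(2)
      by (simp add: mult_dihedral_group m mod_mod_cancel mod_simps)
  qed (use m in \<open>auto simp: E Q\<close>)
  show "?\<iota> ` carrier ?A = kernel ?E ?Q ?\<pi>"
  proof (intro equalityI subsetI)
    fix y assume "y \<in> kernel ?E ?Q ?\<pi>"
    then obtain x where x: "y = (x, 0)" "x mod m = 0" "0 \<le> x" "x < m * int d"
      by (auto simp: kernel_def E Q)
    then obtain a where "x = m * a" by (auto simp: mod_eq_0_iff_dvd)
    then show "y \<in> ?\<iota> ` carrier ?A"
      using x m(1) by (auto simp: A zero_le_mult_iff)
  qed (use m(1) in \<open>auto simp: kernel_def E Q A\<close>)
  show "\<forall>a\<in>carrier ?A. \<forall>x\<in>carrier ?E. ?\<iota> a \<otimes>\<^bsub>?E\<^esub> x = x \<otimes>\<^bsub>?E\<^esub> ?\<iota> a"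
  proof (intro ballI)
    fix a and x :: "int \<times> int"
    have "(1 - int d) * (m * a) = m * a + m * int d * (- a)"
      by (simp add: algebra_simps)
    then have "((1 - int d) * (m * a)) mod (m * int d) = (m * a) mod (m * int d)"
      by (simp only: mod_mult_self2)
    then have "(fst x + (1 - int d) * (m * a) mod (m * int d)) mod (m * int d) = (m * a + fst x) mod (m * int d)"
      by (metis mod_add_right_eq add.commute)
    then show "?\<iota> a \<otimes>\<^bsub>?E\<^esub> x = x \<otimes>\<^bsub>?E\<^esub> ?\<iota> a"
      unfolding E(2) fst_conv snd_conv by (cases "snd x = 0") (simp_all add: add.commute)
  qed
qed

section \<open>Words and presentations\<close>

definition word_eval :: "('a, 'x) monoid_scheme \<Rightarrow> ('g \<Rightarrow> 'a) \<Rightarrow> 'g word \<Rightarrow> 'a" where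
  "word_eval G f w = foldr (\<lambda>(g, b) x. (if b then f g else inv\<^bsub>G\<^esub> (f g)) \<otimes>\<^bsub>G\<^esub> x) w \<one>\<^bsub>G\<^esub>"

lemma word_eval_simps [simp]:
  "word_eval G f [] = \<one>\<^bsub>G\<^esub>"
  "word_eval G f ((g, b) # w) = (if b then f g else inv\<^bsub>G\<^esub> (f g)) \<otimes>\<^bsub>G\<^esub> word_eval G f w"
  by (simp_all add: word_eval_def)

lemma word_eval_closed [simp]:
  assumes "group G" "\<And>g. f g \<in> carrier G"
  shows "word_eval G f w \<in> carrier G"
proof -
  interpret group G by fact
  show ?thesis using assms by (induction w) auto
qed

lemma word_eval_append:
  assumes "group G" "\<And>g. f g \<in> carrier G"
  shows "word_eval G f (u @ v) = word_eval G f u \<otimes>\<^bsub>G\<^esub> word_eval G f v"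
proof -
  interpret group G by fact
  show ?thesis using assms by (induction u) (auto simp: m_assoc)
qed

text \<open>Von Dyck's principle: an assignment of the generators that satisfies the relations
  respects all their consequences.\<close>

lemma presentation_eq_imp_word_eval_eq:
  assumes G: "group G" and f: "\<And>g. f g \<in> carrier G"
    and R: "\<And>u v. (u, v) \<in> R \<Longrightarrow> word_eval G f u = word_eval G f v"
    and "presentation_eq R u v"
  shows "word_eval G f u = word_eval G f v"
  using assms(4)
proof induction
  case (cancel g b)
  interpret group G by fact
  show ?case using f by simp
qed (use R in \<open>auto simp: word_eval_append[OF G f]\<close>)

text \<open>\<open>nf\<close> chooses normal forms. Since a letter in front of a normal form can be
  absorbed, induction reduces every word to the normal form of its value, and words of equal value
  become equal in the presented group.\<close>

lemma iso_presented_group: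
  assumes G: "group G" and f: "\<And>g. f g \<in> carrier G"
    and R: "\<And>u v. (u, v) \<in> R \<Longrightarrow> word_eval G f u = word_eval G f v"
    and nf_one: "nf \<one>\<^bsub>G\<^esub> = []"
    and nf_eval: "\<And>x. x \<in> carrier G \<Longrightarrow> word_eval G f (nf x) = x"
    and nf_Cons: "\<And>g b x. x \<in> carrier G \<Longrightarrow>
      presentation_eq R ((g, b) # nf x) (nf ((if b then f g else inv\<^bsub>G\<^esub> (f g)) \<otimes>\<^bsub>G\<^esub> x))"
  shows "G \<cong> presented_group R"
proof -
  let ?ev = "word_eval G f"
  have nf: "presentation_eq R w (nf (?ev w))" for w
  proof (induction w)
    case Nil
    show ?case by (simp add: nf_one presentation_eq.refl)
  next
    case (Cons l w)
    obtain g b where l: "l = (g, b)" by fastforce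
    have "presentation_eq R ([l] @ w) ([l] @ nf (?ev w))"
      by (intro presentation_eq.append presentation_eq.refl Cons.IH)
    moreover have "presentation_eq R ([l] @ nf (?ev w)) (nf (?ev (l # w)))"
      using nf_Cons[of "?ev w" g b] G f by (simp add: l)
    ultimately show ?case
      using presentation_eq.trans by fastforce
  qed
  have eq: "presentation_eq R u v \<longleftrightarrow> ?ev u = ?ev v" for u v
    using presentation_eq_imp_word_eval_eq[of G f R u v] G f R nf
    by (metis presentation_eq.sym presentation_eq.trans)
  have surj: "\<exists>w. ?ev w = x" if "x \<in> carrier G" for x
    using nf_eval[OF that] by blast
  have "(\<lambda>x. {w. ?ev w = x}) \<in> iso G (presented_group R)"
    unfolding iso_def bij_betw_def
  proof (intro CollectI conjI homI)
    have *: "{(u, v). presentation_eq R u v} `` {w} = {v. ?ev v = ?ev w}" for w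
      by (auto simp: eq)
    show "(\<lambda>x. {w. ?ev w = x}) ` carrier G = carrier (presented_group R)"
      unfolding presented_group_def quotient_def * by (auto simp: G f) (metis surj)
    then show "{w. ?ev w = x} \<in> carrier (presented_group R)" if "x \<in> carrier G" for x
      using that by blast
    show "inj_on (\<lambda>x. {w. ?ev w = x}) (carrier G)"
      by (rule inj_onI) (use surj in blast)
    fix x y assume "x \<in> carrier G" "y \<in> carrier G"
    then obtain a b where "?ev a = x" "?ev b = y" using surj by metis
    then show "{w. ?ev w = x \<otimes>\<^bsub>G\<^esub> y} = {w. ?ev w = x} \<otimes>\<^bsub>presented_group R\<^esub> {w. ?ev w = y}"
      by (auto simp: presented_group_def eq word_eval_append[OF G f])
  qed
  then show ?thesis by (rule is_isoI)
qed

text \<open>Normal forms are tau^x sigma^h with 0 <= x < n and h in {0, 1}. Letters are moved into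
  place by sigma tau = tau^e sigma, which the third relation yields after multiplication by sigma on
  the right.\<close>

lemma metacyclic_group_iso_presented_group:
  assumes d: "d \<ge> 4"
  shows "metacyclic_group (d * (d - 2)) (1 - int d) \<cong> presented_group (C_relations d)"
proof -
  define n where "n = d * (d - 2)"
  have "n \<ge> d * 1"
    unfolding n_def using d by (intro mult_le_mono) auto
  with d have n: "n > 1" "n \<ge> d" by auto
  have int_n: "int n = int d * (int d - 2)"
    using d by (simp add: n_def of_nat_diff)
  let ?G = "metacyclic_group n (1 - int d)"
  have G: "group ?G"
    unfolding n_def using d by (intro group_metacyclic_group metacyclic_square) auto
  interpret group ?G by fact
  have mult: "(x, h) \<otimes>\<^bsub>?G\<^esub> (x', h') =
      ((x + (if h = 0 then x' else ((1 - int d) * x') mod int n)) mod int n, (h + h') mod 2)" for x h x' h'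
    by (simp add: metacyclic_group_def semidirect_product_def)
  have one: "\<one>\<^bsub>?G\<^esub> = (0, 0)"
    by (simp add: metacyclic_group_def semidirect_product_def)
  have carrier: "carrier ?G = {0..<int n} \<times> {0, 1}"
    using n by (auto simp: metacyclic_group_def semidirect_product_def carrier_integer_mod_group)
  define f :: "generator \<Rightarrow> int \<times> int" where
    "f g = (case g of gen_sigma \<Rightarrow> (0, 1) | gen_tau \<Rightarrow> (1, 0))" for g
  have inv_f: "inv\<^bsub>?G\<^esub> (f gen_sigma) = (0, 1)" "inv\<^bsub>?G\<^esub> (f gen_tau) = (int n - 1, 0)"
    using inv_metacyclic_group[of n "1 - int d"] metacyclic_square[of d] n d
    by (simp_all add: f_def n_def)
  have f: "f g \<in> carrier ?G" for g
    using n by (auto simp: f_def carrier split: generator.splits)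
  have ev_tau: "word_eval ?G f (replicate j (gen_tau, True)) = (int j mod int n, 0)" for j
    by (induction j) (auto simp: one f_def mult mod_simps)
  have ev_tau_inv: "word_eval ?G f (replicate j (gen_tau, False)) = ((- int j) mod int n, 0)" for j
  proof (induction j)
    case (Suc j)
    have "(int n - 1 + (- int j) mod int n) mod int n = (- int (Suc j)) mod int n"
      using mod_add_self2[of "- int (Suc j)" "int n"] mod_add_right_eq[of "int n - 1" "- int j" "int n"]
      by (simp add: algebra_simps)
    then show ?case using Suc by (simp add: inv_f mult)
  qed (simp add: one)
  define nf :: "int \<times> int \<Rightarrow> generator word" where
    "nf = (\<lambda>(x, h). replicate (nat x) (gen_tau, True) @ replicate (nat h) (gen_sigma, True))"
  define R where "R = C_relations d"
  note R_def' = R_def[unfolded C_relations_def Let_def, folded n_def]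
  define \<sigma> \<tau> \<tau>' where letters: "\<sigma> = (gen_sigma, True)" "\<tau> = (gen_tau, True)" "\<tau>' = (gen_tau, False)"
  have \<sigma>\<sigma>: "presentation_eq R [\<sigma>, \<sigma>] []" and \<tau>n: "presentation_eq R (replicate n \<tau>) []"
    and \<sigma>\<tau>\<sigma>: "presentation_eq R [\<sigma>, \<tau>, \<sigma>] (replicate (d - 1) \<tau>')"
    by (rule presentation_eq.relation; simp add: R_def' letters)+
  note trans = presentation_eq.trans[of R] and refl = presentation_eq.refl[of R]
    and append = presentation_eq.append[of R] and sym = presentation_eq.sym[of R]
  have app: "presentation_eq R (u @ v @ w) (u @ v' @ w)" if "presentation_eq R v v'" for u v v' w
    by (intro append refl that)
  have \<tau>mod: "presentation_eq R (replicate j \<tau>) (replicate (j mod n) \<tau>)" for j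
  proof (induction j rule: less_induct)
    case (less j)
    show ?case
    proof (cases "j < n")
      case False
      then have "replicate j \<tau> = replicate n \<tau> @ replicate (j - n) \<tau>"
        by (simp flip: replicate_add)
      then have "presentation_eq R (replicate j \<tau>) (replicate (j - n) \<tau>)"
        using append[OF \<tau>n refl[of "replicate (j - n) \<tau>"]] by simp
      moreover have "presentation_eq R (replicate (j - n) \<tau>) (replicate (j mod n) \<tau>)"
        using less[of "j - n"] False n by (simp add: le_mod_geq)
      ultimately show ?thesis by (rule trans)
    qed (simp add: refl)
  qed
  \<comment> \<open>Inverse letters are traded for positive powers, as \<open>nf\<close> contains
    none.\<close>
  have \<tau>': "presentation_eq R [\<tau>'] (replicate (n - 1) \<tau>)"
  proof -
    have "presentation_eq R ([\<tau>'] @ []) ([\<tau>'] @ replicate n \<tau>)"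
      by (intro append refl sym[OF \<tau>n])
    moreover have "replicate n \<tau> = \<tau> # replicate (n - 1) \<tau>"
      using n by (metis One_nat_def Suc_diff_1 less_trans less_one replicate_Suc zero_less_one)
    moreover have "presentation_eq R ([\<tau>', \<tau>] @ replicate (n - 1) \<tau>) ([] @ replicate (n - 1) \<tau>)"
      using presentation_eq.cancel[of R gen_tau False] by (intro append refl) (simp add: letters)
    ultimately show ?thesis using trans by fastforce
  qed
  have \<tau>'s: "presentation_eq R (replicate j \<tau>') (replicate (j * (n - 1)) \<tau>)" for j
  proof (induction j)
    case (Suc j)
    show ?case using append[OF \<tau>' Suc] by (simp add: replicate_add)
  qed (simp add: refl)
  \<comment> \<open>A nonnegative exponent congruent to 1 - d modulo n: each of the d - 1 inverse
    letters in the relation contributes n - 1.\<close>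
  define e where "e = (d - 1) * (n - 1)"
  have \<sigma>\<tau>: "presentation_eq R [\<sigma>, \<tau>] (replicate e \<tau> @ [\<sigma>])"
  proof -
    have "presentation_eq R [\<sigma>, \<tau>] [\<sigma>, \<tau>, \<sigma>, \<sigma>]"
      using append[OF refl[of "[\<sigma>, \<tau>]"] sym[OF \<sigma>\<sigma>]] by simp
    moreover have "presentation_eq R [\<sigma>, \<tau>, \<sigma>, \<sigma>] (replicate e \<tau> @ [\<sigma>])"
      using append[OF trans[OF \<sigma>\<tau>\<sigma> \<tau>'s] refl[of "[\<sigma>]"]] by (simp add: e_def)
    ultimately show ?thesis by (rule trans)
  qed
  have \<sigma>\<tau>s: "presentation_eq R ([\<sigma>] @ replicate j \<tau>) (replicate (e * j) \<tau> @ [\<sigma>])" for j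
  proof (induction j)
    case (Suc j)
    have "presentation_eq R ([\<sigma>] @ replicate (Suc j) \<tau>) (replicate e \<tau> @ ([\<sigma>] @ replicate j \<tau>))"
      using append[OF \<sigma>\<tau> refl[of "replicate j \<tau>"]] by simp
    moreover have "presentation_eq R (replicate e \<tau> @ ([\<sigma>] @ replicate j \<tau>)) (replicate e \<tau> @ replicate (e * j) \<tau> @ [\<sigma>])"
      by (intro append refl Suc)
    ultimately have "presentation_eq R ([\<sigma>] @ replicate (Suc j) \<tau>) (replicate e \<tau> @ replicate (e * j) \<tau> @ [\<sigma>])"
      by (rule trans)
    then show ?case by (simp add: replicate_add)
  qed (simp add: refl)
  have \<sigma>inv: "presentation_eq R [(gen_sigma, False)] [\<sigma>]"
  proof -
    have "presentation_eq R ([(gen_sigma, False)] @ []) ([(gen_sigma, False)] @ [\<sigma>, \<sigma>])"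
      by (intro append refl sym[OF \<sigma>\<sigma>])
    moreover have "presentation_eq R ([(gen_sigma, False), \<sigma>] @ [\<sigma>]) ([] @ [\<sigma>])"
      using presentation_eq.cancel[of R gen_sigma False] by (intro append refl) (simp add: letters)
    ultimately show ?thesis using trans by fastforce
  qed
  have \<tau>_nf: "presentation_eq R (replicate j \<tau> @ nf (x, h)) (nf ((int j + x) mod int n, h))"
    if "0 \<le> x" for j x h
  proof -
    have "nat ((int j + x) mod int n) = (j + nat x) mod n"
      using that by (simp add: nat_mod_distrib nat_add_distrib)
    then show ?thesis
      using append[OF \<tau>mod[of "j + nat x"] refl[of "replicate (nat h) \<sigma>"]]
      by (simp add: nf_def letters replicate_add)
  qed
  have \<sigma>_nf: "presentation_eq R (\<sigma> # nf (x, h)) (nf (((1 - int d) * x) mod int n, (1 + h) mod 2))"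
    if x: "0 \<le> x" and h: "h \<in> {0, 1}" for x h
  proof -
    have "int e = (int d - 1) * (int n - 1)"
      using n d unfolding e_def of_nat_mult by (simp add: of_nat_diff)
    then have "int e = (1 - int d) + int n * (int d - 1)"
      by (simp add: algebra_simps)
    then have "int e * x = (1 - int d) * x + int n * ((int d - 1) * x)"
      by (simp only: distrib_right mult.assoc)
    then have "((1 - int d) * x) mod int n = (int e * x) mod int n"
      by (simp only: mod_mult_self2)
    then have *: "nat (((1 - int d) * x) mod int n) = (e * nat x) mod n"
      using x by (simp add: nat_mod_distrib nat_mult_distrib)
    have "presentation_eq R (([\<sigma>] @ replicate (nat x) \<tau>) @ replicate (nat h) \<sigma>)
        ((replicate (e * nat x) \<tau> @ [\<sigma>]) @ replicate (nat h) \<sigma>)"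
      by (intro append refl \<sigma>\<tau>s)
    then have "presentation_eq R (\<sigma> # nf (x, h)) (replicate (e * nat x) \<tau> @ ([\<sigma>] @ replicate (nat h) \<sigma>))"
      by (simp add: nf_def letters)
    moreover have "presentation_eq R (replicate (e * nat x) \<tau> @ ([\<sigma>] @ replicate (nat h) \<sigma>))
        (replicate (e * nat x mod n) \<tau> @ replicate (nat ((1 + h) mod 2)) \<sigma>)"
      using h \<sigma>\<sigma> by (intro append \<tau>mod) (auto simp: refl)
    ultimately have "presentation_eq R (\<sigma> # nf (x, h)) (replicate (e * nat x mod n) \<tau> @ replicate (nat ((1 + h) mod 2)) \<sigma>)"
      by (rule trans)
    then show ?thesis
      by (simp add: nf_def letters *)
  qed
  have "?G \<cong> presented_group R"
  proof (rule iso_presented_group[OF G f, where nf = nf])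
    show "word_eval ?G f u = word_eval ?G f v" if "(u, v) \<in> R" for u v
      using that d unfolding R_def'
      by (auto simp: ev_tau ev_tau_inv) (auto simp: f_def mult one of_nat_diff n int_n mod_mult_right_eq)
    show "nf \<one>\<^bsub>?G\<^esub> = []" by (simp add: one nf_def)
  next
    have "word_eval ?G f (u @ v) = word_eval ?G f u \<otimes>\<^bsub>?G\<^esub> word_eval ?G f v" for u v
      by (rule word_eval_append[OF G f])
    moreover fix x assume "x \<in> carrier ?G"
    ultimately show "word_eval ?G f (nf x) = x"
      unfolding carrier by (auto simp: nf_def ev_tau) (auto simp: f_def mult one)
  next
    fix g b x assume "x \<in> carrier ?G"
    then obtain a h where x: "x = (a, h)" "0 \<le> a" "a < int n" "h \<in> {0, 1}" by (auto simp: carrier)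
    have \<sigma>: "presentation_eq R (\<sigma> # nf x) (nf ((0, 1) \<otimes>\<^bsub>?G\<^esub> x))"
      using \<sigma>_nf[of a h] x by (simp add: mult)
    show "presentation_eq R ((g, b) # nf x) (nf ((if b then f g else inv\<^bsub>?G\<^esub> (f g)) \<otimes>\<^bsub>?G\<^esub> x))"
    proof (cases g)
      case gen_sigma
      moreover have "presentation_eq R ([(gen_sigma, False)] @ nf x) ([\<sigma>] @ nf x)"
        by (intro append refl \<sigma>inv)
      then have "presentation_eq R ((gen_sigma, False) # nf x) (nf ((0, 1) \<otimes>\<^bsub>?G\<^esub> x))"
        using trans[OF _ \<sigma>] by simp
      moreover have "f gen_sigma = (0, 1)" by (simp add: f_def)
      ultimately show ?thesis
        using \<sigma> inv_f(1) gen_sigma by (cases b) (simp_all add: letters)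
    next
      case gen_tau
      have "presentation_eq R ([\<tau>'] @ nf x) (replicate (n - 1) \<tau> @ nf x)"
        by (intro append refl \<tau>')
      moreover have "presentation_eq R (replicate (n - 1) \<tau> @ nf x) (nf ((int n - 1 + a) mod int n, h))"
        using \<tau>_nf[of a "n - 1" h] x n by (simp add: of_nat_diff)
      ultimately have "presentation_eq R ([\<tau>'] @ nf x) (nf ((int n - 1 + a) mod int n, h))"
        by (rule trans)
      moreover have "presentation_eq R ([\<tau>] @ nf x) (nf ((1 + a) mod int n, h))"
        using \<tau>_nf[of a 1 h] x by simp
      moreover have "h mod 2 = h" using x by auto
      ultimately show ?thesis
        using gen_tau by (auto simp: inv_f) (auto simp: f_def letters mult x)
    qed
  qed
  then show ?thesis by (simp add: n_def R_def)
qed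

section \<open>Roots of unity and polynomial identities\<close>

text \<open>Induction on n, splitting off a prime p with n = p m. If p divides m, a p-th root of a
  primitive m-th root works; otherwise the m-th root is multiplied by a primitive p-th root.\<close>

lemma primitive_root_of_unity_exists:
  assumes "n > 0"
  shows "\<exists>\<zeta> :: 'k::{alg_closed_field, field_char_0}. \<forall>j. \<zeta> ^ j = 1 \<longleftrightarrow> n dvd j"
  using assms
proof (induction n rule: less_induct)
  case (less n)
  show ?case
  proof (cases "n = 1")
    case True
    then show ?thesis by (intro exI[of _ 1]) auto
  next
    case False
    then obtain p where p: "prime p" "p dvd n" using prime_factor_nat by blast
    then obtain m where n: "n = p * m" by blast
    have m: "m > 0" "m < n" using less.prems p prime_gt_1_nat[of p] by (auto simp: n)
    then obtain \<zeta> :: 'k where \<zeta>: "\<And>j. \<zeta> ^ j = 1 \<longleftrightarrow> m dvd j"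
      using less.IH by blast
    show ?thesis
    proof (cases "p dvd m")
      case True
      obtain \<xi> where \<xi>: "\<xi> ^ p = \<zeta>"
        using nth_root_exists[of p \<zeta>] p prime_gt_0_nat by blast
      have "n dvd j" if j: "\<xi> ^ j = 1" for j
      proof -
        have "\<zeta> ^ j = (\<xi> ^ j) ^ p" by (simp add: mult.commute flip: \<xi> power_mult)
        then have "m dvd j" using \<zeta> j by simp
        then obtain i where i: "j = p * i" using True by (meson dvd_def dvd_trans)
        then have "\<zeta> ^ i = 1" using j by (simp add: power_mult \<xi>)
        then show ?thesis using \<zeta> by (simp add: n i)
      qed
      moreover have "\<xi> ^ j = 1" if "n dvd j" for j
        using that \<zeta>[of "m * _"] by (auto simp: n power_mult \<xi>)
      ultimately show ?thesis by blast
    next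
      case False
      then have "coprime m p" using p prime_imp_coprime coprime_commute by blast
      \<comment> \<open>A root of 1 + x + ... + x^(p-1) is a p-th root of unity; it is not 1,
        because the value at 1 is p and the characteristic is zero.\<close>
      let ?P = "\<Sum>i<p. monom (1 :: 'k) i"
      have "coeff ?P (p - 1) = 1"
        using prime_gt_1_nat[OF p(1)] by (simp add: coeff_sum)
      then have "p - 1 \<le> degree ?P" by (intro le_degree) simp
      then obtain \<omega> where "poly ?P \<omega> = 0"
        using alg_closed_imp_poly_has_root[of ?P] prime_gt_1_nat[OF p(1)] by fastforce
      then have sum: "(\<Sum>i<p. \<omega> ^ i) = 0" by (simp add: poly_sum poly_monom)
      then have "\<omega> ^ p = 1"
        using power_diff_1_eq[of \<omega> p] by simp
      have "\<omega> \<noteq> 1" using sum prime_gt_0_nat[OF p(1)] by auto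
      have \<omega>: "p dvd j" if "\<omega> ^ j = 1" for j
      proof (rule ccontr)
        assume j: "\<not> p dvd j"
        then have "j \<noteq> 0" by (metis dvd_0_right)
        \<comment> \<open>If p does not divide j, Bezout expresses omega through powers of omega^j
          and omega^p, both equal to 1.\<close>
        then obtain x y where "j * x = p * y + gcd j p"
          using bezout_nat by blast
        moreover have "gcd j p = 1"
          using j p(1) by (metis coprime_commute coprime_imp_gcd_eq_1 prime_imp_coprime)
        ultimately have "(\<omega> ^ j) ^ x = (\<omega> ^ p) ^ y * \<omega>"
          by (simp flip: power_mult)
        then show False using that \<open>\<omega> ^ p = 1\<close> \<open>\<omega> \<noteq> 1\<close> by simp
      qed
      have "n dvd j" if j: "(\<zeta> * \<omega>) ^ j = 1" for j
      proof -
        have "\<zeta> ^ (j * p) = ((\<zeta> * \<omega>) ^ j) ^ p"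
          using \<open>\<omega> ^ p = 1\<close> by (simp add: power_mult_distrib) (metis mult.commute power_mult power_one mult_1_right)
        then have "m dvd j" using \<zeta>[of "j * p"] \<open>coprime m p\<close> j by (simp add: coprime_dvd_mult_left_iff)
        have "\<omega> ^ (j * m) = ((\<zeta> * \<omega>) ^ j) ^ m"
          using \<zeta>[of m] by (simp add: power_mult_distrib) (metis mult.commute power_mult power_one mult_1_right)
        then have "p dvd j" using \<omega>[of "j * m"] j \<open>coprime m p\<close>
          by (simp add: coprime_dvd_mult_left_iff coprime_commute)
        show ?thesis unfolding n
          using \<open>m dvd j\<close> \<open>p dvd j\<close> \<open>coprime m p\<close> by (metis divides_mult mult.commute)
      qed
      moreover have "(\<zeta> * \<omega>) ^ j = 1" if nj: "n dvd j" for j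
      proof -
        have "\<zeta> ^ j = 1" using \<zeta> nj dvd_trans by (auto simp: n)
        moreover obtain i where "j = n * i" using nj by blast
        then have "\<omega> ^ j = 1" by (simp only: n power_mult \<open>\<omega> ^ p = 1\<close> power_one)
        ultimately show ?thesis by (simp add: power_mult_distrib)
      qed
      ultimately show ?thesis by blast
    qed
  qed
qed

lemma inj_on_primitive_root_power:
  fixes \<zeta> :: "'k::field"
  assumes n: "n > 0" and \<zeta>: "\<And>j. \<zeta> ^ j = 1 \<longleftrightarrow> n dvd j"
  shows "inj_on (\<lambda>i. \<zeta> ^ i) {..<n}"
proof -
  have "\<zeta> \<noteq> 0" using \<zeta>[of n] n by (auto simp: power_0_left split: if_splits)
  have inj: "i = j" if "\<zeta> ^ i = \<zeta> ^ j" "i \<le> j" "j < n" for i j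
  proof -
    have "\<zeta> ^ j = \<zeta> ^ i * \<zeta> ^ (j - i)" using that(2) by (simp flip: power_add)
    then have "\<zeta> ^ (j - i) = 1" using that(1) \<open>\<zeta> \<noteq> 0\<close> by simp
    then have "n dvd j - i" using \<zeta> by simp
    then show ?thesis using that by (auto dest: dvd_imp_le)
  qed
  then show ?thesis
    by (intro inj_onI) (metis lessThan_iff nat_le_linear)
qed

text \<open>The n distinct powers of zeta exhaust the at most n roots of x^n - 1.\<close>

lemma root_of_unity_is_power:
  fixes \<zeta> :: "'k::field"
  assumes n: "n > 0" and \<zeta>: "\<And>j. \<zeta> ^ j = 1 \<longleftrightarrow> n dvd j" and x: "x ^ n = 1"
  shows "\<exists>i<n. x = \<zeta> ^ i"
proof -
  have "card ((\<lambda>i. \<zeta> ^ i) ` {..<n}) = n"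
    using inj_on_primitive_root_power[OF n \<zeta>] by (simp add: card_image)
  let ?P = "monom 1 n - 1 :: 'k poly"
  have "coeff ?P n = 1" using n by simp
  then have "?P \<noteq> 0" by (metis coeff_0 zero_neq_one)
  have deg: "degree ?P \<le> n" by (intro degree_diff_le) (auto simp: degree_monom_le)
  have sub: "(\<lambda>i. \<zeta> ^ i) ` {..<n} \<subseteq> {x. poly ?P x = 0}"
    using \<zeta>[of "_ * n"] by (auto simp: poly_monom simp flip: power_mult)
  have "(\<lambda>i. \<zeta> ^ i) ` {..<n} = {x. poly ?P x = 0}"
  proof (rule card_seteq)
    show "finite {x. poly ?P x = 0}" using \<open>?P \<noteq> 0\<close> by (rule poly_roots_finite)
    show "card {x. poly ?P x = 0} \<le> card ((\<lambda>i. \<zeta> ^ i) ` {..<n})"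
      using card_poly_roots_bound[OF \<open>?P \<noteq> 0\<close>] deg \<open>card _ = n\<close> by linarith
  qed (rule sub)
  moreover have "x \<in> {x. poly ?P x = 0}" using x by (simp add: poly_monom)
  ultimately show ?thesis by fastforce
qed

section \<open>Polynomial identities that exclude powers of linear forms\<close>

lemma power_dvd_pderiv:
  fixes L P :: "'k::field_char_0 poly"
  assumes "L ^ Suc k dvd P"
  shows "L ^ k dvd pderiv P"
proof -
  obtain Q where "P = L ^ Suc k * Q" using assms by blast
  then have "pderiv P = L ^ k * (L * pderiv Q + smult (of_nat (Suc k)) (pderiv L) * Q)"
    by (simp only: pderiv_mult pderiv_power_Suc) (simp add: algebra_simps)
  then show ?thesis by (rule dvdI)
qed

lemma poly_ext:
  fixes p q :: "'k::field_char_0 poly"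
  shows "(\<And>x. poly p x = poly q x) \<Longrightarrow> p = q"
  using poly_eq_poly_eq_iff by blast

text \<open>The exponent n - 2 does not occur on the left because n >= 4, so l l' = 0 and the power
  is a multiple of y^n or of 1. The coefficients on the left come in pairs, those of y^n and y being
  multiples of e, those of y^(n-1) and 1 multiples of b; in each pair one exponent is missed by the
  power.\<close>

lemma trinomial_eq_linear_power:
  fixes \<alpha> :: "'k::field_char_0"
  assumes n: "n \<ge> 4" and "K \<noteq> 0" "\<alpha> \<noteq> 0"
    and eq: "\<And>y. e * y ^ n + of_nat n * b * y ^ (n - 1) + of_nat n * \<alpha> * e * y + \<alpha> * b = K * (l * y + l') ^ n"
  shows "b = 0" "e = 0" "l = 0" "l' = 0"
proof -
  have "monom e n + monom (of_nat n * b) (n - 1) + monom (of_nat n * \<alpha> * e) 1 + monom (\<alpha> * b) 0 =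
      smult K ([:l', l:] ^ n)" (is "?P = ?Q")
    by (rule poly_ext) (use eq in \<open>simp add: poly_monom algebra_simps\<close>)
  then have c: "coeff ?P j = K * (of_nat (n choose j) * l ^ j * l' ^ (n - j))" if "j \<le> n" for j
    using that by (simp add: coeff_linear_poly_power)
  obtain k where k: "n = k + 4" using n by (metis add.commute le_Suc_ex)
  have P: "coeff ?P (n - 2) = 0" "coeff ?P (n - 1) = of_nat n * b" "coeff ?P n = e"
    "coeff ?P 1 = of_nat n * \<alpha> * e" "coeff ?P 0 = \<alpha> * b"
    by (simp_all add: k)
  have "n choose (n - 2) \<noteq> 0" using n by (simp add: binomial_eq_0_iff)
  then have ll: "l = 0 \<or> l' = 0"
    using c[of "n - 2"] \<open>K \<noteq> 0\<close> unfolding P by auto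
  then have "of_nat n * b = 0"
    using c[of "n - 1"] n unfolding P by (auto simp: power_0_left)
  then show "b = 0" using n by simp
  then show "l' = 0" using c[of 0] n \<open>K \<noteq> 0\<close> unfolding P by auto
  have "of_nat n * \<alpha> * e = 0"
    using c[of 1] n ll unfolding P by (auto simp: power_0_left)
  then show "e = 0" using n \<open>\<alpha> \<noteq> 0\<close> by simp
  then show "l = 0" using c[of n] n \<open>K \<noteq> 0\<close> unfolding P by auto
qed

text \<open>The coefficient of y is absent on the left, which gives l l' = 0. Its use is the polar
  of the Fermat form on the line through two coordinate points.\<close>

lemma binomial_eq_linear_power:
  fixes a :: "'k::field_char_0"
  assumes n: "n \<ge> 2" and "K \<noteq> 0"
    and eq: "\<And>y. a * y ^ n + b = K * (l * y + l') ^ n"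
  shows "l = 0 \<or> l' = 0"
proof -
  have "monom a n + monom b 0 = smult K ([:l', l:] ^ n)" (is "?P = ?Q")
    by (rule poly_ext) (use eq in \<open>simp add: poly_monom algebra_simps\<close>)
  then have "coeff ?P 1 = K * (of_nat (n choose 1) * l ^ 1 * l' ^ (n - 1))"
    using n by (simp add: coeff_linear_poly_power)
  then show ?thesis using n \<open>K \<noteq> 0\<close> by auto
qed

text \<open>Up to a constant factor, the left-hand side of the equation is the second polar of
  \<open>Y^(m+1) Z + Y Z^(m+1)\<close> at its root \<open>(b, c)\<close>, evaluated at \<open>(y, 1)\<close>.\<close>

lemma second_polar_not_linear_power_mult:
  fixes b c :: "'k::field_char_0"
  assumes m: "m \<ge> 3" "m \<noteq> 4" and bc: "b \<noteq> 0" "c \<noteq> 0" "b ^ m + c ^ m = 0"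
    and eq: "\<And>y. 2 * b * c * y ^ m + of_nat m * b\<^sup>2 * y ^ (m - 1) + of_nat m * c\<^sup>2 * y + 2 * b * c =
                 K * (l * y + l') ^ (m - 1) * (k * y + k')"
  shows False
proof -
  define P where "P = monom (2 * b * c) m + monom (of_nat m * b\<^sup>2) (m - 1) + monom (of_nat m * c\<^sup>2) 1
    + monom (2 * b * c) 0"
  have P: "P = smult K ([:l', l:] ^ (m - 1) * [:k', k:])"
    by (rule poly_ext) (use eq in \<open>simp add: P_def poly_monom algebra_simps\<close>)
  have coeff_m: "coeff P m = 2 * b * c" and coeff_0: "coeff P 0 = 2 * b * c"
    using m by (auto simp: P_def)
  \<comment> \<open>With l = 0 the right side would have degree at most 1, below the degree m of the
    left.\<close>
  have "l \<noteq> 0"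
  proof
    assume "l = 0"
    moreover have "[:l':] ^ j = [:l' ^ j:]" for j by (induction j) auto
    ultimately have "P = [:K * l' ^ (m - 1):] * [:k', k:]"
      by (simp add: P)
    then have "coeff P m = 0"
      using m by (auto simp: coeff_pCons split: nat.splits)
    then show False using coeff_m bc by simp
  qed
  \<comment> \<open>The root of the linear factor, of multiplicity at least m - 1; the derivatives
    of P of order below m - 1 vanish there too.\<close>
  define r where "r = - l' / l"
  have r: "[:l', l:] ^ j dvd Q \<Longrightarrow> j > 0 \<Longrightarrow> poly Q r = 0" for j Q
    using \<open>l \<noteq> 0\<close> by (auto simp: r_def power_0_left elim!: dvdE)
  have "r \<noteq> 0"
  proof
    assume "r = 0"
    then have "l' = 0" using \<open>l \<noteq> 0\<close> by (simp add: r_def)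
    then have "poly P 0 = 0" using m by (simp add: P power_0_left)
    then show False using coeff_0 bc by (simp add: poly_0_coeff_0)
  qed
  have dvd: "[:l', l:] ^ (m - 1) dvd P" unfolding P by (intro dvd_smult dvd_triv_left)
  consider "m = 3" | "m \<ge> 5" using m by linarith
  then show False
  proof cases
    case 1
    \<comment> \<open>Only a double root is at hand here. Elimination with b^3 = -c^3 leaves r = -b
      / (2 c), which the quadratic equation for r excludes.\<close>
    then have "[:l', l:] ^ Suc 1 dvd P" using dvd by (simp add: numeral_2_eq_2)
    then have "poly P r = 0" "poly (pderiv P) r = 0"
      using r power_dvd_pderiv by (blast, metis zero_less_one)
    then have e1: "2 * b * c * r ^ 3 + 3 * b\<^sup>2 * r\<^sup>2 + 3 * c\<^sup>2 * r + 2 * b * c = 0"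
      and e2: "6 * b * c * r\<^sup>2 + 6 * b\<^sup>2 * r + 3 * c\<^sup>2 = 0"
      using 1 by (simp_all add: P_def poly_monom pderiv_add pderiv_monom algebra_simps power2_eq_square)
    have "b ^ 3 = - (c ^ 3)" using bc(3) 1 by (simp add: eq_neg_iff_add_eq_0)
    have "b\<^sup>2 * r\<^sup>2 + 2 * c\<^sup>2 * r + 2 * b * c = 0"
      using e1 e2 by algebra
    then have "6 * c^3 * r + 3 * b * c\<^sup>2 = 0"
      using e2 \<open>b ^ 3 = - (c ^ 3)\<close> by algebra
    then have "c\<^sup>2 * 3 * (2 * c * r + b) = 0" by algebra
    then have "2 * c * r + b = 0" using bc by simp
    then have "b * c ^ 3 * 3 = 0"
      using \<open>b\<^sup>2 * r\<^sup>2 + 2 * c\<^sup>2 * r + 2 * b * c = 0\<close> \<open>b ^ 3 = - (c ^ 3)\<close> by algebra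
    then show False using bc by simp
  next
    case 2
    then obtain j where j: "m = j + 5" by (metis add.commute le_Suc_ex)
    \<comment> \<open>Multiplicity at least 4 kills the third derivative. The second and third
      derivatives are monomials times 2 c y + (m - 2) b and 2 c y + (m - 3) b, which have no common
      root. For m = 4 the multiplicity 3 reaches only the second.\<close>
    have "[:l', l:] ^ Suc (Suc (Suc (Suc j))) dvd P" using dvd by (simp add: j numeral_eq_Suc)
    then have "poly (pderiv (pderiv P)) r = 0" "poly (pderiv (pderiv (pderiv P))) r = 0"
      using r power_dvd_pderiv by (meson zero_less_Suc)+
    then have "of_nat (m * (m - 1)) * b * (2 * c * r + of_nat (m - 2) * b) * r ^ (j + 2) = 0"
      and "of_nat (m * (m - 1) * (m - 2)) * b * (2 * c * r + of_nat (m - 3) * b) * r ^ (j + 1) = 0"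
      by (simp_all add: P_def poly_monom pderiv_add pderiv_monom j algebra_simps power2_eq_square numeral_eq_Suc)
    moreover have "of_nat (m * (m - 1)) \<noteq> (0 :: 'k)" "of_nat (m * (m - 1) * (m - 2)) \<noteq> (0 :: 'k)"
      using 2 by (simp_all only: of_nat_eq_0_iff) auto
    ultimately have "2 * c * r + of_nat (m - 2) * b = 0" "2 * c * r + of_nat (m - 3) * b = 0"
      using \<open>r \<noteq> 0\<close> bc by (simp_all only: mult_eq_0_iff power_eq_0_iff simp_thms)
    moreover have "of_nat (m - 2) = of_nat (m - 3) + (1 :: 'k)" by (simp add: j)
    ultimately show False using bc by (simp add: algebra_simps)
  qed
qed

section \<open>The polar of the curve\<close>

text \<open>When invertible, these are the matrices fixing the point (1:0:0) and the line X =
  0.\<close>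

definition block_matrix :: "'k::field \<Rightarrow> 'k \<Rightarrow> 'k \<Rightarrow> 'k \<Rightarrow> 'k \<Rightarrow> 'k^3^3" where
  "block_matrix x p q r s = vector [vector [x, 0, 0], vector [0, p, q], vector [0, r, s]]"

lemma block_matrix_mult:
  "block_matrix x p q r s ** block_matrix x' p' q' r' s' =
   block_matrix (x * x') (p * p' + q * r') (p * q' + q * s') (r * p' + s * r') (r * q' + s * s')"
  by (simp add: vec_eq_iff forall_3 matrix_matrix_mult_def sum_3 block_matrix_def)

lemma mat_mult_block_matrix:
  "mat c ** block_matrix x p q r s = block_matrix (c * x) (c * p) (c * q) (c * r) (c * s)"
  by (simp add: vec_eq_iff forall_3) (simp add: block_matrix_def)

lemma block_matrix_eq_iff:
  "block_matrix x p q r s = block_matrix x' p' q' r' s' \<longleftrightarrow>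
     x = x' \<and> p = p' \<and> q = q' \<and> r = r' \<and> s = s'"
  by (auto simp: vec_eq_iff forall_3 block_matrix_def)

lemma block_matrix_vector:
  "(block_matrix x p q r s *v v) $ 1 = x * v $ 1"
  "(block_matrix x p q r s *v v) $ 2 = p * v $ 2 + q * v $ 3"
  "(block_matrix x p q r s *v v) $ 3 = r * v $ 2 + s * v $ 3"
  by (simp_all add: matrix_vector_mult_def sum_3 block_matrix_def)

lemma invertible_block_matrix_iff:
  "invertible (block_matrix x p q r s) \<longleftrightarrow> x \<noteq> 0 \<and> p * s - q * r \<noteq> 0"
  by (simp add: invertible_det_nz det_3) (auto simp: block_matrix_def algebra_simps)

lemma PGL_class_block_matrix_1_eq_iff:
  "PGL_class (block_matrix 1 p q r s) = PGL_class (block_matrix 1 p' q' r' s') \<longleftrightarrow>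
     p = p' \<and> q = q' \<and> r = r' \<and> s = s'"
  by (auto simp: PGL_class_eq_iff mat_mult_block_matrix block_matrix_eq_iff)

definition binary_form :: "nat \<Rightarrow> 'k::field \<Rightarrow> 'k \<Rightarrow> 'k \<Rightarrow> 'k" where
  "binary_form d \<alpha> y z = y ^ (d - 1) * z + \<alpha> * y * z ^ (d - 1)"

lemma C_form_eq: "C_form d \<alpha> v = (v $ 1) ^ d + binary_form d \<alpha> (v $ 2) (v $ 3)"
  by (simp add: C_form_def binary_form_def)

lemma binary_form_scale:
  assumes "d \<ge> 1"
  shows "binary_form d \<alpha> (c * y) (c * z) = c ^ d * binary_form d \<alpha> y z"
proof -
  obtain n where "d = Suc n" using assms by (cases d) auto
  then show ?thesis by (simp add: binary_form_def power_mult_distrib algebra_simps)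
qed

lemma homogeneous_C_form: "d \<ge> 1 \<Longrightarrow> homogeneous d (C_form d \<alpha>)"
  by (simp add: homogeneous_def C_form_eq binary_form_scale power_mult_distrib distrib_left)

lemma preserves_C_form_block_matrix:
  assumes "x \<noteq> 0" "p * s - q * r \<noteq> 0"
    and "\<And>y z. binary_form d \<alpha> (p * y + q * z) (r * y + s * z) = x ^ d * binary_form d \<alpha> y z"
  shows "preserves (C_form d \<alpha>) (block_matrix x p q r s)"
  unfolding preserves_def invertible_block_matrix_iff
  using assms by (auto simp: C_form_eq block_matrix_vector power_mult_distrib distrib_left intro!: exI[of _ "x ^ d"])

text \<open>This is v . grad F(w) for F = \<open>C_form\<close>, the polar of the point v, and at
  the same time the coefficient of t in F(w + t v).\<close>

definition C_polar :: "nat \<Rightarrow> 'k::field \<Rightarrow> 'k^3 \<Rightarrow> 'k^3 \<Rightarrow> 'k" where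
  "C_polar d \<alpha> v w = of_nat d * v $ 1 * w $ 1 ^ (d - 1)
     + v $ 2 * (of_nat (d - 1) * w $ 2 ^ (d - 2) * w $ 3 + \<alpha> * w $ 3 ^ (d - 1))
     + v $ 3 * (w $ 2 ^ (d - 1) + \<alpha> * of_nat (d - 1) * w $ 2 * w $ 3 ^ (d - 2))"

text \<open>F(A w + t A v) = c F(w + t v) is an identity of polynomials in t, as the field is
  infinite; the claim compares the coefficients of t.\<close>

lemma C_polar_invariant:
  fixes \<alpha> :: "'k::field_char_0"
  assumes d: "d \<ge> 2" and inv: "\<And>v. C_form d \<alpha> (A *v v) = c * C_form d \<alpha> v"
  shows "C_polar d \<alpha> (A *v v) (A *v w) = c * C_polar d \<alpha> v w"
proof -
  define L where "L w v i = [:w $ i, v $ i:]" for w v :: "'k^3" and i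
  define P where "P w v = L w v 1 ^ d + L w v 2 ^ (d - 1) * L w v 3 + smult \<alpha> (L w v 3 ^ (d - 1) * L w v 2)" for w v
  have poly: "poly (P w v) t = C_form d \<alpha> (w + t *s v)" for w v t
    by (simp add: P_def L_def C_form_def algebra_simps)
  have "coeff (P w v) 1 = C_polar d \<alpha> v w" for w v
    using d by (simp add: P_def L_def C_polar_def coeff_linear_poly_power coeff_mult algebra_simps numeral_2_eq_2)
  moreover have "P (A *v w) (A *v v) = smult c (P w v)"
  proof (rule poly_ext)
    fix t
    have "A *v w + t *s (A *v v) = A *v (w + t *s v)"
      by (simp add: matrix_vector_right_distrib vector_scalar_commute)
    then show "poly (P (A *v w) (A *v v)) t = poly (smult c (P w v)) t"
      by (simp add: poly inv)
  qed
  ultimately show ?thesis by (metis coeff_smult)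
qed

text \<open>The polar at e = (1:0:0) is d X^(d-1). Pulled back by the inverse of A and restricted to
  X = 0, it is a power of a linear form and, up to a constant, the polar of A e, so
  \<open>trinomial_eq_linear_power\<close> makes both vanish. Hence A fixes the point e, and its
  inverse fixes the line X = 0.\<close>

lemma preserves_C_form_imp_block_matrix:
  fixes \<alpha> :: "'k::field_char_0"
  assumes d: "d \<ge> 5" and \<alpha>: "\<alpha> \<noteq> 0" and A: "preserves (C_form d \<alpha>) A"
  obtains x p q r s where "A = block_matrix x p q r s" "x \<noteq> 0" "p * s - q * r \<noteq> 0"
    "\<And>y z. binary_form d \<alpha> (p * y + q * z) (r * y + s * z) = x ^ d * binary_form d \<alpha> y z"
proof -
  obtain c where c: "c \<noteq> 0" "\<And>v. C_form d \<alpha> (A *v v) = c * C_form d \<alpha> v"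
    using A by (auto simp: preserves_def)
  obtain A' where A': "A ** A' = mat 1" "A' ** A = mat 1"
    using A by (auto simp: preserves_def elim: invertible_inverse_matrix)
  have "A $ 3 $ 1 * y ^ (d - 1) + of_nat (d - 1) * A $ 2 $ 1 * y ^ (d - 1 - 1) + of_nat (d - 1) * \<alpha> * A $ 3 $ 1 * y + \<alpha> * A $ 2 $ 1
      = (c * of_nat d) * (A' $ 1 $ 2 * y + A' $ 1 $ 3) ^ (d - 1)" for y
  proof -
    define u :: "'k^3" where "u = vector [0, y, 1]"
    define e :: "'k^3" where "e = vector [1, 0, 0]"
    have "C_polar d \<alpha> (A *v e) (A *v (A' *v u)) = c * C_polar d \<alpha> e (A' *v u)"
      using d by (intro C_polar_invariant c) auto
    moreover have "A *v (A' *v u) = u"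
      by (simp add: A' matrix_vector_mul_assoc)
    moreover have "C_polar d \<alpha> e (A' *v u) = of_nat d * (A' $ 1 $ 2 * y + A' $ 1 $ 3) ^ (d - 1)"
      by (simp add: C_polar_def e_def matrix_vector_mult_def sum_3 u_def)
    moreover have "C_polar d \<alpha> (A *v e) u = A $ 2 $ 1 * (of_nat (d - 1) * y ^ (d - 2) + \<alpha>)
        + A $ 3 $ 1 * (y ^ (d - 1) + \<alpha> * of_nat (d - 1) * y)"
      using d by (simp add: C_polar_def e_def matrix_vector_mult_def sum_3 u_def power_0_left)
    moreover have "d - 2 = d - 1 - 1" by simp
    ultimately show ?thesis
      by (simp only: mult.assoc) (simp add: algebra_simps)
  qed
  from trinomial_eq_linear_power[OF _ _ \<alpha> this] d c(1)
  have z: "A $ 2 $ 1 = 0" "A $ 3 $ 1 = 0" "A' $ 1 $ 2 = 0" "A' $ 1 $ 3 = 0"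
    by auto
  have "(A' ** A) $ 1 $ j = A' $ 1 $ 1 * A $ 1 $ j" for j
    by (simp add: matrix_matrix_mult_def sum_3 z)
  then have *: "A' $ 1 $ 1 * A $ 1 $ j = (mat 1 :: 'k^3^3) $ 1 $ j" for j
    by (metis A'(2))
  from *[of 1] *[of 2] *[of 3] have "A $ 1 $ 2 = 0" "A $ 1 $ 3 = 0"
    by (auto simp: mat_def)
  with z have A_eq: "A = block_matrix (A $ 1 $ 1) (A $ 2 $ 2) (A $ 2 $ 3) (A $ 3 $ 2) (A $ 3 $ 3)" (is "A = ?B")
    by (simp add: vec_eq_iff forall_3 block_matrix_def)
  have "invertible ?B" using A A_eq by (simp add: preserves_def)
  \<comment> \<open>Evaluation at (1, 0, 0), where the form is 1.\<close>
  moreover have "c = A $ 1 $ 1 ^ d"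
  proof -
    have "C_form d \<alpha> (?B *v vector [1, 0, 0]) = c * C_form d \<alpha> (vector [1, 0, 0])"
      using c(2) A_eq by simp
    then show ?thesis using d by (simp add: C_form_def block_matrix_vector power_0_left)
  qed
  moreover have "binary_form d \<alpha> (A $ 2 $ 2 * y + A $ 2 $ 3 * z) (A $ 3 $ 2 * y + A $ 3 $ 3 * z) = c * binary_form d \<alpha> y z" for y z
  proof -
    have "C_form d \<alpha> (?B *v vector [0, y, z]) = c * C_form d \<alpha> (vector [0, y, z])"
      using c(2) A_eq by simp
    then show ?thesis using d by (simp add: C_form_eq block_matrix_vector power_0_left)
  qed
  ultimately show ?thesis
    using A_eq that unfolding invertible_block_matrix_iff by blast
qed

lemma preserves_C_form_normalised:
  fixes \<alpha> :: "'k::field_char_0"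
  assumes d: "d \<ge> 5" and \<alpha>: "\<alpha> \<noteq> 0" and A: "preserves (C_form d \<alpha>) A"
  obtains p q r s where "PGL_class A = PGL_class (block_matrix 1 p q r s)" "p * s - q * r \<noteq> 0"
    "\<And>y z. binary_form d \<alpha> (p * y + q * z) (r * y + s * z) = binary_form d \<alpha> y z"
proof -
  obtain x p q r s where x: "A = block_matrix x p q r s" "x \<noteq> 0" "p * s - q * r \<noteq> 0"
    "\<And>y z. binary_form d \<alpha> (p * y + q * z) (r * y + s * z) = x ^ d * binary_form d \<alpha> y z"
    using preserves_C_form_imp_block_matrix[OF assms] by blast
  show ?thesis
  proof
    show "PGL_class A = PGL_class (block_matrix 1 (p / x) (q / x) (r / x) (s / x))"
      unfolding PGL_class_eq_iff using x(1,2) by (intro exI[of _ "1 / x"]) (simp add: mat_mult_block_matrix)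
    show "p / x * (s / x) - q / x * (r / x) \<noteq> 0"
      using x(2,3) by (simp add: field_simps)
    fix y z
    have "binary_form d \<alpha> ((1 / x) * (p * y + q * z)) ((1 / x) * (r * y + s * z)) = binary_form d \<alpha> y z"
      using d x(2,4) by (subst binary_form_scale) (simp_all add: power_one_over)
    then show "binary_form d \<alpha> (p / x * y + q / x * z) (r / x * y + s / x * z) = binary_form d \<alpha> y z"
      by (simp add: distrib_left)
  qed
qed

text \<open>If p and r are nonzero, (1:0) goes to a root (p:r) of f off the axes. The second polar
  at (1:0) is a multiple of Y^(d-3) Z, so the one at (p:r) would also be the power of exponent d - 3
  of a linear form times a linear form, which \<open>second_polar_not_linear_power_mult\<close>
  forbids.\<close>

lemma binary_form_symmetry_fixes_axes:
  fixes p q r s :: "'k::field_char_0"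
  assumes d: "d \<ge> 5" "d \<noteq> 6" and det: "p * s - q * r \<noteq> 0"
    and inv: "\<And>y z. binary_form d 1 (p * y + q * z) (r * y + s * z) = binary_form d 1 y z"
  shows "p = 0 \<or> r = 0"
proof (rule ccontr)
  assume "\<not> (p = 0 \<or> r = 0)"
  then have pr: "p \<noteq> 0" "r \<noteq> 0" by auto
  define n where "n = d - 1"
  have n: "n \<ge> 4" "n \<noteq> 5" "d - Suc 0 = n" using d by (auto simp: n_def)
  then obtain m where m: "n = Suc m" by (cases n) auto
  define \<delta> where "\<delta> = p * s - q * r"
  have "\<delta> \<noteq> 0" using det by (simp add: \<delta>_def)
  have "binary_form d 1 p r = 0"
    using inv[of 1 0] n by (simp add: binary_form_def power_0_left)
  then have "p * r * (p ^ m + r ^ m) = 0"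
    by (simp add: binary_form_def n m algebra_simps)
  then have root: "p ^ m + r ^ m = 0" using pr by simp
  have "2 * p * r * y ^ m + of_nat m * p\<^sup>2 * y ^ (m - 1) + of_nat m * r\<^sup>2 * y + 2 * p * r =
      of_nat m * ((s / \<delta>) * y + - q / \<delta>) ^ (m - 1) * ((- r / \<delta>) * y + p / \<delta>)" for y
  proof -
    \<comment> \<open>The preimage of (y, 1) under the symmetry, by Cramer's rule.\<close>
    define y0 z0 where "y0 = (s / \<delta>) * y + - q / \<delta>" and "z0 = (- r / \<delta>) * y + p / \<delta>"
    have yz: "p * y0 + q * z0 = y" "r * y0 + s * z0 = 1"
      using \<open>\<delta> \<noteq> 0\<close> by (simp_all add: y0_def z0_def field_simps) (simp_all add: \<delta>_def algebra_simps)
    \<comment> \<open>Both sides are f along a line with parameter t, in direction (p, r) on the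
      left and (1, 0) on the right; the coefficient of t^2 is the second polar up to a
      constant.\<close>
    have "[:y, p:] ^ n * [:1, r:] + [:1, r:] ^ n * [:y, p:] = smult z0 ([:y0, 1:] ^ n) + smult (z0 ^ n) [:y0, 1:]"
      (is "?P = ?Q")
    proof (rule poly_ext)
      fix t
      have "p * (y0 + t) + q * z0 = y + p * t" "r * (y0 + t) + s * z0 = 1 + r * t"
        by (simp_all add: distrib_left add.assoc add.commute add.left_commute flip: yz)
      then have "(y + p * t) ^ n * (1 + r * t) + (y + p * t) * (1 + r * t) ^ n = (y0 + t) ^ n * z0 + (y0 + t) * z0 ^ n"
        using inv[of "y0 + t" z0] by (simp add: binary_form_def n)
      then show "poly ?P t = poly ?Q t"
        by (simp add: algebra_simps)
    qed
    then have "coeff ?P 2 = coeff ?Q 2" by simp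
    moreover have lin: "coeff (R * [:a, b:]) 2 = coeff R 2 * a + coeff R 1 * b" for R and a b :: 'k
      by (simp add: numeral_2_eq_2 mult.commute)
    moreover have lin2: "coeff [:a, b:] 2 = 0" for a b :: 'k
      by (simp add: numeral_2_eq_2)
    have pow: "coeff ([:a, b:] ^ n) 1 = of_nat n * b * a ^ m" "coeff ([:a, b:] ^ n) 2 = of_nat (n choose 2) * b\<^sup>2 * a ^ (m - 1)"
      for a b :: 'k
    proof -
      have "n - 1 = m" "n - 2 = m - 1" by (simp_all add: m)
      then show "coeff ([:a, b:] ^ n) 1 = of_nat n * b * a ^ m" "coeff ([:a, b:] ^ n) 2 = of_nat (n choose 2) * b\<^sup>2 * a ^ (m - 1)"
        using coeff_linear_poly_power[of 1 n a b] coeff_linear_poly_power[of 2 n a b] n by simp_all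
    qed
    ultimately have eq: "of_nat (n choose 2) * p\<^sup>2 * y ^ (m - 1) + of_nat n * p * y ^ m * r +
        (of_nat (n choose 2) * r\<^sup>2 * y + of_nat n * r * p) = of_nat (n choose 2) * y0 ^ (m - 1) * z0"
      unfolding coeff_add coeff_smult lin lin2 pow by (simp add: mult_ac)
    \<comment> \<open>Twice the binomial coefficient is n m, so the common factor n of the whole
      equation can be cancelled.\<close>
    have "2 * (n choose 2) = n * m" using choose_two[of n] by (simp add: m)
    then have two: "of_nat n * of_nat m = (2 * of_nat (n choose 2) :: 'k)"
      by (metis of_nat_mult of_nat_numeral)
    have "of_nat n * (2 * p * r * y ^ m + of_nat m * p\<^sup>2 * y ^ (m - 1) + of_nat m * r\<^sup>2 * y + 2 * p * r) =
        2 * of_nat n * p * r * y ^ m + (of_nat n * of_nat m) * p\<^sup>2 * y ^ (m - 1) + (of_nat n * of_nat m) * r\<^sup>2 * y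
          + 2 * of_nat n * p * r"
      by (simp add: algebra_simps del: of_nat_mult)
    also have "\<dots> = 2 * (of_nat (n choose 2) * y0 ^ (m - 1) * z0)"
      unfolding two eq[symmetric] by (simp add: algebra_simps)
    also have "\<dots> = of_nat n * (of_nat m * y0 ^ (m - 1) * z0)"
      by (simp add: mult.assoc flip: two)
    finally have "of_nat n * (2 * p * r * y ^ m + of_nat m * p\<^sup>2 * y ^ (m - 1) + of_nat m * r\<^sup>2 * y + 2 * p * r) =
       of_nat n * (of_nat m * y0 ^ (m - 1) * z0)" .
    then show ?thesis
      using n unfolding y0_def z0_def by (simp del: of_nat_mult)
  qed
  moreover have "m \<ge> 3" "m \<noteq> 4" using n by (simp_all add: m)
  ultimately show False
    using second_polar_not_linear_power_mult[OF _ _ pr root] by blast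
qed

text \<open>With parameter 1 the form is symmetric in y and z, so the previous lemma also applies
  after exchanging the columns of the matrix.\<close>

lemma binary_form_symmetry_monomial:
  fixes p q r s :: "'k::field_char_0"
  assumes d: "d \<ge> 5" "d \<noteq> 6" and det: "p * s - q * r \<noteq> 0"
    and inv: "\<And>y z. binary_form d 1 (p * y + q * z) (r * y + s * z) = binary_form d 1 y z"
  shows "q = 0 \<and> r = 0 \<or> p = 0 \<and> s = 0"
proof -
  have sym: "binary_form d (1 :: 'k) y z = binary_form d 1 z y" for y z
    by (simp add: binary_form_def)
  have "p = 0 \<or> r = 0"
    using d det inv by (rule binary_form_symmetry_fixes_axes)
  moreover have "q = 0 \<or> s = 0"
  proof (rule binary_form_symmetry_fixes_axes[OF d])
    show "q * r - p * s \<noteq> 0" using det by (simp add: algebra_simps)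
    show "binary_form d 1 (q * y + p * z) (s * y + r * z) = binary_form d 1 y z" for y z
      using inv[of z y] sym by (simp add: add.commute)
  qed
  ultimately show ?thesis using det by auto
qed

lemma binary_form_diagonal:
  fixes p s :: "'k::field_char_0"
  assumes d: "d \<ge> 4" and inv: "\<And>y z. binary_form d 1 (p * y) (s * z) = binary_form d 1 y z"
  shows "p ^ (d - 1) * s = 1" "p * s ^ (d - 1) = 1"
proof -
  define a b where "a = p ^ (d - 1) * s" and "b = p * s ^ (d - 1)"
  have "a * t + b * t ^ (d - 1) = t + t ^ (d - 1)" for t
    using inv[of 1 t] by (simp add: binary_form_def a_def b_def power_mult_distrib mult_ac)
  \<comment> \<open>Two evaluations suffice: 2^(d-1) differs from 2, so the linear system determines
    a and b.\<close>
  from this[of 1] this[of 2] have e: "a + b = 2" "a * 2 + b * 2 ^ (d - 1) = 2 + 2 ^ (d - 1)" by auto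
  have "a = 2 - b" using e(1) by (simp add: eq_diff_eq)
  then have "(b - 1) * (2 ^ (d - 1) - 2) = 0" using e(2)[unfolded \<open>a = 2 - b\<close>] by (simp add: algebra_simps)
  moreover have "(2 :: 'k) ^ (d - 1) \<noteq> 2"
  proof -
    have "(2 :: nat) ^ 1 < 2 ^ (d - 1)" using d by (intro power_strict_increasing) auto
    then show ?thesis by (metis nat_neq_iff of_nat_eq_iff of_nat_numeral of_nat_power power_one_right)
  qed
  ultimately have "b = 1" by simp
  with e(1) show "p ^ (d - 1) * s = 1" "p * s ^ (d - 1) = 1"
    by (auto simp: a_def b_def)
qed

section \<open>The general degree\<close>

lemma power_int_cong_mod:
  fixes \<zeta> :: "'k::field"
  assumes "\<zeta> ^ n = 1" "\<zeta> \<noteq> 0" "a mod int n = b mod int n"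
  shows "\<zeta> powi a = \<zeta> powi b"
proof -
  have "\<zeta> powi c = \<zeta> powi (c mod int n)" for c
  proof -
    have "\<zeta> powi c = \<zeta> powi (int n * (c div int n) + c mod int n)" by simp
    also have "\<dots> = (\<zeta> powi int n) powi (c div int n) * \<zeta> powi (c mod int n)"
      using assms(2) by (simp only: power_int_add power_int_mult disj_absorb simp_thms)
    finally show ?thesis using assms(1) by simp
  qed
  then show ?thesis using assms(3) by metis
qed

lemma power_int_eq_imp_eq:
  fixes \<zeta> :: "'k::field"
  assumes n: "n > 0" and \<zeta>: "\<And>j. \<zeta> ^ j = 1 \<longleftrightarrow> n dvd j"
    and "\<zeta> powi a = \<zeta> powi b" "a \<in> {0..<int n}" "b \<in> {0..<int n}"
  shows "a = b"
proof -
  have "\<zeta> ^ nat a = \<zeta> ^ nat b" "nat a \<in> {..<n}" "nat b \<in> {..<n}"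
    using assms(3-5) by (auto simp: power_int_def)
  then have "nat a = nat b" using inj_on_primitive_root_power[OF n \<zeta>] by (meson inj_onD)
  then show ?thesis using assms(4,5) by (metis atLeastLessThan_iff eq_nat_nat_iff)
qed

text \<open>Substituting (rho s Y, s Z) into the form with parameter beta gives the coefficients
  rho^(d-1) s^d and beta rho s^d. The first is 1 by the choice of s; the second is then beta /
  rho^(d-2), which the choice of rho makes equal to alpha.\<close>

lemma curve_Aut_C_form_change_parameter:
  fixes \<alpha> \<beta> :: "'k::{alg_closed_field, field_char_0}"
  assumes d: "d \<ge> 3" and "\<alpha> \<noteq> 0" "\<beta> \<noteq> 0"
  shows "curve_Aut (C_form d \<alpha>) \<cong> curve_Aut (C_form d \<beta>)"
proof -
  obtain \<rho> where \<rho>: "\<rho> ^ (d - 2) = \<beta> / \<alpha>"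
    using nth_root_exists[of "d - 2"] d by auto
  have "\<rho> \<noteq> 0" using \<rho> assms by (auto simp: power_0_left split: if_splits)
  obtain s where s: "s ^ d = inverse (\<rho> ^ (d - 1))"
    using nth_root_exists[of d] d by auto
  have "s \<noteq> 0" using s \<open>\<rho> \<noteq> 0\<close> d by (auto simp: power_0_left)
  have m: "d = Suc (Suc m)" if "m = d - 2" for m using d that by simp
  define m where "m = d - 2"
  note m = m[OF m_def]
  have 1: "(\<rho> * s) ^ (d - 1) * s = 1"
  proof -
    have "(\<rho> * s) ^ (d - 1) * s = \<rho> ^ (d - 1) * s ^ d"
      by (simp add: m power_mult_distrib mult_ac)
    then show ?thesis unfolding s using \<open>\<rho> \<noteq> 0\<close> by simp
  qed
  have "\<beta> * (\<rho> * s) * s ^ (d - 1) * \<rho> ^ m = \<alpha> * \<rho> ^ m"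
  proof -
    have "\<beta> * (\<rho> * s) * s ^ (d - 1) * \<rho> ^ m = \<beta> * (\<rho> ^ (d - 1) * s ^ d)"
      by (simp add: m mult_ac)
    also have "\<dots> = \<beta>" unfolding s using \<open>\<rho> \<noteq> 0\<close> by simp
    also have "\<dots> = \<alpha> * \<rho> ^ m" using \<rho> \<open>\<alpha> \<noteq> 0\<close> by (simp add: m)
    finally show ?thesis .
  qed
  then have 2: "\<beta> * (\<rho> * s) * s ^ (d - 1) = \<alpha>" using \<open>\<rho> \<noteq> 0\<close> by simp
  show ?thesis
  proof (rule curve_Aut_substitution)
    show "homogeneous d (C_form d \<beta>)" using d by (intro homogeneous_C_form) auto
    show "invertible (block_matrix 1 (\<rho> * s) 0 0 s)"
      using \<open>\<rho> \<noteq> 0\<close> \<open>s \<noteq> 0\<close> by (simp add: invertible_block_matrix_iff)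
    fix v :: "'k^3"
    have "C_form d \<beta> (block_matrix 1 (\<rho> * s) 0 0 s *v v) =
        v $ 1 ^ d + ((\<rho> * s) ^ (d - 1) * s) * (v $ 2 ^ (d - 1) * v $ 3)
          + (\<beta> * (\<rho> * s) * s ^ (d - 1)) * (v $ 2 * v $ 3 ^ (d - 1))"
      by (simp add: C_form_def block_matrix_vector power_mult_distrib mult_ac)
    then show "C_form d \<alpha> v = 1 * C_form d \<beta> (block_matrix 1 (\<rho> * s) 0 0 s *v v)"
      unfolding 1 2 by (simp add: C_form_def)
  qed simp
qed

text \<open>Every symmetry of f is diagonal or antidiagonal, and a diagonal one is determined by its
  entry p, an n-th root of unity, since s = p^(1-d).\<close>

lemma curve_Aut_C_form_iso_metacyclic_group:
  assumes d: "d \<ge> 5" "d \<noteq> 6"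
  shows "curve_Aut (C_form d (1 :: 'k::{alg_closed_field, field_char_0})) \<cong> metacyclic_group (d * (d - 2)) (1 - int d)"
proof -
  define n where "n = d * (d - 2)"
  have n: "n > 0" using d by (simp add: n_def)
  obtain \<zeta> :: 'k where \<zeta>: "\<And>j. \<zeta> ^ j = 1 \<longleftrightarrow> n dvd j"
    using primitive_root_of_unity_exists[OF n] by blast
  have \<zeta>n: "\<zeta> ^ n = 1" using \<zeta> by simp
  then have \<zeta>0: "\<zeta> \<noteq> 0" using n by (auto simp: power_0_left)
  define z where "z a = \<zeta> powi a" for a
  have z_add: "z (a + b) = z a * z b" for a b
    using \<zeta>0 by (simp add: z_def power_int_add)
  have z_power: "z a ^ j = z (a * int j)" for a j
    by (simp add: z_def power_int_mult)
  have z_cong: "z a = z b" if "a mod int n = b mod int n" for a b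
    unfolding z_def by (rule power_int_cong_mod[OF \<zeta>n \<zeta>0 that])
  have z_mod [simp]: "z (a mod int n) = z a" for a
    by (rule z_cong) simp
  have z_mod_mult [simp]: "z (b * (a mod int n)) = z (b * a)" for a b
    by (rule z_cong) (simp add: mod_mult_right_eq)
  have z0: "z 0 = 1" by (simp add: z_def)
  have z_nonzero: "z a \<noteq> 0" for a using \<zeta>0 by (simp add: z_def)
  define k where "k = 1 - int d"
  have "(k * k) mod int n = 1 mod int n"
    unfolding n_def k_def using d by (intro metacyclic_square) auto
  then have kk: "z (k * (k * a)) = z a" for a
    by (intro z_cong) (metis mod_mult_left_eq mult.assoc mult_1)
  have dk: "int (d - 1) = - k" using d by (simp add: k_def of_nat_diff)
  \<comment> \<open>(1, 0) becomes the diagonal generator with entries zeta and zeta^k, and (0, 1)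
    becomes the exchange of Y and Z; conjugation by the exchange requires k^2 = 1 modulo n.\<close>
  define M where "M = (\<lambda>(i, h :: int). if h = 0 then block_matrix 1 (z i) 0 0 (z (k * i))
      else block_matrix 1 0 (z i) (z (k * i)) 0)"
  let ?H = "metacyclic_group n k"
  have H: "carrier ?H = {0..<int n} \<times> {0, 1}"
    using n by (auto simp: metacyclic_group_def semidirect_product_def carrier_integer_mod_group)
  have "curve_Aut (C_form d (1 :: 'k)) \<cong> ?H"
  proof (rule curve_Aut_isoI[where M = M])
    show "homogeneous d (C_form d (1 :: 'k))" using d by (intro homogeneous_C_form) auto
    show "group ?H"
      unfolding n_def k_def using d by (intro group_metacyclic_group metacyclic_square) auto
  next
    fix x assume "x \<in> carrier ?H"
    then obtain i h where x: "x = (i, h)" by fastforce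
    have e: "z i ^ (d - 1) * z (k * i) = 1" "z i * z (k * i) ^ (d - 1) = 1"
    proof -
      have "i * int (d - 1) + k * i = 0" by (simp only: dk) simp
      then show "z i ^ (d - 1) * z (k * i) = 1"
        by (simp only: z_power z0 flip: z_add)
      have "z (k * i) ^ (d - 1) = z (- (k * (k * i)))"
        unfolding z_power dk by (simp add: mult_ac)
      also have "\<dots> = inverse (z (k * (k * i)))"
        by (simp add: z_def power_int_minus)
      finally have "z (k * i) ^ (d - 1) = inverse (z (k * (k * i)))" .
      then show "z i * z (k * i) ^ (d - 1) = 1"
        using z_nonzero by (simp add: kk)
    qed
    have diag: "binary_form d 1 (z i * y) (z (k * i) * w) = binary_form d 1 y w" for y w
    proof -
      have "binary_form d 1 (z i * y) (z (k * i) * w) =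
          (z i ^ (d - 1) * z (k * i)) * (y ^ (d - 1) * w) + (z i * z (k * i) ^ (d - 1)) * (y * w ^ (d - 1))"
        by (simp add: binary_form_def power_mult_distrib mult_ac)
      then show ?thesis unfolding e by (simp add: binary_form_def)
    qed
    moreover have "binary_form d 1 (z i * y) (z (k * i) * w) = binary_form d 1 w y" for y w
      unfolding diag by (simp add: binary_form_def)
    ultimately show "preserves (C_form d 1) (M x)"
      by (auto simp: x M_def z_nonzero intro!: preserves_C_form_block_matrix)
  next
    fix x y assume "x \<in> carrier ?H" "y \<in> carrier ?H"
    then obtain i h j g where xy: "x = (i, h)" "y = (j, g)" "h \<in> {0, 1}" "g \<in> {0, 1}"
      by (auto simp: H)
    have "M (x \<otimes>\<^bsub>?H\<^esub> y) = M x ** M y"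
      using xy(3,4)
      by (auto simp: M_def metacyclic_group_def semidirect_product_def block_matrix_mult xy(1,2)
          z_add kk distrib_left)
    then show "PGL_class (M (x \<otimes>\<^bsub>?H\<^esub> y)) = PGL_class (M x ** M y)" by simp
  next
    fix x y assume "x \<in> carrier ?H" "y \<in> carrier ?H" and eq: "PGL_class (M x) = PGL_class (M y)"
    then obtain i h j g where xy: "x = (i, h)" "y = (j, g)" "h \<in> {0, 1}" "g \<in> {0, 1}"
      "i \<in> {0..<int n}" "j \<in> {0..<int n}"
      by (auto simp: H)
    have "h = g" "z i = z j"
      using eq xy(3,4) z_nonzero by (auto simp: xy(1,2) M_def PGL_class_block_matrix_1_eq_iff)
    then show "x = y"
      using power_int_eq_imp_eq[OF n \<zeta>] xy by (simp add: z_def)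
  next
    fix A :: "'k^3^3" assume "preserves (C_form d 1) A"
    then obtain p q r s where A: "PGL_class A = PGL_class (block_matrix 1 p q r s)" "p * s - q * r \<noteq> 0"
      and inv: "\<And>y z. binary_form d 1 (p * y + q * z) (r * y + s * z) = binary_form d 1 y z"
      using preserves_C_form_normalised[OF d(1) one_neq_zero] by metis
    have *: "\<exists>i. 0 \<le> i \<and> i < int n \<and> a = z i \<and> b = z (k * i)"
      if "\<And>y z. binary_form d 1 (a * y) (b * z) = binary_form d 1 y z" for a b :: 'k
    proof -
      have ab: "a ^ (d - 1) * b = 1" "a * b ^ (d - 1) = 1"
        using binary_form_diagonal[OF _ that] d by auto
      then have "b = inverse (a ^ (d - 1))" "a \<noteq> 0"
        using inverse_unique by (metis, auto)
      \<comment> \<open>Raising a^(d-1) b = 1 to the power d - 1 and using (d - 1)^2 = n + 1 leaves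
        a^n (a b^(d-1)) = 1.\<close>
      have "a ^ n = 1"
      proof -
        obtain m where "d = m + 2" using d le_Suc_ex[of 2 d] by (auto simp: add.commute)
        then have "(d - 1) * (d - 1) = Suc n" by (simp add: n_def algebra_simps)
        then have "1 = a ^ Suc n * b ^ (d - 1)"
          using ab(1) by (metis power_mult power_mult_distrib power_one)
        also have "a ^ Suc n * b ^ (d - 1) = a ^ n * (a * b ^ (d - 1))" by (simp add: mult_ac)
        finally show ?thesis unfolding ab(2) by simp
      qed
      then obtain i where i: "i < n" "a = \<zeta> ^ i"
        using root_of_unity_is_power[OF n \<zeta>] by blast
      then have a: "a = z (int i)" by (simp add: z_def)
      have "b = inverse (z (int i * - k))"
        unfolding \<open>b = _\<close> a z_power dk ..
      also have "\<dots> = z (k * int i)"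
        by (simp add: z_def mult.commute flip: power_int_minus)
      finally have "b = z (k * int i)" .
      then show ?thesis using i a by (intro exI[of _ "int i"]) auto
    qed
    have "q = 0 \<and> r = 0 \<or> p = 0 \<and> s = 0"
      using d A(2) inv by (rule binary_form_symmetry_monomial)
    then show "\<exists>x\<in>carrier ?H. PGL_class (M x) = PGL_class A"
    proof
      assume qr: "q = 0 \<and> r = 0"
      then obtain i where "0 \<le> i" "i < int n" "p = z i" "s = z (k * i)"
        using *[of p s] inv by auto
      then show ?thesis
        using qr by (intro bexI[of _ "(i, 0)"]) (auto simp: M_def H A)
    next
      assume ps: "p = 0 \<and> s = 0"
      then have "binary_form d 1 (q * y) (r * w) = binary_form d 1 y w" for y w
        using inv[of w y] by (simp add: binary_form_def mult_ac add_ac)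
      then obtain i where "0 \<le> i" "i < int n" "q = z i" "r = z (k * i)"
        using *[of q r] by auto
      then show ?thesis
        using ps by (intro bexI[of _ "(i, 1)"]) (auto simp: M_def H A)
    qed
  qed
  then show ?thesis by (simp add: n_def k_def)
qed

section \<open>Degree 6\<close>

lemma binary_form_6: "binary_form 6 (- 1) y z = y ^ 5 * z - y * z ^ 5"
  by (simp add: binary_form_def)

text \<open>The stabiliser of the vertex (1:0): the missing y^4 term forces q = 0, and comparing the
  terms in y^5 and y at z = 1 leaves a rotation by a fourth root of unity.\<close>

lemma octahedral_upper_triangular:
  fixes p q s c :: "'k::field_char_0"
  assumes "p \<noteq> 0" "s \<noteq> 0"
    and inv: "\<And>y z. binary_form 6 (- 1) (p * y + q * z) (s * z) = c * binary_form 6 (- 1) y z"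
  shows "q = 0" "s ^ 4 = p ^ 4"
proof -
  have "smult s ([:q, p:] ^ 5) - smult (s ^ 5) [:q, p:] = smult c (monom 1 5 - monom 1 1)" (is "?P = ?Q")
  proof (rule poly_ext)
    fix y
    show "poly ?P y = poly ?Q y"
      using inv[of y 1] by (simp add: binary_form_6 poly_monom algebra_simps)
  qed
  then have "coeff ?P j = coeff ?Q j" for j by simp
  then have eq: "s * coeff ([:q, p:] ^ 5) j - s ^ 5 * coeff [:q, p:] j =
      c * (coeff (monom 1 5) j - coeff (monom 1 1) j)" for j
    by (simp only: coeff_diff coeff_smult)
  have lin: "coeff [:q, p:] j = (if j = 1 then p else if j = 0 then q else 0)" for j
    by (auto simp: coeff_pCons split: nat.split)
  have "s * (5 * p ^ 4 * q) = 0"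
    using eq[of 4] coeff_linear_poly_power[of 4 5 q p] by (simp add: lin binomial_Suc_n[of 4, simplified])
  then show "q = 0" using assms by simp
  have "s * p ^ 5 = c" using eq[of 5] coeff_linear_poly_power[of 5 5 q p] by (simp add: lin)
  moreover have "s ^ 5 * p = c" using eq[of 1] coeff_linear_poly_power[of 1 5 q p] \<open>q = 0\<close> by (simp add: lin)
  moreover have "s * p * (s ^ 4 - p ^ 4) = s ^ 5 * p - s * p ^ 5" by algebra
  ultimately have "s * p * (s ^ 4 - p ^ 4) = 0" by simp
  then show "s ^ 4 = p ^ 4" using assms by simp
qed

text \<open>The binary form of degree 6 vanishes at the vertices of an octahedron. Moving the image of the
  vertex \<open>(1:0)\<close> back by a known rotation leaves an upper triangular matrix.\<close>

lemma octahedral_cases: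
  fixes p q r s c :: "'k::field_char_0"
  assumes det: "p * s - q * r \<noteq> 0" 
    and inv: "\<And>y z. binary_form 6 (- 1) (p * y + q * z) (r * y + s * z) = c * binary_form 6 (- 1) y z"
  obtains (diagonal) u where "u ^ 4 = 1" "q = 0" "r = 0" "s = u * p"
  | (antidiagonal) u where "u ^ 4 = 1" "p = 0" "s = 0" "r = u * q"
  | (full) u t where "u ^ 4 = 1" "t ^ 4 = 1" "p \<noteq> 0" "q = u * p" "r = t * p" "s = - t * u * p"
proof -
  have "binary_form 6 (- 1) p r = 0"
    using inv[of 1 0] by (simp add: binary_form_6)
  moreover have "binary_form 6 (- 1) p r = p * r * (p ^ 4 - r ^ 4)"
    unfolding binary_form_6 by algebra
  ultimately have "p * r * (p ^ 4 - r ^ 4) = 0" by simp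
  then consider "r = 0" | "p = 0" | "p \<noteq> 0" "r \<noteq> 0" "p ^ 4 = r ^ 4" by auto
  then show thesis
  proof cases
    case 1
    have nz: "p \<noteq> 0" "s \<noteq> 0" using det 1 by auto
    have "q = 0" "s ^ 4 = p ^ 4"
      using octahedral_upper_triangular[OF nz, of q c] inv 1 by auto
    then show thesis using 1 nz by (intro diagonal[of "s / p"]) (auto simp: power_divide)
  next
    case 2
    have nz: "r \<noteq> 0" "q \<noteq> 0" using det 2 by auto
    have "binary_form 6 (- 1) (r * y + s * z) (q * z) = - c * binary_form 6 (- 1) y z" for y z
      using inv[of y z] 2 by (simp add: binary_form_6 algebra_simps)
    then have "s = 0" "q ^ 4 = r ^ 4"
      using octahedral_upper_triangular[OF nz, of s "- c"] by auto
    then show thesis using 2 nz by (intro antidiagonal[of "r / q"]) (auto simp: power_divide)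
  next
    case 3
    define t where "t = r / p"
    have t: "t ^ 4 = 1" "t \<noteq> 0" "r = t * p" using 3 by (auto simp: t_def power_divide)
    \<comment> \<open>The rotation of the octahedron that takes (1:t) to (1:0); composed with the
      given matrix it yields an upper triangular one.\<close>
    have rotate: "binary_form 6 (- 1) (a + b / t) (a - b / t) = 8 / t * binary_form 6 (- 1) a b" for a b
    proof -
      define e where "e = b / t"
      have b: "b = t * e" using t(2) by (simp add: e_def)
      have "binary_form 6 (- 1) (a + e) (a - e) = 8 * (a ^ 5 * e - a * e ^ 5)"
        unfolding binary_form_6 by algebra
      also have "\<dots> = 8 / t * (a ^ 5 * b - a * b ^ 5)"
      proof -
        have "t ^ 5 = t ^ 4 * t" by (simp add: numeral_eq_Suc)
        then have "t ^ 5 = t" using t(1) by simp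
        then have "a ^ 5 * b - a * b ^ 5 = t * (a ^ 5 * e - a * e ^ 5)"
          by (simp add: b power_mult_distrib algebra_simps)
        then show ?thesis using t(2) by simp
      qed
      finally show ?thesis by (simp add: e_def binary_form_6)
    qed
    have "binary_form 6 (- 1) (2 * p * y + (q + s / t) * z) ((q - s / t) * z) = 8 / t * c * binary_form 6 (- 1) y z" for y z
    proof -
      have *: "(p * y + q * z) + (r * y + s * z) / t = 2 * p * y + (q + s / t) * z"
        and **: "(p * y + q * z) - (r * y + s * z) / t = (q - s / t) * z"
        using t by (simp_all add: field_simps)
      show ?thesis using rotate[of "p * y + q * z" "r * y + s * z"] unfolding * ** inv by (simp add: mult.assoc)
    qed
    moreover have "q - s / t \<noteq> 0" using det t by (auto simp: field_simps)
    ultimately have "q + s / t = 0" and pow: "(q - s / t) ^ 4 = (2 * p) ^ 4"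
      using octahedral_upper_triangular[of "2 * p" "q - s / t" "q + s / t" "8 / t * c"] 3(1) by auto
    then have s: "s = - t * q" using t(2) by (simp add: field_simps eq_neg_iff_add_eq_0)
    then have "(2 * q) ^ 4 = (2 * p) ^ 4" using pow t(2) by simp
    then have "q ^ 4 = p ^ 4" by (simp add: power_mult_distrib)
    then show thesis
      using t s 3(1) by (intro full[of "q / p" t]) (auto simp: power_divide)
  qed
qed

text \<open>The zeros of the four quadratic forms are the pairs of opposite faces of the octahedron.\<close>

definition face_pair :: "'k::field \<Rightarrow> nat \<Rightarrow> 'k \<Rightarrow> 'k \<Rightarrow> 'k" where
  "face_pair I k y z = y\<^sup>2 + I ^ k * (1 + I) * y * z - (- 1) ^ k * I * z\<^sup>2"

text \<open>In this direction A moves the zeros of form k to those of form j, and products of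
  matrices give products of permutations in the same order.\<close>

definition maps_face_pair :: "'k::field \<Rightarrow> 'k^3^3 \<Rightarrow> nat \<Rightarrow> nat \<Rightarrow> bool" where
  "maps_face_pair I A k j \<longleftrightarrow>
     (\<exists>c. c \<noteq> 0 \<and> (\<forall>v. face_pair I j ((A *v v) $ 2) ((A *v v) $ 3) = c * face_pair I k (v $ 2) (v $ 3)))"

text \<open>Extended by the identity outside {1..4}, as \<open>permutes\<close> demands.\<close>

definition face_perm :: "'k::field \<Rightarrow> 'k^3^3 \<Rightarrow> nat \<Rightarrow> nat" where
  "face_perm I A k = (if k \<in> {1..4} then THE j. j \<in> {1..4} \<and> maps_face_pair I A k j else k)"

lemma face_perm_outside: "k \<notin> {1..4} \<Longrightarrow> face_perm I A k = k"
  unfolding face_perm_def by (rule if_not_P)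

lemma maps_face_pair_mult:
  "maps_face_pair I A j l \<Longrightarrow> maps_face_pair I B k j \<Longrightarrow> maps_face_pair I (A ** B) k l"
  unfolding maps_face_pair_def
  by (auto simp flip: matrix_vector_mul_assoc) (metis mult.assoc no_zero_divisors)

lemma maps_face_pair_inverse:
  assumes "A ** B = mat 1" "B ** A = mat 1" "maps_face_pair I A k j"
  shows "maps_face_pair I B j k"
proof -
  obtain c where c: "c \<noteq> 0" "\<And>v. face_pair I j ((A *v v) $ 2) ((A *v v) $ 3) = c * face_pair I k (v $ 2) (v $ 3)"
    using assms(3) by (auto simp: maps_face_pair_def)
  have "face_pair I k ((B *v v) $ 2) ((B *v v) $ 3) = inverse c * face_pair I j (v $ 2) (v $ 3)" for v
    using c(2)[of "B *v v"] c(1) by (simp add: matrix_vector_mul_assoc assms)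
  then show ?thesis
    unfolding maps_face_pair_def using c(1) by (intro exI[of _ "inverse c"]) auto
qed

lemma face_pair_scale: "face_pair I k (c * y) (c * z) = c\<^sup>2 * face_pair I k y z"
  by (simp add: face_pair_def power2_eq_square algebra_simps)

lemma maps_face_pair_mat_mult:
  assumes "c \<noteq> 0" "maps_face_pair I A k j"
  shows "maps_face_pair I (mat c ** A) k j"
  using assms unfolding maps_face_pair_def
  by (auto simp: mat_vector_mult face_pair_scale simp flip: matrix_vector_mul_assoc)
    (metis mult.assoc no_zero_divisors power_not_zero)

context
  fixes I :: "'k::{alg_closed_field, field_char_0}"
  assumes I: "I\<^sup>2 = - 1"
begin

lemma imaginary_unit_powers:
  "I ^ 4 = 1" "I ^ 3 = - I" "1 + I \<noteq> 0" "I \<noteq> 0" "I \<noteq> 1" "I \<noteq> - 1" "- I \<noteq> 1"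
proof -
  show "I ^ 3 = - I" using I by (simp add: power3_eq_cube power2_eq_square)
  show "I ^ 4 = 1" using I by (simp add: power4_eq_xxxx power2_eq_square)
  show "I \<noteq> 0" "I \<noteq> 1" "I \<noteq> - 1" using I by auto
  then show "1 + I \<noteq> 0" "- I \<noteq> 1" by (metis add_eq_0_iff, metis minus_minus)
qed

text \<open>The four forms are one orbit of the quarter turn (y, z) to (y, I z), which lowers k by
  one modulo 4. In the coordinate y / z two opposite face centres have sum -I^k (1 + I) and product
  -(-1)^k I.\<close>

lemma face_pair_simps:
  "face_pair I 1 y z = y\<^sup>2 + (I - 1) * y * z + I * z\<^sup>2"
  "face_pair I (Suc 0) y z = y\<^sup>2 + (I - 1) * y * z + I * z\<^sup>2"
  "face_pair I 2 y z = y\<^sup>2 - (1 + I) * y * z - I * z\<^sup>2"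
  "face_pair I 3 y z = y\<^sup>2 + (1 - I) * y * z + I * z\<^sup>2"
  "face_pair I 4 y z = y\<^sup>2 + (1 + I) * y * z - I * z\<^sup>2"
  using I by (simp_all add: face_pair_def imaginary_unit_powers algebra_simps power2_eq_square)

lemma face_indices: "k \<in> {1..4} \<longleftrightarrow> k = 1 \<or> k = 2 \<or> k = 3 \<or> k = (4 :: nat)"
  by auto

text \<open>The leading coefficient makes c = 1, and the coefficients I^k (1 + I) of y z are
  distinct for k = 1, ..., 4.\<close>

lemma face_pair_unique:
  assumes kj: "k \<in> {1..4}" "j \<in> {1..4}" and eq: "\<And>y z. face_pair I k y z = c * face_pair I j y z"
  shows "k = j"
proof -
  have "c = 1" using eq[of 1 0] by (simp add: face_pair_def)
  have diff: "face_pair I l 1 1 - face_pair I l 1 (- 1) = 2 * (I ^ l * (1 + I))" for l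
    by (simp add: face_pair_def)
  have "2 * (I ^ k * (1 + I)) = 2 * (I ^ j * (1 + I))"
    unfolding diff[symmetric] eq \<open>c = 1\<close> by simp
  then have "I ^ k = I ^ j" using imaginary_unit_powers by simp
  then show ?thesis
    using kj imaginary_unit_powers I unfolding face_indices by (auto simp: eq_commute[of _ I])
qed

lemma maps_face_pair_unique:
  assumes A: "invertible A" and "j \<in> {1..4}" "j' \<in> {1..4}" and "maps_face_pair I A k j" "maps_face_pair I A k j'"
  shows "j = j'"
proof -
  obtain c c' where c: "c \<noteq> 0" "c' \<noteq> 0"
    "\<And>v. face_pair I j ((A *v v) $ 2) ((A *v v) $ 3) = c * face_pair I k (v $ 2) (v $ 3)"
    "\<And>v. face_pair I j' ((A *v v) $ 2) ((A *v v) $ 3) = c' * face_pair I k (v $ 2) (v $ 3)"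
    using assms by (auto simp: maps_face_pair_def)
  obtain B where B: "A ** B = mat 1" using A by (auto elim: invertible_inverse_matrix)
  have "face_pair I j y z = (c / c') * face_pair I j' y z" for y z
  proof -
    define v where "v = B *v vector [0, y, z]"
    have "A *v v = vector [0, y, z]" by (simp add: v_def matrix_vector_mul_assoc B)
    then show ?thesis using c(3)[of v] c(4)[of v] c(1,2) by simp
  qed
  then show ?thesis using assms(2,3) by (intro face_pair_unique)
qed

lemma face_perm_eqI:
  assumes "invertible A" "k \<in> {1..4}" "j \<in> {1..4}" "maps_face_pair I A k j"
  shows "face_perm I A k = j"
  using assms maps_face_pair_unique[OF assms(1)] by (auto simp: face_perm_def intro!: the_equality)

definition permutes_faces :: "'k^3^3 \<Rightarrow> bool" where
  "permutes_faces A \<longleftrightarrow> invertible A \<and> (\<forall>k\<in>{1..4}. \<exists>j\<in>{1..4}. maps_face_pair I A k j)"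

lemma permutes_faces_mult: "permutes_faces A \<Longrightarrow> permutes_faces B \<Longrightarrow> permutes_faces (A ** B)"
  unfolding permutes_faces_def by (metis invertible_mult maps_face_pair_mult)

lemma permutes_faces_mat_mult: "permutes_faces A \<Longrightarrow> c \<noteq> 0 \<Longrightarrow> permutes_faces (mat c ** A)"
  unfolding permutes_faces_def by (metis invertible_mult invertible_mat maps_face_pair_mat_mult)

lemma maps_face_perm:
  assumes "permutes_faces A" "k \<in> {1..4}"
  shows "face_perm I A k \<in> {1..4}" "maps_face_pair I A k (face_perm I A k)"
proof -
  obtain j where j: "j \<in> {1..4}" "maps_face_pair I A k j"
    using assms unfolding permutes_faces_def by blast
  then have "face_perm I A k = j" using assms by (intro face_perm_eqI) (auto simp: permutes_faces_def)
  then show "face_perm I A k \<in> {1..4}" "maps_face_pair I A k (face_perm I A k)"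
    using j by auto
qed

lemma face_perm_permutes:
  assumes A: "permutes_faces A"
  shows "face_perm I A permutes {1..4}"
proof (rule bij_imp_permutes)
  obtain B where B: "A ** B = mat 1" "B ** A = mat 1" "invertible B"
    using A by (auto simp: permutes_faces_def elim: invertible_inverse_matrix)
  have "inj_on (face_perm I A) {1..4}"
  proof (rule inj_onI)
    fix k k' assume k: "k \<in> {1..4}" "k' \<in> {1..4}" "face_perm I A k = face_perm I A k'"
    then show "k = k'"
      using maps_face_pair_inverse[OF B(1,2)] maps_face_perm(2)[OF A] maps_face_pair_unique[OF B(3)] by metis
  qed
  moreover have "face_perm I A ` {1..4} \<subseteq> {1..4}" using maps_face_perm(1)[OF A] by blast
  ultimately show "bij_betw (face_perm I A) {1..4} {1..4}"
    by (simp add: bij_betw_def endo_inj_surj)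
qed (auto simp: face_perm_def)

lemma face_perm_mult:
  assumes "permutes_faces A" "permutes_faces B"
  shows "face_perm I (A ** B) = face_perm I A \<circ> face_perm I B"
proof
  fix k
  show "face_perm I (A ** B) k = (face_perm I A \<circ> face_perm I B) k"
  proof (cases "k \<in> {1..4}")
    case True
    then have "face_perm I (A ** B) k = face_perm I A (face_perm I B k)"
      using assms maps_face_perm[OF assms(1)] maps_face_perm[OF assms(2)]
      by (intro face_perm_eqI maps_face_pair_mult[of I A "face_perm I B k"]) (auto simp: permutes_faces_def invertible_mult)
    then show ?thesis by simp
  next
    case False
    then show ?thesis by (simp only: face_perm_outside comp_apply simp_thms)
  qed
qed

lemma face_perm_mat_mult:
  assumes "permutes_faces A" "c \<noteq> 0"
  shows "face_perm I (mat c ** A) = face_perm I A"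
proof
  fix k
  show "face_perm I (mat c ** A) k = face_perm I A k"
  proof (cases "k \<in> {1..4}")
    case True
    then show ?thesis
      using assms maps_face_perm[OF assms(1)] permutes_faces_mat_mult[OF assms]
      by (intro face_perm_eqI maps_face_pair_mat_mult) (auto simp: permutes_faces_def)
  qed (simp only: face_perm_outside simp_thms)
qed

lemma maps_face_pair_blockI:
  assumes "c \<noteq> 0" "\<And>y z. face_pair I j (p * y + q * z) (r * y + s * z) = c * face_pair I k y z"
  shows "maps_face_pair I (block_matrix x p q r s) k j"
  unfolding maps_face_pair_def using assms by (auto simp: block_matrix_vector intro!: exI[of _ c])

lemma fourth_root_of_unity_cases: "u ^ 4 = 1 \<Longrightarrow> u = 1 \<or> u = - 1 \<or> u = I \<or> u = - I"
proof -
  assume "u ^ 4 = 1"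
  then have "(u - 1) * (u + 1) * (u - I) * (u + I) = 0"
    using I by algebra
  then show ?thesis by (auto simp: eq_neg_iff_add_eq_0)
qed

text \<open>The quarter turn acts as a 4-cycle; together with the transposition induced by the half
  turn below it generates S_4. The entry x stays free, to be chosen later so that the sextic is
  preserved.\<close>

lemma quarter_turn_maps_face_pair:
  assumes "x \<noteq> 0"
  shows "invertible (block_matrix x 1 0 0 I)"
    "maps_face_pair I (block_matrix x 1 0 0 I) 1 4" "maps_face_pair I (block_matrix x 1 0 0 I) 2 1"
    "maps_face_pair I (block_matrix x 1 0 0 I) 3 2" "maps_face_pair I (block_matrix x 1 0 0 I) 4 3"
  using assms I imaginary_unit_powers
  by (auto intro!: maps_face_pair_blockI[of 1] simp: face_pair_simps invertible_block_matrix_iff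
      power_mult_distrib algebra_simps power2_eq_square)

lemma half_turn_maps_face_pair:
  assumes "x \<noteq> 0"
  shows "invertible (block_matrix x 1 1 1 (- 1))"
    "maps_face_pair I (block_matrix x 1 1 1 (- 1)) 1 2" "maps_face_pair I (block_matrix x 1 1 1 (- 1)) 2 1"
    "maps_face_pair I (block_matrix x 1 1 1 (- 1)) 3 3" "maps_face_pair I (block_matrix x 1 1 1 (- 1)) 4 4"
proof -
  have II: "I * I = - 1" using I by (simp add: power2_eq_square)
  then have II': "I * (I * a) = - a" for a by (simp flip: mult.assoc)
  show "invertible (block_matrix x 1 1 1 (- 1))"
    using assms by (simp add: invertible_block_matrix_iff)
  \<comment> \<open>The factors here and below are the values of the target form at (1, 1), the
    image of (1, 0), where the source form is 1.\<close>
  show "maps_face_pair I (block_matrix x 1 1 1 (- 1)) 1 2"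
    by (rule maps_face_pair_blockI[of "- 2 * I"])
      (use imaginary_unit_powers in \<open>auto simp: face_pair_simps algebra_simps power2_eq_square II II'\<close>)
  show "maps_face_pair I (block_matrix x 1 1 1 (- 1)) 2 1"
    by (rule maps_face_pair_blockI[of "2 * I"])
      (use imaginary_unit_powers in \<open>auto simp: face_pair_simps algebra_simps power2_eq_square II II'\<close>)
  show "maps_face_pair I (block_matrix x 1 1 1 (- 1)) 3 3"
    by (rule maps_face_pair_blockI[of 2])
      (use imaginary_unit_powers in \<open>auto simp: face_pair_simps algebra_simps power2_eq_square II II'\<close>)
  show "maps_face_pair I (block_matrix x 1 1 1 (- 1)) 4 4"
    by (rule maps_face_pair_blockI[of 2])
      (use imaginary_unit_powers in \<open>auto simp: face_pair_simps algebra_simps power2_eq_square II II'\<close>)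
qed

lemma permutes_facesI:
  assumes "invertible A"
    and "maps_face_pair I A 1 j1" "maps_face_pair I A 2 j2" "maps_face_pair I A 3 j3" "maps_face_pair I A 4 j4"
    and "j1 \<in> {1..4}" "j2 \<in> {1..4}" "j3 \<in> {1..4}" "j4 \<in> {1..4}"
  shows "permutes_faces A"
  unfolding permutes_faces_def
proof (intro conjI ballI)
  fix k :: nat assume "k \<in> {1..4}"
  then consider "k = 1" | "k = 2" | "k = 3" | "k = 4" unfolding face_indices by blast
  then show "\<exists>j\<in>{1..4}. maps_face_pair I A k j" using assms by cases metis+
qed (rule assms(1))

lemma permutes_faces_quarter_turn:
  assumes "x \<noteq> 0"
  shows "permutes_faces (block_matrix x 1 0 0 I)"
  by (rule permutes_facesI[OF quarter_turn_maps_face_pair[OF assms]]) auto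

lemma permutes_faces_half_turn:
  assumes "x \<noteq> 0"
  shows "permutes_faces (block_matrix x 1 1 1 (- 1))"
  by (rule permutes_facesI[OF half_turn_maps_face_pair[OF assms]]) auto

lemma permutes_faces_diagonal:
  assumes "x \<noteq> 0" "u ^ 4 = 1"
  shows "permutes_faces (block_matrix x 1 0 0 u)"
proof -
  let ?g = "block_matrix x 1 0 0 I" and ?h = "block_matrix 1 1 0 0 I"
  have II: "I * I = - 1" using I by (simp add: power2_eq_square)
  have "block_matrix x 1 0 0 (- 1) = ?g ** ?h" "block_matrix x 1 0 0 (- I) = ?g ** ?h ** ?h"
    "block_matrix x 1 0 0 1 = ?g ** ?h ** ?h ** ?h"
    by (simp_all add: block_matrix_mult II)
  then show ?thesis
    using fourth_root_of_unity_cases[OF assms(2)] permutes_faces_quarter_turn[OF assms(1)]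
      permutes_faces_quarter_turn[of 1] by (auto intro!: permutes_faces_mult)
qed

lemma preserves_C_form_6_imp_block_matrix:
  fixes A :: "'k^3^3"
  assumes "preserves (C_form 6 (- 1)) A"
  obtains x p q r s where "A = block_matrix x p q r s" "x \<noteq> 0" "p * s - q * r \<noteq> 0"
    "\<And>y z. binary_form 6 (- 1) (p * y + q * z) (r * y + s * z) = x ^ 6 * binary_form 6 (- 1) y z"
proof (rule preserves_C_form_imp_block_matrix[OF _ _ assms])
  show "(5 :: nat) \<le> 6" "- 1 \<noteq> (0 :: 'k)" by simp_all
qed (rule that)

text \<open>In each of \<open>octahedral_cases\<close> the matrix factors, up to a scalar, into
  powers of the quarter turn and the half turn, so the two explicit computations above
  suffice.\<close>

lemma preserves_imp_permutes_faces:
  assumes "preserves (C_form 6 (- 1)) A"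
  shows "permutes_faces A"
proof -
  obtain x p q r s where A: "A = block_matrix x p q r s" "x \<noteq> 0" and det: "p * s - q * r \<noteq> 0"
    and inv: "\<And>y z. binary_form 6 (- 1) (p * y + q * z) (r * y + s * z) = x ^ 6 * binary_form 6 (- 1) y z"
    using preserves_C_form_6_imp_block_matrix[OF assms] by blast
  have D: "permutes_faces (block_matrix y 1 0 0 u)" if "u ^ 4 = 1" "y \<noteq> 0" for u y
    using that by (intro permutes_faces_diagonal)
  have H: "permutes_faces (block_matrix 1 1 1 1 (- 1))"
    by (intro permutes_faces_half_turn) simp
  from det inv show ?thesis
  proof (cases rule: octahedral_cases)
    case (diagonal u)
    then have "p \<noteq> 0" using det by auto
    then have "A = mat p ** block_matrix (x / p) 1 0 0 u"
      using diagonal by (simp add: A mat_mult_block_matrix mult.commute)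
    then show ?thesis using D[of u "x / p"] diagonal A(2) \<open>p \<noteq> 0\<close> by (simp add: permutes_faces_mat_mult)
  next
    case (antidiagonal u)
    then have "q \<noteq> 0" using det by auto
    \<comment> \<open>The half turn conjugates diag(1, -1) into the exchange of the coordinates; it
      squares to 2 on (y, z), whence q / 2.\<close>
    then have eq: "A = mat (q / 2) ** (block_matrix (2 * x / q) 1 0 0 u ** (block_matrix 1 1 1 1 (- 1) **
        block_matrix 1 1 0 0 (- 1) ** block_matrix 1 1 1 1 (- 1)))"
      using antidiagonal by (simp add: A mat_mult_block_matrix block_matrix_mult block_matrix_eq_iff)
    have "permutes_faces (block_matrix (2 * x / q) 1 0 0 u)" "permutes_faces (block_matrix 1 1 0 0 (- 1))"
      using antidiagonal(1) A(2) \<open>q \<noteq> 0\<close> by (auto intro!: D)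
    then show ?thesis
      unfolding eq using \<open>q \<noteq> 0\<close> H by (intro permutes_faces_mat_mult permutes_faces_mult) simp_all
  next
    case (full u t)
    then have eq: "A = mat p ** (block_matrix (x / p) 1 0 0 t ** (block_matrix 1 1 1 1 (- 1) ** block_matrix 1 1 0 0 u))"
      by (simp add: A mat_mult_block_matrix block_matrix_mult block_matrix_eq_iff)
    have "permutes_faces (block_matrix (x / p) 1 0 0 t)" "permutes_faces (block_matrix 1 1 0 0 u)"
      using full A(2) by (auto intro!: D)
    then show ?thesis
      unfolding eq using full(3) H by (intro permutes_faces_mat_mult permutes_faces_mult)
  qed
qed

text \<open>Each fixed form has a factor of proportionality, computed both from the y^2 coefficient
  and from the y z coefficient. These agree only when the block on (y, z) is scalar.\<close>

lemma face_perm_eq_id_imp_homology: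
  assumes A: "preserves (C_form 6 (- 1)) A" and id: "face_perm I A = id"
  shows "\<exists>w. w ^ 6 = 1 \<and> PGL_class A = PGL_class (block_matrix w 1 0 0 1)"
proof -
  obtain x p q r s where A_eq: "A = block_matrix x p q r s" "x \<noteq> 0" and det: "p * s - q * r \<noteq> 0"
    and inv: "\<And>y z. binary_form 6 (- 1) (p * y + q * z) (r * y + s * z) = x ^ 6 * binary_form 6 (- 1) y z"
    using preserves_C_form_6_imp_block_matrix[OF A] by blast
  have "\<exists>c. c \<noteq> 0 \<and> (\<forall>y z. face_pair I k (p * y + q * z) (r * y + s * z) = c * face_pair I k y z)"
    if "k \<in> {1..4}" for k
  proof -
    have "maps_face_pair I A k k"
      using maps_face_perm(2)[OF preserves_imp_permutes_faces[OF A] that] by (simp add: id)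
    then obtain c where c: "c \<noteq> 0" "\<And>v. face_pair I k ((A *v v) $ 2) ((A *v v) $ 3) = c * face_pair I k (v $ 2) (v $ 3)"
      by (auto simp: maps_face_pair_def)
    have "face_pair I k (p * y + q * z) (r * y + s * z) = c * face_pair I k y z" for y z
      using c(2)[of "vector [0, y, z]"] by (simp add: A_eq block_matrix_vector)
    then show ?thesis using c(1) by blast
  qed
  from this[of 1] this[of 2] this[of 4] obtain c1 c2 c4 where c: "c1 \<noteq> 0" "c2 \<noteq> 0" "c4 \<noteq> 0"
    "\<And>y z. face_pair I 1 (p * y + q * z) (r * y + s * z) = c1 * face_pair I 1 y z"
    "\<And>y z. face_pair I 2 (p * y + q * z) (r * y + s * z) = c2 * face_pair I 2 y z"
    "\<And>y z. face_pair I 4 (p * y + q * z) (r * y + s * z) = c4 * face_pair I 4 y z"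
    by auto
  \<comment> \<open>Twice the coefficient of y z, isolated as the difference of the values at (1, 1)
    and (1, -1).\<close>
  have mixed: "4 * p * q + 2 * (I ^ k * (1 + I)) * (p * s + q * r) - (- 1) ^ k * 4 * I * r * s = c * (2 * (I ^ k * (1 + I)))"
    if "\<And>y z. face_pair I k (p * y + q * z) (r * y + s * z) = c * face_pair I k y z" for k c
  proof -
    have "face_pair I k (p + q) (r + s) - face_pair I k (p - q) (r - s) = c * (face_pair I k 1 1 - face_pair I k 1 (- 1))"
      using that[of 1 1] that[of 1 "- 1"] by (simp add: right_diff_distrib)
    moreover have "face_pair I k (p + q) (r + s) - face_pair I k (p - q) (r - s) =
        4 * p * q + 2 * (I ^ k * (1 + I)) * (p * s + q * r) - (- 1) ^ k * 4 * I * r * s"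
      by (simp add: face_pair_def power2_eq_square algebra_simps)
    moreover have "face_pair I k 1 1 - face_pair I k 1 (- 1) = 2 * (I ^ k * (1 + I))"
      by (simp add: face_pair_def)
    ultimately show ?thesis by simp
  qed
  define g where "g = 1 + I"
  have g: "g \<noteq> 0" using imaginary_unit_powers by (simp add: g_def)
  note E = mixed[OF c(4), folded g_def] mixed[OF c(5), folded g_def] mixed[OF c(6), folded g_def]
  from det inv have "q = 0 \<and> r = 0 \<and> s = p"
  proof (cases rule: octahedral_cases)
    case (diagonal u)
    have "p \<noteq> 0" using det diagonal by auto
    have "c4 = p\<^sup>2" using c(6)[of 1 0] diagonal by (simp add: face_pair_simps)
    moreover have "c4 = u * p\<^sup>2"
      using E(3) g imaginary_unit_powers by (simp add: diagonal power2_eq_square mult_ac)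
    ultimately have "u = 1" using \<open>p \<noteq> 0\<close> by simp
    then show ?thesis using diagonal by simp
  next
    case (antidiagonal u)
    have "c1 = I * u\<^sup>2 * q\<^sup>2" "c4 = - I * u\<^sup>2 * q\<^sup>2"
      using c(4)[of 1 0] c(6)[of 1 0] antidiagonal by (simp_all add: face_pair_simps power_mult_distrib mult_ac)
    then have "c4 = - c1" by simp
    moreover have "c1 = u * q\<^sup>2" "c4 = u * q\<^sup>2"
      using E(1) E(3) g imaginary_unit_powers by (simp_all add: antidiagonal power2_eq_square mult_ac)
    then have "c4 = c1" by simp
    ultimately have "c1 + c1 = 0" by (simp add: eq_neg_iff_add_eq_0)
    then show ?thesis using c(1) by simp
  next
    case (full u t)
    have "c2 = p\<^sup>2 - g * p * r - I * r\<^sup>2" "c4 = p\<^sup>2 + g * p * r - I * r\<^sup>2"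
      using c(5)[of 1 0] c(6)[of 1 0] by (simp_all add: face_pair_simps g_def)
    then have c24: "c2 = p\<^sup>2 * (1 - g * t - I * t\<^sup>2)" "c4 = p\<^sup>2 * (1 + g * t - I * t\<^sup>2)"
      by (simp_all add: full power2_eq_square algebra_simps)
    have "p * s + q * r = 0" unfolding full by (simp add: algebra_simps)
    then have e: "4 * p * q - 4 * I * r * s = c4 * (2 * g)" "4 * p * q - 4 * I * r * s = - c2 * (2 * g)"
      using E(2,3) I by (simp_all add: imaginary_unit_powers)
    \<comment> \<open>Forms 2 and 4 differ only in the sign of the y z term, and p s + q r = 0 here,
      so c4 = -c2. The y^2 coefficients then give I t^2 = 1, which is incompatible with t^4 =
      1.\<close>
    have "(c4 + c2) * (2 * g) = c4 * (2 * g) - (- c2 * (2 * g))" by (simp add: algebra_simps)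
    also have "\<dots> = 0" unfolding e[symmetric] by simp
    finally have "(c4 + c2) * (2 * g) = 0" .
    then have "c4 + c2 = 0" using g by simp
    then have "2 * p\<^sup>2 * (1 - I * t\<^sup>2) = 0" unfolding c24 by (simp add: algebra_simps)
    then have "I * t\<^sup>2 = 1" using full(3) by simp
    then have "(I * t\<^sup>2)\<^sup>2 = 1" by simp
    then have "I\<^sup>2 * t ^ 4 = 1" by (simp add: power_mult_distrib flip: power_mult)
    then have False using full(2) I by simp
    then show ?thesis ..
  qed
  then have qrs: "q = 0" "r = 0" "s = p" and "p \<noteq> 0" using det by auto
  \<comment> \<open>(1, 2) is a point where the sextic does not vanish.\<close>
  have "binary_form 6 (- 1) (p * 1) (p * 2) = x ^ 6 * binary_form 6 (- 1 :: 'k) 1 2"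
    using inv[of 1 2] qrs by simp
  then have "p ^ 6 = x ^ 6"
    by (subst (asm) binary_form_scale) (simp_all add: binary_form_6)
  then have "(x / p) ^ 6 = 1" using \<open>p \<noteq> 0\<close> A_eq(2) by (simp add: power_divide)
  moreover have "A = mat p ** block_matrix (x / p) 1 0 0 1"
    using \<open>p \<noteq> 0\<close> by (simp add: A_eq qrs mat_mult_block_matrix)
  then have "PGL_class A = PGL_class (block_matrix (x / p) 1 0 0 1)"
    using \<open>p \<noteq> 0\<close> PGL_class_eq_iff by metis
  ultimately show ?thesis by blast
qed

end

text \<open>Conjugating t = (1 2) by the 4-cycle c yields the adjacent transpositions, and these
  yield all others. Only closure under composition is assumed of S, so the inverse of c enters as
  c^3.\<close>

lemma S4_generated:
  assumes id: "id \<in> S" and comp: "\<And>p q. p \<in> S \<Longrightarrow> q \<in> S \<Longrightarrow> p \<circ> q \<in> S"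
    and c: "c \<in> S" "c permutes {1..4}" "c 1 = 4" "c 2 = 1" "c 3 = 2" "c 4 = 3"
    and t: "t \<in> S" "t permutes {1..4}" "t 1 = 2" "t 2 = 1" "t 3 = 3" "t 4 = (4 :: nat)"
    and p: "p permutes {1..4}"
  shows "p \<in> S"
proof -
  have fixed: "c k = k" "t k = k" if "k \<notin> {1, 2, 3, 4}" for k
    using that c(2) t(2) by (auto simp: permutes_def)
  have ext: "f = g" if "f 1 = g 1" "f 2 = g 2" "f 3 = g 3" "f 4 = g 4"
    "\<And>k. k \<notin> {1, 2, 3, 4} \<Longrightarrow> f k = g k" for f g :: "nat \<Rightarrow> nat"
    using that by (metis ext insert_iff singletonD)
  note tr = Transposition.transpose_def c(3)[simplified] t(3)[simplified]
  have "Transposition.transpose 1 2 = t" "Transposition.transpose 2 3 = c \<circ> (c \<circ> (c \<circ> (t \<circ> c)))"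
    by (rule ext; auto simp: tr c t fixed)+
  then have s: "Transposition.transpose 1 2 \<in> S" "Transposition.transpose 2 3 \<in> S"
    using c(1) t(1) comp by auto
  have "Transposition.transpose 3 4 = c \<circ> (c \<circ> (c \<circ> (Transposition.transpose 2 3 \<circ> c)))"
    by (rule ext; auto simp: tr c t fixed)
  then have s3: "Transposition.transpose 3 4 \<in> S" using c(1) s comp by auto
  have "Transposition.transpose 1 3 = Transposition.transpose 1 2 \<circ> (Transposition.transpose 2 3 \<circ> Transposition.transpose 1 (2 :: nat))"
    "Transposition.transpose 2 4 = Transposition.transpose 2 3 \<circ> (Transposition.transpose 3 4 \<circ> Transposition.transpose 2 (3 :: nat))"
    by (rule ext; auto simp: tr)+
  then have s4: "Transposition.transpose 1 3 \<in> S" "Transposition.transpose 2 4 \<in> S" using s s3 comp by auto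
  have "Transposition.transpose 1 4 = Transposition.transpose 1 2 \<circ> (Transposition.transpose 2 4 \<circ> Transposition.transpose 1 (2 :: nat))"
    by (rule ext; auto simp: tr)
  then have s5: "Transposition.transpose 1 4 \<in> S" using s s4 comp by auto
  have transp: "Transposition.transpose a b \<in> S" if "a \<in> {1..4}" "b \<in> {1..4}" for a b :: nat
  proof -
    have "a = 1 \<or> a = 2 \<or> a = 3 \<or> a = 4" "b = 1 \<or> b = 2 \<or> b = 3 \<or> b = 4" using that by auto
    then show ?thesis using s s3 s4 s5 id by (auto simp: transpose_commute[of _ 1] transpose_commute[of _ "Suc 0"] transpose_commute[of 4] transpose_commute[of 3 2])
  qed
  from p finite_atLeastAtMost show ?thesis
  proof (induction rule: permutes_induct)
    case (swap a b q)
    then show ?case by (intro comp transp)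
  qed (rule id)
qed

lemma carrier_curve_Aut_C_form_6:
  "carrier (curve_Aut (C_form 6 (- 1 :: 'k::field))) = PGL_class ` {A. preserves (C_form 6 (- 1)) A}"
  by (rule carrier_curve_Aut[OF homogeneous_C_form]) simp

text \<open>The kernel of the action on face pairs is the group of homologies diag(w, 1, 1) with w^6
  = 1. They are central because every automorphism is block diagonal.\<close>

lemma central_extension_curve_Aut_C_form_6:
  "central_extension (curve_Aut (C_form 6 (- 1 :: 'k::{alg_closed_field, field_char_0})))
     (sym_group 4) (integer_mod_group 6)" (is "central_extension ?E _ ?A")
proof -
  let ?F = "C_form 6 (- 1 :: 'k)"
  note carrier = carrier_curve_Aut_C_form_6[where 'k = 'k]
  obtain I :: 'k where I: "I\<^sup>2 = - 1" using nth_root_exists[of 2 "- 1"] by auto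
  obtain \<omega> :: 'k where \<omega>: "\<And>j. \<omega> ^ j = 1 \<longleftrightarrow> 6 dvd j"
    using primitive_root_of_unity_exists[of 6] by auto
  have \<omega>6: "\<omega> ^ 6 = 1" using \<omega> by simp
  then have \<omega>0: "\<omega> \<noteq> 0" by (auto simp: power_0_left)
  have faces: "permutes_faces I A" if "preserves ?F A" for A
    using preserves_imp_permutes_faces[OF I that] .
  \<comment> \<open>Any matrix of the class will do, since \<open>face_perm\<close> ignores
    scalars.\<close>
  define \<pi> where "\<pi> X = face_perm I (SOME A. A \<in> X)" for X :: "('k^3^3) set"
  have \<pi>: "\<pi> (PGL_class A) = face_perm I A" if "preserves ?F A" for A
  proof -
    have "mat 1 ** A \<in> PGL_class A"
      unfolding PGL_class_def by (metis (mono_tags, lifting) mem_Collect_eq one_neq_zero)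
    then have "(SOME B. B \<in> PGL_class A) \<in> PGL_class A" by (rule someI)
    then obtain c where "c \<noteq> 0" "(SOME B. B \<in> PGL_class A) = mat c ** A"
      by (auto simp: PGL_class_def)
    then show ?thesis unfolding \<pi>_def using face_perm_mat_mult[OF I faces[OF that]] by simp
  qed
  have \<pi>_hom: "\<pi> (PGL_class A \<otimes>\<^bsub>?E\<^esub> PGL_class B) = \<pi> (PGL_class A) \<circ> \<pi> (PGL_class B)"
    if "preserves ?F A" "preserves ?F B" for A B
    using that by (simp add: mult_curve_Aut \<pi> preserves_mult face_perm_mult[OF I] faces)
  define z where "z a = \<omega> powi a" for a
  have z_root: "z a ^ 6 = 1" for a
  proof -
    have "z a ^ 6 = (\<omega> ^ 6) powi a"
      by (simp add: z_def power_int_power power_int_power' mult.commute)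
    then show ?thesis using \<omega>6 by simp
  qed
  have z_nonzero: "z a \<noteq> 0" for a using \<omega>0 by (simp add: z_def)
  define \<iota> where "\<iota> a = PGL_class (block_matrix (z a) 1 0 0 1)" for a
  have homology: "preserves ?F (block_matrix w 1 0 0 1)" if "w ^ 6 = 1" for w
    using that by (intro preserves_C_form_block_matrix) auto
  have \<iota>_class: "\<exists>a\<in>carrier ?A. \<iota> a = PGL_class (block_matrix w 1 0 0 1)" if w6: "w ^ 6 = 1" for w
  proof -
    obtain j where "j < 6" "w = \<omega> ^ j"
      using root_of_unity_is_power[OF _ \<omega> w6] by auto
    then show ?thesis
      by (intro bexI[of _ "int j"]) (auto simp: \<iota>_def z_def carrier_integer_mod_group)
  qed
  have "\<iota> \<in> mon ?A ?E"
    unfolding mon_def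
  proof (intro CollectI conjI homI inj_onI)
    fix a show "\<iota> a \<in> carrier ?E"
      using homology[OF z_root] by (simp add: \<iota>_def carrier)
  next
    fix a b
    have "z ((a + b) mod 6) = z (a + b)"
      unfolding z_def by (rule power_int_cong_mod[OF \<omega>6 \<omega>0]) simp
    also have "\<dots> = z a * z b" using \<omega>0 by (simp add: z_def power_int_add)
    finally show "\<iota> (a \<otimes>\<^bsub>?A\<^esub> b) = \<iota> a \<otimes>\<^bsub>?E\<^esub> \<iota> b"
      using homology[OF z_root] by (simp add: \<iota>_def mult_curve_Aut block_matrix_mult)
  next
    fix a b assume ab: "a \<in> carrier ?A" "b \<in> carrier ?A" and "\<iota> a = \<iota> b"
    then have "z a = z b"
      by (auto simp: \<iota>_def PGL_class_eq_iff mat_mult_block_matrix block_matrix_eq_iff)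
    then show "a = b"
      using power_int_eq_imp_eq[of 6 \<omega>] \<omega> ab by (simp add: z_def carrier_integer_mod_group)
  qed
  moreover have "\<pi> \<in> epi ?E (sym_group 4)"
    unfolding epi_def
  proof (intro CollectI conjI homI)
    fix X assume "X \<in> carrier ?E"
    then show "\<pi> X \<in> carrier (sym_group 4)"
      using \<pi> face_perm_permutes[OF I faces] by (auto simp: carrier sym_group_carrier)
  next
    fix X Y assume "X \<in> carrier ?E" "Y \<in> carrier ?E"
    then show "\<pi> (X \<otimes>\<^bsub>?E\<^esub> Y) = \<pi> X \<otimes>\<^bsub>sym_group 4\<^esub> \<pi> Y"
      using \<pi>_hom by (auto simp: carrier sym_group_mult)
  next
    let ?S = "\<pi> ` carrier ?E"
    have S: "face_perm I A \<in> ?S" if "preserves ?F A" for A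
      using \<pi>[OF that] that by (auto simp: carrier intro!: image_eqI[of _ _ "PGL_class A"])
    \<comment> \<open>The quarter turn multiplies the binary sextic by I and the half turn by 8;
      with these sixth roots as first entries X^6 scales alike.\<close>
    obtain x :: 'k where x: "x ^ 6 = I" using nth_root_exists[of 6 I] by auto
    obtain y :: 'k where y: "y ^ 6 = 8" using nth_root_exists[of 6 8] by auto
    have I0: "I \<noteq> 0" using I by auto
    then have xy: "x \<noteq> 0" "y \<noteq> 0" using x y by (auto simp: power_0_left)
    define c where "c = block_matrix x 1 0 0 I"
    define t where "t = block_matrix y 1 1 1 (- 1)"
    have "I ^ 5 = I"
      using I by (simp add: numeral_eq_Suc power2_eq_square flip: mult.assoc)
    then have "preserves ?F c"
      unfolding c_def using xy I0
      by (intro preserves_C_form_block_matrix) (auto simp: x binary_form_6 power_mult_distrib algebra_simps)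
    have "binary_form 6 (- 1) (a + b) (a - b) = 8 * binary_form 6 (- 1) a b" for a b :: 'k
      unfolding binary_form_6 by algebra
    then have "preserves ?F t"
      unfolding t_def using xy by (intro preserves_C_form_block_matrix) (auto simp: y)
    note ct = quarter_turn_maps_face_pair[OF I xy(1), folded c_def] half_turn_maps_face_pair[OF I xy(2), folded t_def]
    show "?S = carrier (sym_group 4)"
    proof (intro equalityI subsetI)
      fix p assume "p \<in> carrier (sym_group 4)"
      then have p: "p permutes {1..4}" by (simp add: sym_group_carrier)
      show "p \<in> ?S"
      proof (rule S4_generated[OF _ _ _ _ _ _ _ _ _ _ _ _ _ _ p])
        show "face_perm I c \<in> ?S" "face_perm I t \<in> ?S"
          using S \<open>preserves ?F c\<close> \<open>preserves ?F t\<close> by blast+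
        show "face_perm I c permutes {1..4}" "face_perm I t permutes {1..4}"
          using face_perm_permutes[OF I faces] \<open>preserves ?F c\<close> \<open>preserves ?F t\<close> by blast+
        show "face_perm I c 1 = 4" "face_perm I c 2 = 1" "face_perm I c 3 = 2" "face_perm I c 4 = 3"
          "face_perm I t 1 = 2" "face_perm I t 2 = 1" "face_perm I t 3 = 3" "face_perm I t 4 = 4"
          by (rule face_perm_eqI[OF I]; (rule ct)?; simp)+
        have "preserves ?F (mat 1)" by (rule preserves_mat1)
        moreover have "face_perm I (mat 1) = id"
        proof -
          \<comment> \<open>An idempotent bijection is the identity.\<close>
          have "face_perm I (mat 1) \<circ> face_perm I (mat 1) = face_perm I (mat 1)"
            using face_perm_mult[OF I faces[OF preserves_mat1] faces[OF preserves_mat1]] by simp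
          moreover have "bij (face_perm I (mat 1))"
            using face_perm_permutes[OF I faces[OF preserves_mat1]] by (rule permutes_bij)
          ultimately show ?thesis
            by (metis bij_is_inj comp_eq_id_dest comp_id fun.map_id0 inj_iff o_assoc)
        qed
        ultimately show "id \<in> ?S" using S by metis
        fix f g assume "f \<in> ?S" "g \<in> ?S"
        then obtain A B where AB: "f = \<pi> (PGL_class A)" "preserves ?F A" "g = \<pi> (PGL_class B)" "preserves ?F B"
          by (auto simp: carrier)
        then have "f \<circ> g = \<pi> (PGL_class (A ** B))" by (simp add: \<pi>_hom[symmetric] mult_curve_Aut)
        then show "f \<circ> g \<in> ?S" using AB by (auto simp: carrier preserves_mult)
      qed
    next
      fix p assume "p \<in> ?S"
      then show "p \<in> carrier (sym_group 4)"
        using \<pi> face_perm_permutes[OF I faces] by (auto simp: carrier sym_group_carrier)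
    qed
  qed
  moreover have "\<iota> ` carrier ?A = kernel ?E (sym_group 4) \<pi>"
  proof (intro equalityI subsetI)
    fix X assume "X \<in> \<iota> ` carrier ?A"
    then obtain a where X: "X = PGL_class (block_matrix (z a) 1 0 0 1)" by (auto simp: \<iota>_def)
    let ?B = "block_matrix (z a) 1 0 0 1"
    have inv: "invertible ?B" using z_nonzero by (simp add: invertible_block_matrix_iff)
    have "face_perm I ?B = id"
    proof
      fix k
      show "face_perm I ?B k = id k"
      proof (cases "k \<in> {1..4}")
        case True
        then have "face_perm I ?B k = k"
          by (intro face_perm_eqI[OF I inv] maps_face_pair_blockI[OF I, of 1]) auto
        then show ?thesis by simp
      qed (simp only: face_perm_outside id_apply simp_thms)
    qed
    then show "X \<in> kernel ?E (sym_group 4) \<pi>"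
      using homology[OF z_root] by (simp add: X kernel_def carrier \<pi> sym_group_one)
  next
    fix X assume "X \<in> kernel ?E (sym_group 4) \<pi>"
    then obtain A where A: "X = PGL_class A" "preserves ?F A" "face_perm I A = id"
      using \<pi> by (auto simp: kernel_def carrier sym_group_one)
    then obtain w where "w ^ 6 = 1" "X = PGL_class (block_matrix w 1 0 0 1)"
      using face_perm_eq_id_imp_homology[OF I] by blast
    then show "X \<in> \<iota> ` carrier ?A" using \<iota>_class by (metis image_eqI)
  qed
  moreover have "\<iota> a \<otimes>\<^bsub>?E\<^esub> X = X \<otimes>\<^bsub>?E\<^esub> \<iota> a" if "X \<in> carrier ?E" for a X
  proof -
    obtain A where A: "X = PGL_class A" "preserves ?F A" using \<open>X \<in> carrier ?E\<close> by (auto simp: carrier)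
    obtain x p q r s where "A = block_matrix x p q r s"
      using preserves_C_form_6_imp_block_matrix[OF I A(2)] by metis
    then show ?thesis
      using A homology[OF z_root] by (simp add: \<iota>_def mult_curve_Aut block_matrix_mult mult.commute)
  qed
  moreover have "group ?E" by (rule group_curve_Aut[OF homogeneous_C_form]) simp
  ultimately show ?thesis
    unfolding central_extension_def using sym_group_is_group
    by (intro conjI exI[of _ \<iota>] exI[of _ \<pi>]) auto
qed

section \<open>The Fermat curve\<close>

lemma homogeneous_form_linear: "homogeneous_form 1 (\<lambda>v. (T *v v) $ r)" for T :: "'k::field^3^3"
proof -
  have *: "{(i, j, l). i + j + l = (1 :: nat)} = {(1, 0, 0), (0, 1, 0), (0, 0, 1)}" by auto
  show ?thesis
    unfolding homogeneous_form_def *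
    by (rule exI[of _ "\<lambda>(i, j, l). if i = 1 then T $ r $ 1 else if j = 1 then T $ r $ 2 else T $ r $ 3"])
      (simp add: matrix_vector_mult_def sum_3 add_ac)
qed

lemma proj_point_linear_image: "(\<lambda>v. T *v v) ` proj_point v = proj_point (T *v v)"
  by (auto simp: proj_point_def simp flip: vector_scalar_commute)

text \<open>Points are sets of vectors, so the matrix acts on them by taking images; one triple of
  linear forms describes the map around every point.\<close>

lemma curve_morphism_linear:
  fixes T :: "'k::field^3^3"
  assumes T: "invertible T" and F: "\<And>v. F v = 0 \<Longrightarrow> G (T *v v) = 0"
  shows "curve_morphism (plane_curve F) (plane_curve G) ((`) (\<lambda>v. T *v v))"
proof -
  have nz: "T *v v \<noteq> 0" if "v \<noteq> 0" for v
    using T that matrix_left_invertible_ker[of T] by (auto simp: invertible_def)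
  show ?thesis
    unfolding curve_morphism_def
  proof (intro conjI ballI)
    show "(`) (\<lambda>v. T *v v) ` plane_curve F \<subseteq> plane_curve G"
      using nz F by (fastforce simp: plane_curve_def proj_point_linear_image)
    fix P assume "P \<in> plane_curve F"
    then obtain v where "P = proj_point v" "v \<noteq> 0" by (auto simp: plane_curve_def)
    then have "\<forall>w\<in>P. T *v w \<noteq> 0" by (auto simp: proj_point_def intro!: nz)
    then show "\<exists>m. \<exists>G :: 'k^3 \<Rightarrow> 'k^3. (\<forall>i. homogeneous_form m (\<lambda>v. G v $ i)) \<and> (\<forall>v\<in>P. G v \<noteq> 0) \<and>
        (\<forall>v. v \<noteq> 0 \<and> proj_point v \<in> plane_curve F \<and> G v \<noteq> 0 \<longrightarrow>
          (\<lambda>v. T *v v) ` proj_point v = proj_point (G v))"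
      by (intro exI[of _ 1] exI[of _ "\<lambda>v. T *v v"]) (auto simp: homogeneous_form_linear[simplified] proj_point_linear_image)
  qed
qed

lemma curves_isomorphic_substitution:
  fixes T :: "'k::field^3^3"
  assumes T: "invertible T" and F: "\<And>v. F v = G (T *v v)"
  shows "curves_isomorphic (plane_curve F) (plane_curve G)"
proof -
  obtain S where S: "invertible S" "T ** S = mat 1" "S ** T = mat 1"
    using T by (auto elim: invertible_inverse_matrix)
  have G: "G v = F (S *v v)" for v by (simp add: F S matrix_vector_mul_assoc)
  show ?thesis
    unfolding curves_isomorphic_def
  proof (intro exI conjI)
    show "curve_morphism (plane_curve F) (plane_curve G) ((`) (\<lambda>v. T *v v))"
      using T by (rule curve_morphism_linear) (simp add: F)
    show "curve_morphism (plane_curve G) (plane_curve F) ((`) (\<lambda>v. S *v v))"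
      using S(1) by (rule curve_morphism_linear) (simp add: G)
  qed (simp_all add: image_image matrix_vector_mul_assoc S)
qed

text \<open>The substitution rests on the identity \<open>8 a b (a\<^sup>2 + b\<^sup>2) = (a + b)^4 - (a - b)^4\<close>.\<close>

lemma C_form_4_substitution:
  fixes \<alpha> :: "'k::{alg_closed_field, field_char_0}"
  assumes "\<alpha> \<noteq> 0"
  obtains T where "invertible T" "\<And>v. C_form 4 \<alpha> v = fermat_form 4 (T *v v)"
proof -
  \<comment> \<open>Take a = Y and b = s Z in the identity. The fourth root e of -1 turns the
    difference of fourth powers into a sum, and k^4 = 1 / (8 s) removes the factor.\<close>
  obtain s where s: "s ^ 2 = \<alpha>" using nth_root_exists[of 2] by auto
  obtain e :: 'k where e: "e ^ 4 = -1" using nth_root_exists[of 4 "-1"] by auto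
  define w where "w = inverse (8 * s)"
  obtain k where k: "k ^ 4 = w" using nth_root_exists[of 4 w] by auto
  have nz: "s \<noteq> 0" using s assms by auto
  then have "k ^ 4 \<noteq> 0" "k ^ 4 * 8 * s = 1" unfolding k w_def by simp_all
  then have nz': "k \<noteq> 0" by auto
  have nz'': "e \<noteq> 0" using e by auto
  let ?T = "block_matrix 1 k (k * s) (k * e) (- (k * e * s))"
  show thesis
  proof
    have "k * - (k * e * s) - k * s * (k * e) = - 2 * (k * k * e * s)" by simp
    then show "invertible ?T"
      unfolding invertible_block_matrix_iff using nz nz' nz'' by simp
    fix v :: "'k^3"
    define y z where "y = v $ 2" and "z = v $ 3"
    have "(k * y + k * s * z) ^ 4 + (k * e * y + - (k * e * s) * z) ^ 4 =
        k ^ 4 * ((y + s * z) ^ 4 + e ^ 4 * (y - s * z) ^ 4)"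
    proof -
      have eqs: "k * y + k * s * z = k * (y + s * z)" "k * e * y + - (k * e * s) * z = k * (e * (y - s * z))"
        by (simp_all add: algebra_simps)
      show ?thesis by (simp only: eqs power_mult_distrib distrib_left[of "k ^ 4"])
    qed
    also have "\<dots> = (k ^ 4 * 8 * s) * (y ^ 3 * z + s ^ 2 * y * z ^ 3)"
      unfolding e by (simp add: algebra_simps power4_eq_xxxx power3_eq_cube power2_eq_square)
    also have "\<dots> = y ^ 3 * z + \<alpha> * y * z ^ 3"
      unfolding s \<open>k ^ 4 * 8 * s = 1\<close> by simp
    finally show "C_form 4 \<alpha> v = fermat_form 4 (?T *v v)"
      by (simp add: C_form_def fermat_form_def block_matrix_vector y_def z_def)
  qed
qed

section \<open>Automorphisms of the Fermat form are monomial\<close>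

lemma fermat_form_eq_sum: "fermat_form n v = (\<Sum>i\<in>UNIV. v $ i ^ n)"
  by (simp add: fermat_form_def sum_3)

lemma homogeneous_fermat_form: "homogeneous n (fermat_form n)"
  by (simp add: homogeneous_def fermat_form_def power_mult_distrib distrib_left)

text \<open>As in \<open>C_polar_invariant\<close> the coefficients of t are compared; they carry a
  factor n, which is cancelled.\<close>

lemma fermat_polar_invariant:
  fixes A :: "'k::field_char_0^3^3"
  assumes n: "n \<ge> 1" and inv: "\<And>v. fermat_form n (A *v v) = c * fermat_form n v"
  shows "(\<Sum>i\<in>UNIV. (A *v v) $ i * (A *v w) $ i ^ (n - 1)) = c * (\<Sum>i\<in>UNIV. v $ i * w $ i ^ (n - 1))"
proof -
  define P where "P w v = (\<Sum>i\<in>UNIV. [:w $ i, v $ i:] ^ n)" for w v :: "'k^3"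
  have poly: "poly (P w v) t = fermat_form n (w + t *s v)" for w v t
    by (simp add: P_def poly_sum fermat_form_eq_sum)
  have "coeff (P w v) 1 = of_nat n * (\<Sum>i\<in>UNIV. v $ i * w $ i ^ (n - 1))" for w v
    using n by (simp add: P_def coeff_sum coeff_linear_poly_power sum_distrib_left mult_ac)
  moreover have "P (A *v w) (A *v v) = smult c (P w v)"
  proof (rule poly_ext)
    fix t
    have "A *v w + t *s (A *v v) = A *v (w + t *s v)"
      by (simp add: matrix_vector_right_distrib vector_scalar_commute)
    then show "poly (P (A *v w) (A *v v)) t = poly (smult c (P w v)) t"
      by (simp add: poly inv)
  qed
  ultimately have "of_nat n * (\<Sum>i\<in>UNIV. (A *v v) $ i * (A *v w) $ i ^ (n - 1)) =
      of_nat n * (c * (\<Sum>i\<in>UNIV. v $ i * w $ i ^ (n - 1)))"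
    by (metis coeff_smult mult.left_commute)
  then show ?thesis using n by simp
qed

lemma matrix_vector_axis: "A *v axis j 1 = column j A" for A :: "'k::field^'n^'m"
  by (simp add: matrix_vector_mult_def axis_def column_def vec_eq_iff if_distrib[of "\<lambda>x. _ * x"] cong: if_cong)

text \<open>The polar of the coordinate point e_j is a pure power. Pulled back by A to the line
  through e_k and e_l it becomes the power of A_jk y + A_jl with exponent n - 1, but it is also
  proportional to the polar of the preimage of e_j, which on this line has only the terms y^(n-1)
  and 1.\<close>

lemma preserves_fermat_form_row:
  fixes A :: "'k::field_char_0^3^3"
  assumes n: "n \<ge> 3" and A: "preserves (fermat_form n) A" and kl: "k \<noteq> l"
  shows "A $ j $ k = 0 \<or> A $ j $ l = 0"
proof -
  obtain B where B: "A ** B = mat 1" "B ** A = mat 1"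
    using A by (auto simp: preserves_def elim: invertible_inverse_matrix)
  obtain c where c: "c \<noteq> 0" "\<And>v. fermat_form n (B *v v) = c * fermat_form n v"
    using preserves_inverse[OF A B] by (auto simp: preserves_def)
  have "B $ k $ j * y ^ (n - 1) + B $ l $ j = c * (A $ j $ k * y + A $ j $ l) ^ (n - 1)" for y
  proof -
    define u :: "'k^3" where "u = y *s axis k 1 + axis l 1"
    have "(\<Sum>i\<in>UNIV. (B *v axis j 1) $ i * (B *v (A *v u)) $ i ^ (n - 1)) =
        c * (\<Sum>i\<in>UNIV. axis j 1 $ i * (A *v u) $ i ^ (n - 1))"
      using n by (intro fermat_polar_invariant c) auto
    moreover have "B *v (A *v u) = u" by (simp add: B matrix_vector_mul_assoc)
    moreover have "(\<Sum>i\<in>UNIV. axis j 1 $ i * (A *v u) $ i ^ (n - 1)) = (A *v u) $ j ^ (n - 1)"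
      by (simp add: axis_def if_distrib[of "\<lambda>x. x * _"] cong: if_cong)
    moreover have "(A *v u) $ j = A $ j $ k * y + A $ j $ l"
      by (simp add: u_def matrix_vector_right_distrib vector_scalar_commute matrix_vector_axis column_def mult.commute)
    moreover have "(\<Sum>i\<in>UNIV. (B *v axis j 1) $ i * u $ i ^ (n - 1)) =
        (\<Sum>i\<in>UNIV. (if i = k then B $ k $ j * y ^ (n - 1) else 0) + (if i = l then B $ l $ j else 0))"
      using n kl unfolding matrix_vector_axis column_def
      by (intro sum.cong) (auto simp: u_def axis_def power_0_left)
    ultimately show ?thesis by (simp add: sum.distrib)
  qed
  from binomial_eq_linear_power[OF _ c(1) this] n show ?thesis by auto
qed

text \<open>Indexed by rows, so products compose the permutations in reverse order; this is why
  inverse permutations appear in \<open>curve_Aut_fermat_form\<close>.\<close>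

definition monomial_matrix :: "('n \<Rightarrow> 'n) \<Rightarrow> ('n \<Rightarrow> 'k) \<Rightarrow> 'k::field^'n^'n" where
  "monomial_matrix \<pi> x = (\<chi> i j. if j = \<pi> i then x i else 0)"

lemma monomial_matrix_vector: "(monomial_matrix \<pi> x *v v) $ i = x i * v $ \<pi> i"
  by (simp add: monomial_matrix_def matrix_vector_mult_def if_distrib[of "\<lambda>x. x * _"] cong: if_cong)

lemma monomial_matrix_mult:
  "monomial_matrix \<pi> x ** monomial_matrix \<rho> y = monomial_matrix (\<rho> \<circ> \<pi>) (\<lambda>i. x i * y (\<pi> i))"
  by (auto simp: vec_eq_iff monomial_matrix_def matrix_matrix_mult_def if_distrib[of "\<lambda>x. x * _"] cong: if_cong)

lemma mat_mult_monomial_matrix: "mat c ** monomial_matrix \<pi> x = monomial_matrix \<pi> (\<lambda>i. c * x i)"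
  by (auto simp: vec_eq_iff) (simp add: monomial_matrix_def)

lemma monomial_matrix_eq_iff:
  assumes "\<And>i. x i \<noteq> 0"
  shows "monomial_matrix \<pi> x = monomial_matrix \<rho> y \<longleftrightarrow> \<pi> = \<rho> \<and> x = y"
proof
  assume eq: "monomial_matrix \<pi> x = monomial_matrix \<rho> y"
  have "x i = (if \<pi> i = \<rho> i then y i else 0)" for i
    using arg_cong[OF eq, of "\<lambda>A. A $ i $ \<pi> i"] by (simp add: monomial_matrix_def)
  then have "\<pi> i = \<rho> i \<and> x i = y i" for i
    using assms by metis
  then show "\<pi> = \<rho> \<and> x = y" by auto
qed simp

lemma preserves_fermat_form_monomial_matrix:
  fixes x :: "3 \<Rightarrow> 'k::field"
  assumes \<pi>: "bij \<pi>" and x: "\<And>i. x i \<noteq> 0" "\<And>i. x i ^ n = 1"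
  shows "preserves (fermat_form n) (monomial_matrix \<pi> x)"
  unfolding preserves_def
proof (intro conjI exI allI)
  have "v = 0" if "monomial_matrix \<pi> x *v v = 0" for v
  proof -
    have "v $ \<pi> i = 0" for i
      using monomial_matrix_vector[of \<pi> x v i] x that by simp
    then show ?thesis using \<pi> by (metis bij_pointE vec_eq_iff zero_index)
  qed
  then show "invertible (monomial_matrix \<pi> x)"
    unfolding invertible_left_inverse matrix_left_invertible_ker by blast
  fix v
  have "fermat_form n (monomial_matrix \<pi> x *v v) = (\<Sum>i\<in>UNIV. v $ \<pi> i ^ n)"
    by (simp add: fermat_form_eq_sum monomial_matrix_vector power_mult_distrib x)
  also have "\<dots> = fermat_form n v"
    unfolding fermat_form_eq_sum using \<pi> by (rule sum.reindex_bij_betw)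
  finally show "fermat_form n (monomial_matrix \<pi> x *v v) = 1 * fermat_form n v" by simp
qed simp

text \<open>Each row has at most one nonzero entry by \<open>preserves_fermat_form_row\<close>, and
  at least one since A is invertible. The values of the form at coordinate points show that the
  entries have equal n-th powers.\<close>

lemma preserves_fermat_form_monomial:
  fixes A :: "'k::field_char_0^3^3"
  assumes n: "n \<ge> 3" and A: "preserves (fermat_form n) A"
  obtains \<pi> x c where "bij \<pi>" "c \<noteq> 0" "\<And>i. x i ^ n = c" "A = monomial_matrix \<pi> x"
proof -
  obtain c where c: "c \<noteq> 0" "\<And>v. fermat_form n (A *v v) = c * fermat_form n v"
    using A by (auto simp: preserves_def)
  obtain B where B: "A ** B = mat 1" "B ** A = mat 1"
    using A by (auto simp: preserves_def elim: invertible_inverse_matrix)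
  have row: "\<exists>j. A $ i $ j \<noteq> 0" for i
  proof (rule ccontr)
    assume "\<not> ?thesis"
    then have "(A ** B) $ i $ i = 0" by (simp add: matrix_matrix_mult_def)
    then show False by (simp add: B mat_def)
  qed
  define \<pi> where "\<pi> i = (SOME j. A $ i $ j \<noteq> 0)" for i
  define x where "x i = A $ i $ \<pi> i" for i
  have x: "x i \<noteq> 0" for i unfolding x_def \<pi>_def using row by (rule someI_ex)
  have A_eq: "A = monomial_matrix \<pi> x"
    using preserves_fermat_form_row[OF n A] x by (auto simp: monomial_matrix_def vec_eq_iff x_def)
  then have Av: "(A *v v) $ i = x i * v $ \<pi> i" for v i
    by (simp add: monomial_matrix_vector)
  have "inj \<pi>"
  proof (rule injI)
    fix i i' assume eq: "\<pi> i = \<pi> i'"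
    \<comment> \<open>If rows i and i' have their entries in the same column, the coordinates i and
      i' of any A w vanish together; w = B e_i gives A w = e_i.\<close>
    have "A *v (B *v axis i 1) = axis i 1" by (simp add: B matrix_vector_mul_assoc)
    then have *: "x l * (B *v axis i 1) $ \<pi> l = axis i 1 $ l" for l
      by (metis Av)
    have "axis i (1 :: 'k) $ i' \<noteq> 0"
    proof
      assume "axis i (1 :: 'k) $ i' = 0"
      then have "(B *v axis i 1) $ \<pi> i' = 0" using *[of i'] x[of i'] by simp
      then have "axis i (1 :: 'k) $ i = 0" using *[of i] eq by simp
      then show False by (simp add: axis_def)
    qed
    then show "i = i'" by (auto simp: axis_def split: if_splits)
  qed
  then have "bij \<pi>" by (simp add: bij_def finite_UNIV_inj_surj)
  moreover have "x i ^ n = c" for i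
  proof -
    have "(\<Sum>l\<in>UNIV. (x l * axis (\<pi> i) 1 $ \<pi> l) ^ n) = (\<Sum>l\<in>UNIV. if l = i then x i ^ n else 0)"
      using n \<open>inj \<pi>\<close> by (intro sum.cong) (auto simp: axis_def power_0_left dest: injD)
    moreover have "fermat_form n (axis (\<pi> i) 1 :: 'k^3) = 1"
      using n by (simp add: fermat_form_eq_sum axis_def if_distrib[of "\<lambda>x. x ^ _"] power_0_left cong: if_cong)
    ultimately show ?thesis
      using c(2)[of "axis (\<pi> i) 1"] by (simp add: fermat_form_eq_sum[of _ "A *v _"] Av)
  qed
  ultimately show thesis using that c(1) A_eq by blast
qed

section \<open>The extension of S_3 by (Z/n)^2 as a group of matrices\<close>

definition index3 :: "3 \<Rightarrow> nat" where
  "index3 i = (if i = 1 then 1 else if i = 2 then 2 else 3)"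

text \<open>Rows are indexed by the numeral type \<open>3\<close>, in which 3 = 0, whereas
  \<open>sym_group 3\<close> acts on {1..3}; this bijection translates.\<close>

lemma bij_betw_index3: "bij_betw index3 UNIV {1..3}"
proof -
  have "inj index3" unfolding inj_def using exhaust_3 by (auto simp: index3_def)
  moreover have "range index3 = {1..3}" unfolding UNIV_3 by (auto simp: index3_def)
  ultimately show ?thesis by (simp add: bij_betw_def)
qed

abbreviation of_index3 :: "nat \<Rightarrow> 3" where
  "of_index3 \<equiv> inv_into UNIV index3"

lemma of_index3_index3 [simp]: "of_index3 (index3 i) = i"
  using bij_betw_index3 by (simp add: bij_betw_def)

lemma index3_of_index3 [simp]: "k \<in> {1..3} \<Longrightarrow> index3 (of_index3 k) = k"
  using bij_betw_index3 by (simp add: bij_betw_inv_into_right)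

lemma index3_in [simp]: "index3 i \<in> {1..3}"
  using bij_betw_index3 by (auto simp: bij_betw_def)

text \<open>The coordinates of the representative (a, b, 0) of a class modulo the diagonal.\<close>

definition S3_coordinate :: "int \<times> int \<Rightarrow> nat \<Rightarrow> int" where
  "S3_coordinate ab i = (if i = 1 then fst ab else if i = 2 then snd ab else 0)"

lemma S3_action_eq:
  "S3_action n p ab =
    ((S3_coordinate ab (inv' p 1) - S3_coordinate ab (inv' p 3)) mod int n,
     (S3_coordinate ab (inv' p 2) - S3_coordinate ab (inv' p 3)) mod int n)"
  by (simp add: S3_action_def S3_coordinate_def Let_def)

text \<open>A permutation may move a nonzero entry to the third place; subtracting it from all
  coordinates returns to the representative that ends in 0.\<close>

lemma S3_coordinate_action:
  assumes "i \<in> {1..3}"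
  shows "S3_coordinate (S3_action n p ab) i =
    (S3_coordinate ab (inv' p i) - S3_coordinate ab (inv' p 3)) mod int n"
proof -
  have "i = 1 \<or> i = 2 \<or> i = 3" using assms by auto
  then show ?thesis by (auto simp: S3_action_eq S3_coordinate_def[of "(_, _)"])
qed

lemma Zn_squared_S3_simps:
  assumes "n > 0"
  shows "carrier (Zn_squared_S3 n) = ({0..<int n} \<times> {0..<int n}) \<times> {p. p permutes {1..3}}"
    "(ab, p) \<otimes>\<^bsub>Zn_squared_S3 n\<^esub> (cd, q) =
       (((fst ab + fst (S3_action n p cd)) mod int n, (snd ab + snd (S3_action n p cd)) mod int n), p \<circ> q)"
  using assms by (auto simp: Zn_squared_S3_def semidirect_product_def carrier_integer_mod_group
      sym_group_def DirProd_def split: prod.splits)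

lemma group_Zn_squared_S3:
  assumes n: "n > 0"
  shows "group (Zn_squared_S3 n)"
  unfolding Zn_squared_S3_def
proof (rule group_semidirect_product)
  let ?N = "integer_mod_group n \<times>\<times> integer_mod_group n"
  show "group ?N" by (simp add: DirProd_group)
  show "group (sym_group 3)" by (rule sym_group_is_group)
  have N: "carrier ?N = {0..<int n} \<times> {0..<int n}"
    using n by (simp add: DirProd_def carrier_integer_mod_group)
  fix p assume "p \<in> carrier (sym_group 3)"
  then have p: "p permutes {1..3}" by (simp add: sym_group_carrier)
  show "S3_action n p \<in> hom ?N ?N"
  proof (rule homI)
    fix x y
    have "S3_coordinate (x \<otimes>\<^bsub>?N\<^esub> y) i mod int n = (S3_coordinate x i + S3_coordinate y i) mod int n" for i
      by (cases x; cases y) (simp add: S3_coordinate_def DirProd_def)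
    then have "(S3_coordinate (x \<otimes>\<^bsub>?N\<^esub> y) i - S3_coordinate (x \<otimes>\<^bsub>?N\<^esub> y) j) mod int n =
        ((S3_coordinate x i - S3_coordinate x j) mod int n + (S3_coordinate y i - S3_coordinate y j) mod int n) mod int n" for i j
      by (metis (no_types, opaque_lifting) add_diff_add mod_add_eq mod_diff_eq)
    then show "S3_action n p (x \<otimes>\<^bsub>?N\<^esub> y) = S3_action n p x \<otimes>\<^bsub>?N\<^esub> S3_action n p y"
      by (simp add: S3_action_eq)
  next
    fix x
    show "S3_action n p x \<in> carrier ?N" using n by (auto simp: S3_action_eq carrier_integer_mod_group)
  qed
  fix q x assume "q \<in> carrier (sym_group 3)"
  then have q: "q permutes {1..3}" by (simp add: sym_group_carrier)
  \<comment> \<open>Coordinates are read at the inverse permutation, and inversion reverses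
    products, so a left action results.\<close>
  have "inv' (p \<circ> q) = inv' q \<circ> inv' p"
    using p q by (simp add: o_inv_distrib permutes_bij)
  moreover have "inv' p i \<in> {1..3}" if "i \<in> {1..3}" for i
    using permutes_in_image[OF permutes_inv[OF p]] that by blast
  ultimately show "S3_action n (p \<otimes>\<^bsub>sym_group 3\<^esub> q) x = S3_action n p (S3_action n q x)"
    by (simp add: S3_action_eq[of n p] S3_action_eq[of n "p \<circ> q"] S3_coordinate_action sym_group_mult mod_diff_eq)
next
  let ?N = "integer_mod_group n \<times>\<times> integer_mod_group n"
  fix x assume "x \<in> carrier ?N"
  then show "S3_action n \<one>\<^bsub>sym_group 3\<^esub> x = x"
    using n by (auto simp: S3_action_eq sym_group_one S3_coordinate_def DirProd_def carrier_integer_mod_group)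
qed

text \<open>((a, b), p) is sent to a monomial matrix with entries zeta^a, zeta^b, 1. Matrices modulo
  scalars correspond to exponents modulo the diagonal, the module on which \<open>S3_action\<close>
  is defined.\<close>

lemma curve_Aut_fermat_form:
  assumes n: "n \<ge> 3"
  shows "curve_Aut (fermat_form n :: 'k::{alg_closed_field, field_char_0}^3 \<Rightarrow> 'k) \<cong> Zn_squared_S3 n"
proof -
  have "n > 0" using n by simp
  note carrier = Zn_squared_S3_simps(1)[OF \<open>n > 0\<close>] and mult = Zn_squared_S3_simps(2)[OF \<open>n > 0\<close>]
  obtain \<zeta> :: 'k where \<zeta>: "\<And>j. \<zeta> ^ j = 1 \<longleftrightarrow> n dvd j"
    using primitive_root_of_unity_exists[OF \<open>n > 0\<close>] by blast
  have \<zeta>n: "\<zeta> ^ n = 1" using \<zeta> by simp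
  then have \<zeta>0: "\<zeta> \<noteq> 0" using n by (auto simp: power_0_left)
  define z where "z a = \<zeta> powi a" for a
  have z_add: "z (a + b) = z a * z b" for a b
    using \<zeta>0 by (simp add: z_def power_int_add)
  have z_cong: "z a = z b" if "a mod int n = b mod int n" for a b
    unfolding z_def by (rule power_int_cong_mod[OF \<zeta>n \<zeta>0 that])
  have z0: "z 0 = 1" by (simp add: z_def)
  have z_nonzero: "z a \<noteq> 0" for a using \<zeta>0 by (simp add: z_def)
  have z_root: "z a ^ n = 1" for a
  proof -
    have "z a ^ n = z (a * int n)" by (simp add: z_def power_int_mult)
    also have "\<dots> = z 0" by (rule z_cong) simp
    finally show ?thesis by (simp add: z0)
  qed
  define \<pi> where "\<pi> p i = of_index3 (inv' p (index3 i))" for p i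
  have inv_in: "inv' p k \<in> {1..3}" if "p permutes {1..3}" "k \<in> {1..3}" for p k
    using permutes_in_image[OF permutes_inv[OF that(1)]] that(2) by blast
  have index3_\<pi>: "index3 (\<pi> p i) = inv' p (index3 i)" if "p permutes {1..3}" for p i
    unfolding \<pi>_def by (rule index3_of_index3[OF inv_in[OF that index3_in]])
  have bij_\<pi>: "bij (\<pi> p)" if p: "p permutes {1..3}" for p
  proof -
    have "inj (\<pi> p)"
    proof (rule injI)
      fix i j assume "\<pi> p i = \<pi> p j"
      then have "inv' p (index3 i) = inv' p (index3 j)" using index3_\<pi>[OF p] by metis
      then have "index3 i = index3 j" using p by (metis permutes_inverses(1))
      then show "i = j" by (metis of_index3_index3)
    qed
    then show ?thesis by (simp add: bij_def finite_UNIV_inj_surj)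
  qed
  have \<pi>_comp: "\<pi> (p \<circ> q) = \<pi> q \<circ> \<pi> p" if "p permutes {1..3}" "q permutes {1..3}" for p q
    using that by (auto simp: fun_eq_iff \<pi>_def[of "p \<circ> q"] \<pi>_def[of q] index3_\<pi> o_inv_distrib permutes_bij)
  define x where "x ab i = z (S3_coordinate ab (index3 i))" for ab i
  define M where "M = (\<lambda>(ab, p). monomial_matrix (\<pi> p) (x ab))"
  show ?thesis
  proof (rule curve_Aut_isoI[OF homogeneous_fermat_form group_Zn_squared_S3[OF \<open>n > 0\<close>], where M = M])
    fix g assume "g \<in> carrier (Zn_squared_S3 n)"
    then show "preserves (fermat_form n) (M g)"
      by (auto simp: carrier M_def x_def z_nonzero z_root bij_\<pi> intro!: preserves_fermat_form_monomial_matrix)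
  next
    fix g h assume "g \<in> carrier (Zn_squared_S3 n)" "h \<in> carrier (Zn_squared_S3 n)"
    then obtain ab p cd q where gh: "g = (ab, p)" "h = (cd, q)" and p: "p permutes {1..3}" "q permutes {1..3}"
      by (auto simp: carrier)
    define ef where "ef = ((fst ab + fst (S3_action n p cd)) mod int n, (snd ab + snd (S3_action n p cd)) mod int n)"
    \<comment> \<open>The third row of the product matrix has the entry zeta^e; dividing by it is
      the renormalisation built into \<open>S3_action\<close>.\<close>
    define e where "e = S3_coordinate cd (inv' p 3)"
    have "x ab i * x cd (\<pi> p i) = z e * x ef i" for i
    proof -
      have "S3_coordinate ef (index3 i) mod int n =
          (S3_coordinate ab (index3 i) + S3_coordinate (S3_action n p cd) (index3 i)) mod int n"
        by (simp add: ef_def S3_coordinate_def)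
      also have "\<dots> = (S3_coordinate ab (index3 i) + (S3_coordinate cd (inv' p (index3 i)) - e)) mod int n"
        unfolding S3_coordinate_action[OF index3_in] e_def by (rule mod_add_right_eq)
      finally have "x ef i = z (S3_coordinate ab (index3 i) + (S3_coordinate cd (inv' p (index3 i)) - e))"
        unfolding x_def by (rule z_cong)
      then have "z e * x ef i = z (S3_coordinate ab (index3 i) + S3_coordinate cd (inv' p (index3 i)))"
        by (simp flip: z_add)
      then show ?thesis by (simp add: x_def z_add index3_\<pi>[OF p(1)])
    qed
    then have "M g ** M h = mat (z e) ** M (g \<otimes>\<^bsub>Zn_squared_S3 n\<^esub> h)"
      by (simp add: gh M_def mult monomial_matrix_mult mat_mult_monomial_matrix \<pi>_comp[OF p] flip: ef_def)
    then show "PGL_class (M (g \<otimes>\<^bsub>Zn_squared_S3 n\<^esub> h)) = PGL_class (M g ** M h)"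
      using z_nonzero by (auto simp: PGL_class_eq_iff)
  next
    fix g h assume gh: "g \<in> carrier (Zn_squared_S3 n)" "h \<in> carrier (Zn_squared_S3 n)"
      and eq: "PGL_class (M g) = PGL_class (M h)"
    obtain a b p a' b' q where g: "g = ((a, b), p)" and h: "h = ((a', b'), q)"
      by (metis surj_pair)
    obtain c where "M h = mat c ** M g" using eq by (auto simp: PGL_class_eq_iff)
    then have *: "\<pi> q = \<pi> p" "x (a', b') = (\<lambda>i. c * x (a, b) i)"
      using monomial_matrix_eq_iff[of "x (a', b')"] z_nonzero
      by (auto simp: g h M_def mat_mult_monomial_matrix x_def)
    \<comment> \<open>Both third entries are normalised to 1.\<close>
    have "c = 1" using fun_cong[OF *(2), of 3] by (simp add: x_def S3_coordinate_def index3_def z0)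
    then have "z a' = z a" "z b' = z b"
      using fun_cong[OF *(2), of 1] fun_cong[OF *(2), of 2] by (simp_all add: x_def S3_coordinate_def index3_def)
    then have "a' = a" "b' = b"
      using gh power_int_eq_imp_eq[OF \<open>n > 0\<close> \<zeta>] by (auto simp: z_def g h carrier)
    moreover have "p = q"
    proof -
      have pq: "p permutes {1..3}" "q permutes {1..3}" using gh by (auto simp: g h carrier)
      have "inv' p k = inv' q k" for k
      proof (cases "k \<in> {1..3}")
        case True
        then show ?thesis using index3_\<pi>[OF pq(1), of "of_index3 k"] index3_\<pi>[OF pq(2), of "of_index3 k"] *(1) by simp
      next
        case False
        then show ?thesis using pq by (metis permutes_inv permutes_not_in)
      qed
      then show ?thesis using pq by (metis ext permutes_inv_inv)
    qed
    ultimately show "g = h" by (simp add: g h)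
  next
    fix A :: "'k^3^3" assume "preserves (fermat_form n) A"
    then obtain \<rho> y c where \<rho>: "bij \<rho>" and c: "c \<noteq> 0" "\<And>i. y i ^ n = c" and A: "A = monomial_matrix \<rho> y"
      using preserves_fermat_form_monomial[OF n] by metis
    have y: "y i \<noteq> 0" for i using c n by (metis not_numeral_le_zero power_0_left)
    \<comment> \<open>All y i have the same n-th power c, so their quotients are n-th roots of
      unity.\<close>
    have "\<exists>a\<in>{0..<int n}. y i / y 3 = z a" for i
    proof -
      have "(y i / y 3) ^ n = 1" using c by (simp add: power_divide)
      then obtain j where "j < n" "y i / y 3 = \<zeta> ^ j"
        using root_of_unity_is_power[OF \<open>n > 0\<close> \<zeta>] by blast
      then show ?thesis by (intro bexI[of _ "int j"]) (auto simp: z_def)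
    qed
    then obtain a b where ab: "a \<in> {0..<int n}" "b \<in> {0..<int n}" "y 1 / y 3 = z a" "y 2 / y 3 = z b"
      by metis
    \<comment> \<open>The permutation rho carried over to {1..3}; the required group element is its
      inverse, as \<open>M\<close> uses inverse permutations.\<close>
    define q where "q k = (if k \<in> {1..3} then index3 (\<rho> (of_index3 k)) else k)" for k
    have "q permutes {1..3}"
    proof (rule bij_imp_permutes)
      have "bij_betw (index3 \<circ> \<rho> \<circ> of_index3) {1..3} {1..3}"
        using bij_betw_index3 \<rho> bij_betw_inv_into[OF bij_betw_index3] by (blast intro: bij_betw_trans)
      then show "bij_betw q {1..3} {1..3}"
        by (rule bij_betw_cong[THEN iffD1, rotated]) (simp add: q_def)
    next
      fix k :: nat assume "k \<notin> {1..3}"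
      then show "q k = k" unfolding q_def by (rule if_not_P)
    qed
    then have q: "inv' q permutes {1..3}" "inv' (inv' q) = q"
      by (simp_all add: permutes_inv permutes_inv_inv)
    have "q (index3 i) = index3 (\<rho> i)" for i
      unfolding q_def by (simp only: index3_in if_True of_index3_index3)
    then have "\<pi> (inv' q) = \<rho>"
      by (simp add: fun_eq_iff \<pi>_def q(2))
    moreover have "x (a, b) = (\<lambda>i. inverse (y 3) * y i)"
    proof
      fix i
      show "x (a, b) i = inverse (y 3) * y i"
        using ab y[of 3] exhaust_3[of i] by (auto simp: x_def S3_coordinate_def index3_def z0 field_simps)
    qed
    ultimately have "M ((a, b), inv' q) = mat (inverse (y 3)) ** A"
      by (simp add: M_def A mat_mult_monomial_matrix)
    then have "PGL_class A = PGL_class (M ((a, b), inv' q))"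
      using y[of 3] by (auto simp: PGL_class_eq_iff intro!: exI[of _ "inverse (y 3)"])
    then show "\<exists>g\<in>carrier (Zn_squared_S3 n). PGL_class (M g) = PGL_class A"
      using ab q by (intro bexI[of _ "((a, b), inv' q)"]) (auto simp: carrier)
  qed
qed

section \<open>The automorphism groups\<close>

theorem proposition41:
  fixes d :: nat and \<alpha> :: "'k::{alg_closed_field, field_char_0}"
  assumes "d \<ge> 4" and "\<alpha> \<noteq> 0"
  shows "(d \<noteq> 4 \<and> d \<noteq> 6 \<longrightarrow>
            curve_Aut (C_form d \<alpha>) \<cong> presented_group (C_relations d) \<and>
            central_extension (curve_Aut (C_form d \<alpha>)) (dihedral_group (d - 2)) (integer_mod_group d) \<and>
            Coset.order (curve_Aut (C_form d \<alpha>)) = 2 * d * (d - 2)) \<and>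
         (d = 6 \<longrightarrow>
            central_extension (curve_Aut (C_form d \<alpha>)) (sym_group 4) (integer_mod_group 6) \<and>
            Coset.order (curve_Aut (C_form d \<alpha>)) = 144) \<and>
         (d = 4 \<longrightarrow>
            curves_isomorphic (plane_curve (C_form d \<alpha>)) (plane_curve (fermat_form 4)) \<and>
            curve_Aut (C_form d \<alpha>) \<cong> Zn_squared_S3 4)"
proof -
  have group: "group (curve_Aut (C_form d \<alpha>))"
    using assms(1) by (intro group_curve_Aut[OF homogeneous_C_form]) auto
  have change: "curve_Aut (C_form d \<alpha>) \<cong> curve_Aut (C_form d \<beta>)" if "\<beta> \<noteq> 0" for \<beta> :: 'k
    using assms that by (intro curve_Aut_C_form_change_parameter) auto
  show ?thesis
  proof (intro conjI impI; (elim conjE)?)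
    assume d: "d \<noteq> 4" "d \<noteq> 6"
    \<comment> \<open>Parameter 1, so that the form is symmetric in Y and Z.\<close>
    note change[OF one_neq_zero]
    also have iso: "curve_Aut (C_form d (1 :: 'k)) \<cong> metacyclic_group (d * (d - 2)) (1 - int d)"
      using assms(1) d by (intro curve_Aut_C_form_iso_metacyclic_group) auto
    finally have iso: "curve_Aut (C_form d \<alpha>) \<cong> metacyclic_group (d * (d - 2)) (1 - int d)" .
    also have "\<dots> \<cong> presented_group (C_relations d)"
      using assms(1) by (rule metacyclic_group_iso_presented_group)
    finally show "curve_Aut (C_form d \<alpha>) \<cong> presented_group (C_relations d)" .
    show ext: "central_extension (curve_Aut (C_form d \<alpha>)) (dihedral_group (d - 2)) (integer_mod_group d)"
      using central_extension_iso[OF iso group central_extension_metacyclic_group] assms(1) by simp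
    show "Coset.order (curve_Aut (C_form d \<alpha>)) = 2 * d * (d - 2)"
      using assms(1) unfolding order_central_extension[OF ext] dihedral_group_def order_semidirect_product
      by (simp add: order_integer_mod_group)
  next
    assume d: "d = 6"
    \<comment> \<open>Parameter -1, for which the roots of the sextic are the vertices of the
      standard octahedron.\<close>
    have "curve_Aut (C_form 6 \<alpha>) \<cong> curve_Aut (C_form 6 (- 1 :: 'k))"
      using change[of "- 1"] d by simp
    then show ext: "central_extension (curve_Aut (C_form d \<alpha>)) (sym_group 4) (integer_mod_group 6)"
      using central_extension_iso[OF _ group central_extension_curve_Aut_C_form_6] d by simp
    have "card {p. p permutes {1..4 :: nat}} = fact 4"
      by (intro card_permutations) auto
    then have "Coset.order (sym_group 4) = 24"
      by (simp add: Coset.order_def sym_group_def fact_numeral)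
    then show "Coset.order (curve_Aut (C_form d \<alpha>)) = 144"
      unfolding order_central_extension[OF ext] by (simp add: order_integer_mod_group)
  next
    assume d: "d = 4"
    obtain T where T: "invertible T" "\<And>v. C_form 4 \<alpha> v = fermat_form 4 (T *v v)"
      using C_form_4_substitution[OF assms(2)] by blast
    show "curves_isomorphic (plane_curve (C_form d \<alpha>)) (plane_curve (fermat_form 4))"
      unfolding d using T by (rule curves_isomorphic_substitution)
    have "curve_Aut (C_form d \<alpha>) \<cong> curve_Aut (fermat_form 4 :: 'k^3 \<Rightarrow> 'k)"
      unfolding d using T by (intro curve_Aut_substitution[OF homogeneous_fermat_form, of T 1]) auto
    also have "\<dots> \<cong> Zn_squared_S3 4"
      by (rule curve_Aut_fermat_form) simp
    finally show "curve_Aut (C_form d \<alpha>) \<cong> Zn_squared_S3 4" .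
  qed
qed

end
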